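(* There exists a meromorphic function $F$ on $\mathbb C$ which is real, i.e. $F(\overline z)=\overline{F(z)}$, such that $$F^{-1}\bigl(\{0,1,\infty\}\bigr)\subset\mathbb R,$$ and each of the three sets $F^{-1}(0)$, $F^{-1}(1)$, and $F^{-1}(\infty)$ is infinite. Moreover, for every $a\in\widehat{\mathbb C}\setminus\{0,1,\infty\}$, the $a$-point divisor of $F$ in each of the half-planes $\mathbb H^{+}$ and $\mathbb H^{-}$ fails the Blaschke condition. In particular, $F$ is not of bounded type in either half-plane $\mathbb H^{+}$ or $\mathbb H^{-}$.
   Context: Notation: $\mathbb H^{+}=\{z\in\mathbb C:\operatorname{Im}z>0\}$, $\mathbb H^{-}=\{z\in\mathbb C:\operatorname{Im}z<0\}$, $\widehat{\mathbb C}=\mathbb C\cup\{\infty\}$. For $a\in\mathbb C$, the $a$-point divisor of a meromorphic function $F$ consists of the zeros of $F-a$, counted with multiplicities; for $a=\infty$ it is the pole divisor of $F$. The $a$-point divisor in a half-plane is its restriction to that half-plane. A discrete divisor $Z$ in $\mathbb H^{+}$ or in $\mathbb H^{-}$ satisfies the Blaschke condition if $$\sum_{z\in Z}\frac{|\operatorname{Im}z|}{1+|z|^2}<\infty,$$ with multiplicities counted. A meromorphic function in a domain is of bounded type if it is a quotient of two bounded holomorphic functions on that domain (the denominator not identically zero). *)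

theory Defs
  imports "HOL-Complex_Analysis.Complex_Analysis"
begin

definition upper_half_plane :: "complex set" where
  "upper_half_plane = {z. Im z > 0}"

definition lower_half_plane :: "complex set" where
  "lower_half_plane = {z. Im z < 0}"

(* None is the point at infinity, as in Alexandroff_extension. *)
type_synonym extended_complex = "complex option"

(* A function that is nicely_meromorphic_on a set takes the dummy value 0 at its poles there.
   sphere_map replaces that value by infinity, so that preimages under sphere_map F are
   preimages under F regarded as a map to the Riemann sphere. *)
definition sphere_map :: "(complex \<Rightarrow> complex) \<Rightarrow> complex \<Rightarrow> extended_complex" where
  "sphere_map F z = (if is_pole F z then None else Some (F z))"

(* A divisor is given by its multiplicity function. *)
type_synonym divisor = "complex \<Rightarrow> nat"

(* Only meaningful for non-constant nicely meromorphic F; the support is then discrete.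
   At an a-point with a finite, zorder is the order of vanishing of F - a; at a pole,
   zorder is minus the order of the pole. *)
definition point_divisor :: "(complex \<Rightarrow> complex) \<Rightarrow> extended_complex \<Rightarrow> divisor" where
  "point_divisor F a z =
     (if sphere_map F z \<noteq> a then 0
      else case a of
             None \<Rightarrow> nat (- zorder F z)
           | Some c \<Rightarrow> nat (zorder (\<lambda>w. F w - c) z))"

definition restrict_divisor :: "divisor \<Rightarrow> complex set \<Rightarrow> divisor" where
  "restrict_divisor Z D z = (if z \<in> D then Z z else 0)"

definition blaschke_condition :: "divisor \<Rightarrow> bool" where
  "blaschke_condition Z \<longleftrightarrow>
     (\<lambda>z. real (Z z) * (\<bar>Im z\<bar> / (1 + (cmod z)\<^sup>2))) summable_on UNIV"

(* For a meromorphic F on a domain D. Equality of meromorphic functions is equality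
   off a set without accumulation points in D. *)
definition bounded_type_on :: "(complex \<Rightarrow> complex) \<Rightarrow> complex set \<Rightarrow> bool" where
  "bounded_type_on F D \<longleftrightarrow>
     (\<exists>g h. g holomorphic_on D \<and> bounded (g ` D) \<and>
            h holomorphic_on D \<and> bounded (h ` D) \<and>
            (\<exists>z\<in>D. h z \<noteq> 0) \<and>
            (\<forall>\<^sub>\<approx>z\<in>D. F z = g z / h z))"

end

theory Submission
  imports Defs "HOL-Real_Asymp.Real_Asymp" "HOL-Computational_Algebra.Fundamental_Theorem_Algebra"
begin

text \<open>In the coordinate \<open>y = 1 / z\<close> the function is \<open>R0 (lim (B\<^sub>0 \<circ> B\<^sub>1 \<circ> \<dots> \<circ> B\<^sub>n) y)\<close>, where
  \<open>R0 x = x\<^sup>3 (2 - x) / (2 x - 1)\<close> takes the values \<open>0\<close>, \<open>1\<close>, \<open>\<infinity>\<close> only on the real line, while every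
  other value has a nonreal preimage. Each block \<open>B\<^sub>n\<close> is a composition of folds
  \<open>y \<mapsto> y + d\<^sup>2 / (y - m)\<close>. A fold is real and its critical values are \<open>m \<plusminus> 2 d\<close>; if these are
  neighbouring points of a finite real set \<open>S\<close>, then the preimage of \<open>S\<close> is again real, so all points
  over \<open>0\<close>, \<open>1\<close>, \<open>\<infinity>\<close> stay real. The folds of \<open>B\<^sub>n\<close> live in a tiny window near \<open>0\<close>, which makes the
  blocks close to the identity elsewhere and the limit exist for \<open>y \<noteq> 0\<close>; the point \<open>y = 0\<close> is
  \<open>z = \<infinity>\<close>. At the isolated singularities, great Picard yields meromorphy.

  The mass of a fiber is \<open>\<Sum> \<bar>Im y\<bar>\<close>. The signed sum \<open>\<Sum> Im y\<close> is not changed by a fold, so a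
  large mass is shared by both half-planes, and since the preimages stay in a bounded region,
  Blaschke fails as soon as the blocks make the mass arbitrarily large on compact subsets.
  That folding can make the mass unbounded is proved by contradiction. The window cannot shrink,
  by Schottky's theorem. If the mass over \<open>\<i>\<close> stayed bounded, integrals of logarithmic potentials of
  the fibers would show that a definite part of the window is mapped to points at moderate
  distance from \<open>S\<close> and from \<open>\<infinity>\<close>, and by the Schwarz-Pick lemma folding the gaps between vertices
  there increases the mass by a definite amount each time.

  A quotient of bounded functions would have only Blaschke-many \<open>a\<close>-points.\<close>

section \<open>Folds\<close>

text \<open>Real vertices force a fold to use a whole gap between neighbouring vertices. Its size
  cannot be chosen, so its gain of mass has to be estimated, and the estimate is good only for gaps
  with well separated points whose images stay away from \<open>S\<close> and from infinity. Such
  points come from Chebyshev's inequality: the difference of the potentials of the fibers over s + i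
  and s + \<kappa> i is nonnegative, is large where the image is close to s, and its integral is
  \<pi> times a difference of masses. This is at most \<pi> times the mass over s + i, however small
  \<kappa> is. A similar test for infinity has a bound independent of its height \<Lambda>. A bound
  on the mass thus limits the set of bad points.

  New blocks enter on the inside of the composition, so closeness to the identity alone does not
  give convergence; Cauchy estimates supply Lipschitz bounds for the outer blocks. Near a given z
  the limit is split into finitely many outer blocks, which are rational, and a tail that is
  injective near 1/z and close to the identity there.\<close>

text \<open>A pair \<open>(m, d)\<close> encodes the fold \<open>y \<mapsto> y + d\<^sup>2 / (y - m)\<close>.\<close>

definition jfold :: "real \<times> real \<Rightarrow> complex \<Rightarrow> complex" where
  "jfold f y = y + of_real ((snd f)\<^sup>2) / (y - of_real (fst f))"

definition rfold :: "real \<times> real \<Rightarrow> real \<Rightarrow> real" where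
  "rfold f y = y + (snd f)\<^sup>2 / (y - fst f)"

text \<open>The branch of the inverse that is close to the identity near infinity.\<close>

definition rlift :: "real \<times> real \<Rightarrow> real \<Rightarrow> real" where
  "rlift f x = fst f + (x - fst f + sgn (x - fst f) * sqrt ((x - fst f)\<^sup>2 - 4 * (snd f)\<^sup>2)) / 2"

text \<open>The interval between the two critical values: the part of the real line that
  \<open>rfold\<close> omits away from the pole. Its points have only nonreal preimages.\<close>

definition gate :: "real \<times> real \<Rightarrow> real set" where
  "gate f = {fst f - 2 * snd f <..< fst f + 2 * snd f}"

lemma jfold_of_real [simp]: "jfold f (of_real x) = of_real (rfold f x)"
  by (simp add: jfold_def rfold_def)

lemma jfold_cnj: "jfold f (cnj y) = cnj (jfold f y)"
  by (simp add: jfold_def)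

section \<open>Order properties of a fold on the real line\<close>

lemma rlift_ge:
  assumes "snd f > 0" "x \<ge> fst f + 2 * snd f"
  shows "rlift f x \<ge> fst f + snd f" "rfold f (rlift f x) = x"
proof -
  define z where "z = x - fst f"
  define d where "d = snd f"
  define s where "s = (z + sqrt (z\<^sup>2 - 4 * d\<^sup>2)) / 2"
  have z: "z \<ge> 2 * d" "d > 0" using assms by (auto simp: z_def d_def)
  have eq: "rlift f x = fst f + s"
    using z by (simp add: rlift_def s_def z_def[symmetric] d_def[symmetric])
  have "z\<^sup>2 - 4 * d\<^sup>2 \<ge> 0"
    using power_mono[of "2 * d" z 2] z by (simp add: power_mult_distrib)
  hence sq: "(sqrt (z\<^sup>2 - 4 * d\<^sup>2))\<^sup>2 = z\<^sup>2 - 4 * d\<^sup>2" by simp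
  have "sqrt (z\<^sup>2 - 4 * d\<^sup>2) \<ge> 0" using \<open>z\<^sup>2 - 4 * d\<^sup>2 \<ge> 0\<close> by simp
  moreover have "d \<le> (z + q) / 2" if "q \<ge> 0" for q using z that by simp
  ultimately have sd: "s \<ge> d" unfolding s_def by blast
  have "s\<^sup>2 - z * s + d\<^sup>2 = 0"
    using sq by (simp add: s_def power2_eq_square field_simps)
  hence "s + d\<^sup>2 / s = z" using sd z by (simp add: field_simps power2_eq_square)
  thus "rlift f x \<ge> fst f + snd f" "rfold f (rlift f x) = x"
    using sd by (auto simp: eq rfold_def z_def d_def)
qed

text \<open>A fold commutes with the reflection in its pole, so statements to the left of the gate
  follow from those to the right.\<close>

lemma rlift_reflect: "rlift (m, d) (2 * m - x) = 2 * m - rlift (m, d) x"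
proof -
  have 1: "m - x = - (x - m)" by simp
  have "sgn (m - x) = - sgn (x - m)" "(m - x)\<^sup>2 = (x - m)\<^sup>2"
    by (subst 1, rule sgn_minus, subst 1, rule power2_minus)
  moreover have "2 * m - x - m = m - x" by simp
  ultimately show ?thesis by (simp add: rlift_def field_simps)
qed

lemma rfold_reflect: "rfold (m, d) (2 * m - x) = 2 * m - rfold (m, d) x"
proof -
  have "d\<^sup>2 / (m - x) = - (d\<^sup>2 / (x - m))"
    by (metis minus_diff_eq minus_divide_right)
  moreover have "2 * m - x - m = m - x" by simp
  ultimately show ?thesis by (simp add: rfold_def)
qed

lemma rlift_le:
  assumes "snd f > 0" "x \<le> fst f - 2 * snd f"
  shows "rlift f x \<le> fst f - snd f" "rfold f (rlift f x) = x"
proof -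
  obtain m d where f: "f = (m, d)" by force
  have *: "snd (m,d) > 0" "2 * m - x \<ge> fst (m,d) + 2 * snd (m,d)" using assms f by auto
  show "rlift f x \<le> fst f - snd f" using rlift_ge(1)[OF *] by (simp add: rlift_reflect f)
  show "rfold f (rlift f x) = x"
    using rlift_ge(2)[OF *] by (simp add: rlift_reflect rfold_reflect f)
qed

lemma not_gate_cases:
  assumes "snd f > 0" "x \<notin> gate f"
  obtains "x \<ge> fst f + 2 * snd f" | "x \<le> fst f - 2 * snd f"
  using assms by (force simp: gate_def)

lemma rfold_rlift: "snd f > 0 \<Longrightarrow> x \<notin> gate f \<Longrightarrow> rfold f (rlift f x) = x"
  using not_gate_cases[of f x] rlift_ge(2)[of f x] rlift_le(2)[of f x] by metis

lemma abs_rlift_ge: "snd f > 0 \<Longrightarrow> x \<notin> gate f \<Longrightarrow> \<bar>rlift f x - fst f\<bar> \<ge> snd f"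
  using not_gate_cases[of f x] rlift_ge(1)[of f x] rlift_le(1)[of f x] by (smt (verit))

lemma rlift_ne: "snd f > 0 \<Longrightarrow> x \<notin> gate f \<Longrightarrow> rlift f x \<noteq> fst f"
  using abs_rlift_ge[of f x] by auto

text \<open>An exact difference quotient. Comparing \<open>(y - fst f) * (y' - fst f)\<close> with
  \<open>(snd f)\<^sup>2\<close> gives monotonicity away from the pole; the sign of the product
  decides whether the fold shortens the interval.\<close>

lemma rfold_diff:
  assumes "y \<noteq> fst f" "y' \<noteq> fst f"
  shows "rfold f y' - rfold f y = (y' - y) * (1 - (snd f)\<^sup>2 / ((y - fst f) * (y' - fst f)))"
proof -
  define s where "s = y - fst f"
  define s' where "s' = y' - fst f"
  have y: "y = fst f + s" "y' = fst f + s'" by (simp_all add: s_def s'_def)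
  have "s \<noteq> 0" "s' \<noteq> 0" using assms by (auto simp: s_def s'_def)
  thus ?thesis by (simp add: rfold_def y field_simps)
qed

lemma rfold_strict_mono:
  assumes "snd f > 0" "y \<ge> fst f + snd f" "y < y'"
  shows "rfold f y < rfold f y'"
proof -
  have "(snd f)\<^sup>2 < (y - fst f) * (y' - fst f)"
    unfolding power2_eq_square using assms by (intro mult_le_less_imp_less) auto
  hence "(snd f)\<^sup>2 / ((y - fst f) * (y' - fst f)) < 1"
    using assms by (simp add: divide_less_eq)
  hence "(y' - y) * (1 - (snd f)\<^sup>2 / ((y - fst f) * (y' - fst f))) > 0"
    using assms by simp
  thus ?thesis using rfold_diff[of y f y'] assms by simp
qed

lemma rfold_strict_mono':
  assumes "snd f > 0" "y' \<le> fst f - snd f" "y < y'"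
  shows "rfold f y < rfold f y'"
proof -
  obtain m d where f: "f = (m, d)" by force
  have "rfold (m,d) (2 * m - y') < rfold (m,d) (2 * m - y)"
    by (rule rfold_strict_mono) (use assms f in auto)
  thus ?thesis by (simp add: rfold_reflect f)
qed

lemma rfold_ge:
  assumes "snd f > 0" "y > fst f" shows "rfold f y \<ge> fst f + 2 * snd f"
proof -
  have "(y - fst f - snd f)\<^sup>2 \<ge> 0" by simp
  thus ?thesis using assms by (simp add: rfold_def field_simps power2_eq_square)
qed

lemma rfold_le:
  assumes "snd f > 0" "y < fst f" shows "rfold f y \<le> fst f - 2 * snd f"
proof -
  obtain m d where f: "f = (m, d)" by force
  have "rfold (m,d) (2 * m - y) \<ge> fst (m,d) + 2 * snd (m,d)"
    by (rule rfold_ge) (use assms f in auto)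
  thus ?thesis by (simp add: rfold_reflect f)
qed

lemma rfold_notin_gate: "snd f > 0 \<Longrightarrow> y \<noteq> fst f \<Longrightarrow> rfold f y \<notin> gate f"
  using rfold_ge[of f y] rfold_le[of f y] by (cases "y < fst f") (auto simp: gate_def)

lemma rlift_unique:
  assumes "snd f > 0" "\<bar>y - fst f\<bar> \<ge> snd f"
  shows "rlift f (rfold f y) = y"
proof -
  have ne: "y \<noteq> fst f" using assms by auto
  have ng: "rfold f y \<notin> gate f" using rfold_notin_gate assms ne by blast
  have eq: "rfold f (rlift f (rfold f y)) = rfold f y" using rfold_rlift[OF assms(1) ng] .
  let ?z = "rlift f (rfold f y)"
  show ?thesis
  proof (cases "y \<ge> fst f + snd f")
    case True
    have "?z \<ge> fst f + snd f" using rfold_ge[of f y] assms True rlift_ge(1) by auto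
    thus ?thesis using rfold_strict_mono[of f y ?z] rfold_strict_mono[of f ?z y] eq True assms
      by (metis less_irrefl linorder_neqE_linordered_idom)
  next
    case False
    hence l: "y \<le> fst f - snd f" using assms by linarith
    have "?z \<le> fst f - snd f" using rfold_le[of f y] assms l rlift_le(1) by auto
    thus ?thesis using rfold_strict_mono'[of f y ?z] rfold_strict_mono'[of f ?z y] eq l assms
      by (metis less_irrefl linorder_neqE_linordered_idom)
  qed
qed

lemma rlift_strict_mono:
  assumes "snd f > 0" "x \<notin> gate f" "x' \<notin> gate f" "x < x'"
  shows "rlift f x < rlift f x'"
  using not_gate_cases[OF assms(1,2)]
proof cases
  case 1
  hence 2: "x' \<ge> fst f + 2 * snd f" using assms by simp
  show ?thesis
  proof (rule ccontr)
    assume "\<not> ?thesis"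
    hence "rfold f (rlift f x') \<le> rfold f (rlift f x)"
      using rfold_strict_mono[of f "rlift f x'" "rlift f x"] rlift_ge(1)[OF assms(1) 2] assms
      by (cases "rlift f x' = rlift f x") auto
    thus False using rfold_rlift assms by simp
  qed
next
  case 2
  note l = rlift_le[OF assms(1) 2]
  show ?thesis using not_gate_cases[OF assms(1,3)]
  proof cases
    case 1
    thus ?thesis using l(1) rlift_ge(1)[OF assms(1) 1] assms(1) by linarith
  next
    case 2
    show ?thesis
    proof (rule ccontr)
      assume "\<not> ?thesis"
      hence "rfold f (rlift f x') \<le> rfold f (rlift f x)"
        using rfold_strict_mono'[of f "rlift f x" "rlift f x'"] l assms
        by (cases "rlift f x' = rlift f x") auto
      thus False using rfold_rlift assms by simp
    qed
  qed
qed

lemma rlift_mono: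
  assumes "snd f > 0" "x \<notin> gate f" "x' \<notin> gate f" "x \<le> x'"
  shows "rlift f x \<le> rlift f x'"
  using rlift_strict_mono[OF assms(1-3)] assms(4) by (cases "x = x'") auto

text \<open>On one side of the pole the second factor in \<open>rfold_diff\<close> is at most 1: the
  fold shortens intervals there and its inverse lengthens them. Hence sides that wait to be folded
  never shrink.\<close>

lemma rlift_expand:
  assumes "snd f > 0" "x \<le> x'" "x \<ge> fst f + 2 * snd f \<or> x' \<le> fst f - 2 * snd f"
  shows "x' - x \<le> rlift f x' - rlift f x"
proof -
  have ng: "x \<notin> gate f" "x' \<notin> gate f" using assms by (auto simp: gate_def)
  have ne: "rlift f x \<noteq> fst f" "rlift f x' \<noteq> fst f" using rlift_ne assms ng by auto
  have "(rlift f x - fst f) * (rlift f x' - fst f) \<ge> 0"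
    using assms(3)
  proof
    assume a: "x \<ge> fst f + 2 * snd f"
    hence "x' \<ge> fst f + 2 * snd f" using assms by simp
    thus ?thesis using rlift_ge(1) a assms(1) by (intro mult_nonneg_nonneg) (smt (verit))+
  next
    assume a: "x' \<le> fst f - 2 * snd f"
    hence "x \<le> fst f - 2 * snd f" using assms by simp
    thus ?thesis using rlift_le(1) a assms(1) by (intro mult_nonpos_nonpos) (smt (verit))+
  qed
  hence "(snd f)\<^sup>2 / ((rlift f x - fst f) * (rlift f x' - fst f)) \<ge> 0" by simp
  hence "(rlift f x' - rlift f x) * (1 - (snd f)\<^sup>2 / ((rlift f x - fst f) * (rlift f x' - fst f)))
      \<le> rlift f x' - rlift f x"
    using rlift_mono[OF assms(1) ng assms(2)] by (intro mult_left_le) auto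
  thus ?thesis using rfold_diff[OF ne, of] rfold_rlift[OF assms(1)] ng by simp
qed

lemma rlift_toward:
  assumes "snd f > 0" "x \<notin> gate f"
  shows "x - rlift f x = (snd f)\<^sup>2 / (rlift f x - fst f)"
  using rfold_rlift[OF assms] by (simp add: rfold_def)

lemma rlift_toward_ge:
  assumes "snd f > 0" "x \<ge> fst f + 2 * snd f" shows "rlift f x \<le> x"
proof -
  have "rlift f x - fst f \<ge> 0" using rlift_ge(1)[OF assms] assms by simp
  hence "(snd f)\<^sup>2 / (rlift f x - fst f) \<ge> 0" by simp
  thus ?thesis using rlift_toward[of f x] assms by (simp add: gate_def)
qed

lemma rlift_toward_le:
  assumes "snd f > 0" "x \<le> fst f - 2 * snd f" shows "rlift f x \<ge> x"
proof -
  have "rlift f x - fst f \<le> 0" using rlift_le(1)[OF assms] assms by simp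
  hence "(snd f)\<^sup>2 / (rlift f x - fst f) \<le> 0" by (simp add: divide_nonneg_nonpos)
  thus ?thesis using rlift_toward[of f x] assms by (simp add: gate_def)
qed

section \<open>The two complex preimages under a fold\<close>

definition fold_fiber :: "real \<times> real \<Rightarrow> complex \<Rightarrow> complex set" where
  "fold_fiber f z = {y. y \<noteq> of_real (fst f) \<and> jfold f y = z}"

lemma jfold_eq_iff:
  assumes "y \<noteq> of_real (fst f)"
  shows "jfold f y = z \<longleftrightarrow>
    (y - of_real (fst f))\<^sup>2 - (z - of_real (fst f)) * (y - of_real (fst f)) + of_real ((snd f)\<^sup>2) = 0"
  using assms by (auto simp: jfold_def field_simps power2_eq_square)

lemma fold_fiber_eq:
  assumes "snd f > 0" and r: "r\<^sup>2 = (z - of_real (fst f))\<^sup>2 - 4 * of_real ((snd f)\<^sup>2)"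
  shows "fold_fiber f z = {of_real (fst f) + (z - of_real (fst f) + r) / 2,
                           of_real (fst f) + (z - of_real (fst f) - r) / 2}"
proof -
  define w where "w = z - of_real (fst f)"
  define d where "d = complex_of_real (snd f)"
  have d: "d \<noteq> 0" using assms by (simp add: d_def)
  have r': "r\<^sup>2 = w\<^sup>2 - 4 * d\<^sup>2" using r by (simp add: w_def d_def)
  have key: "s\<^sup>2 - w * s + d\<^sup>2 = (s - (w + r) / 2) * (s - (w - r) / 2)" for s
  proof -
    have "(s - (w + r) / 2) * (s - (w - r) / 2) = s\<^sup>2 - w * s + (w\<^sup>2 - r\<^sup>2) / 4"
      by (simp add: field_simps power2_eq_square)
    thus ?thesis by (simp add: r')
  qed
  have "y \<in> fold_fiber f z \<longleftrightarrow> y = of_real (fst f) + (w + r) / 2 \<or> y = of_real (fst f) + (w - r) / 2" for y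
  proof -
    define s where "s = y - of_real (fst f)"
    have y: "y = of_real (fst f) + s" by (simp add: s_def)
    have "y \<in> fold_fiber f z \<longleftrightarrow> s \<noteq> 0 \<and> s\<^sup>2 - w * s + d\<^sup>2 = 0"
      using jfold_eq_iff[of y f z] unfolding fold_fiber_def by (auto simp: y w_def d_def)
    also have "\<dots> \<longleftrightarrow> s\<^sup>2 - w * s + d\<^sup>2 = 0" using d by auto
    also have "\<dots> \<longleftrightarrow> s = (w + r) / 2 \<or> s = (w - r) / 2" by (auto simp: key)
    finally show ?thesis by (auto simp: y)
  qed
  thus ?thesis by (auto simp: w_def)
qed

lemma fold_disc_zero_iff:
  "(z - of_real (fst f))\<^sup>2 - 4 * of_real ((snd f)\<^sup>2) = (0::complex) \<longleftrightarrow>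
    z = of_real (fst f - 2 * snd f) \<or> z = of_real (fst f + 2 * snd f)"
proof -
  have "(z - of_real (fst f))\<^sup>2 - 4 * of_real ((snd f)\<^sup>2)
      = (z - of_real (fst f - 2 * snd f)) * (z - of_real (fst f + 2 * snd f))"
    by (simp add: power2_eq_square algebra_simps)
  thus ?thesis by simp
qed

lemma fold_fiber_nonempty:
  assumes "snd f > 0" shows "fold_fiber f z \<noteq> {}" "finite (fold_fiber f z)"
proof -
  define r where "r = csqrt ((z - of_real (fst f))\<^sup>2 - 4 * of_real ((snd f)\<^sup>2))"
  have "r\<^sup>2 = (z - of_real (fst f))\<^sup>2 - 4 * of_real ((snd f)\<^sup>2)" by (simp add: r_def)
  from fold_fiber_eq[OF assms this] show "fold_fiber f z \<noteq> {}" "finite (fold_fiber f z)" by auto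
qed

text \<open>Vieta's relations for the quadratic in \<open>y - of_real (fst f)\<close>. The excluded
  values are the critical ones, where the roots collide. The last clause is the factored quadratic,
  from which products over whole fibers are built.\<close>

lemma fold_fiber_two:
  assumes "snd f > 0" "z \<noteq> of_real (fst f - 2 * snd f)" "z \<noteq> of_real (fst f + 2 * snd f)"
  obtains y1 y2 where "fold_fiber f z = {y1, y2}" "y1 \<noteq> y2" "y1 + y2 = z + of_real (fst f)"
    "(y1 - of_real (fst f)) * (y2 - of_real (fst f)) = of_real ((snd f)\<^sup>2)"
    "\<And>x. x \<noteq> of_real (fst f) \<Longrightarrow> (x - y1) * (x - y2) = (jfold f x - z) * (x - of_real (fst f))"
proof -
  define m where "m = complex_of_real (fst f)"
  define r where "r = csqrt ((z - m)\<^sup>2 - 4 * of_real ((snd f)\<^sup>2))"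
  have r: "r\<^sup>2 = (z - m)\<^sup>2 - 4 * of_real ((snd f)\<^sup>2)" by (simp add: r_def)
  have "r \<noteq> 0" using fold_disc_zero_iff[of z f] assms r by (auto simp: m_def)
  define y1 where "y1 = m + (z - m + r) / 2"
  define y2 where "y2 = m + (z - m - r) / 2"
  have p: "(y1 - m) * (y2 - m) = of_real ((snd f)\<^sup>2)"
  proof -
    have "(y1 - m) * (y2 - m) = ((z - m)\<^sup>2 - r\<^sup>2) / 4"
      by (simp add: y1_def y2_def power2_eq_square algebra_simps)
    thus ?thesis by (simp add: r)
  qed
  have s: "y1 + y2 = z + m" by (simp add: y1_def y2_def field_simps)
  show ?thesis
  proof (rule that)
    show "fold_fiber f z = {y1, y2}" using fold_fiber_eq[OF assms(1), of r z] r
      by (simp add: y1_def y2_def m_def)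
    show "y1 \<noteq> y2" using \<open>r \<noteq> 0\<close> by (simp add: y1_def y2_def)
    show "y1 + y2 = z + of_real (fst f)" "(y1 - of_real (fst f)) * (y2 - of_real (fst f)) = of_real ((snd f)\<^sup>2)"
      using s p by (simp_all add: m_def)
    show "(x - y1) * (x - y2) = (jfold f x - z) * (x - of_real (fst f))" if "x \<noteq> of_real (fst f)" for x
    proof -
      have "(x - y1) * (x - y2) = (x - m)\<^sup>2 - (y1 + y2 - 2 * m) * (x - m) + (y1 - m) * (y2 - m)"
        by (simp add: power2_eq_square algebra_simps)
      also have "\<dots> = (x - m)\<^sup>2 - (z - m) * (x - m) + of_real ((snd f)\<^sup>2)" by (simp add: p s)
      also have "\<dots> = (jfold f x - z) * (x - m)"
        using that by (simp add: jfold_def m_def field_simps power2_eq_square)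
      finally show ?thesis by (simp add: m_def)
    qed
  qed
qed

section \<open>Compositions of folds\<close>

text \<open>The head of the list is the innermost fold.\<close>

fun fold_comp :: "(real \<times> real) list \<Rightarrow> complex \<Rightarrow> complex" where
  "fold_comp [] y = y"
| "fold_comp (f # fs) y = fold_comp fs (jfold f y)"

text \<open>At its pole a fold returns the dummy value \<open>of_real (fst f)\<close>, because of
  the division by zero. Points whose orbit meets a pole are therefore collected and excluded
  explicitly.\<close>

fun poles :: "(real \<times> real) list \<Rightarrow> complex set" where
  "poles [] = {}"
| "poles (f # fs) = insert (of_real (fst f)) {y. y \<noteq> of_real (fst f) \<and> jfold f y \<in> poles fs}"

text \<open>The finite preimages of \<open>S\<close> and infinity: every fold fixes infinity, so a
  point that meets a pole stays over infinity.\<close>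

definition vert :: "complex set \<Rightarrow> (real \<times> real) list \<Rightarrow> complex set" where
  "vert S fs = poles fs \<union> {y. y \<notin> poles fs \<and> fold_comp fs y \<in> S}"

definition fiber :: "(real \<times> real) list \<Rightarrow> complex \<Rightarrow> complex set" where
  "fiber fs b = {y. y \<notin> poles fs \<and> fold_comp fs y = b}"

text \<open>Applied to \<open>a\<close> and \<open>b\<close>, this gives the ends of the current
  window.\<close>

fun rlifts :: "(real \<times> real) list \<Rightarrow> real \<Rightarrow> real" where
  "rlifts [] x = x"
| "rlifts (f # fs) x = rlift f (rlifts fs x)"

text \<open>The critical values of each fold are neighbouring vertices of the folds outside it. This keeps
  all vertices real.\<close>

fun admissible :: "complex set \<Rightarrow> real \<Rightarrow> real \<Rightarrow> (real \<times> real) list \<Rightarrow> bool" where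
  "admissible S a b [] \<longleftrightarrow> True"
| "admissible S a b (f # fs) \<longleftrightarrow> admissible S a b fs \<and> snd f > 0 \<and>
     of_real (fst f - 2 * snd f) \<in> vert S fs \<and> of_real (fst f + 2 * snd f) \<in> vert S fs \<and>
     (\<forall>x\<in>gate f. of_real x \<notin> vert S fs) \<and>
     rlifts fs a \<le> fst f - 2 * snd f \<and> fst f + 2 * snd f \<le> rlifts fs b"

lemma vert_Nil [simp]: "vert S [] = S"
  by (simp add: vert_def)

lemma vert_Cons: "vert S (f # fs) = insert (of_real (fst f)) {y. y \<noteq> of_real (fst f) \<and> jfold f y \<in> vert S fs}"
  by (auto simp: vert_def)

lemma vert_mono: "S \<subseteq> S' \<Longrightarrow> vert S fs \<subseteq> vert S' fs"
  by (auto simp: vert_def)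

lemma poles_subset_vert: "poles fs \<subseteq> vert S fs"
  by (auto simp: vert_def)

lemma fiber_Nil [simp]: "fiber [] b = {b}"
  by (auto simp: fiber_def)

lemma fiber_Cons: "fiber (f # fs) b = (\<Union>z\<in>fiber fs b. fold_fiber f z)"
  by (auto simp: fiber_def fold_fiber_def)

lemma fiber_subset_vert: "b \<in> S \<Longrightarrow> fiber fs b \<subseteq> vert S fs"
  by (auto simp: fiber_def vert_def)

lemma fiber_disjoint_vert: "b \<notin> S \<Longrightarrow> fiber fs b \<inter> vert S fs = {}"
  by (auto simp: fiber_def vert_def)

lemma finite_fiber: "list_all (\<lambda>f. snd f > 0) fs \<Longrightarrow> finite (fiber fs b)"
  by (induction fs) (auto simp: fiber_Cons fold_fiber_nonempty)

lemma fold_fiber_disjoint: "z \<noteq> z' \<Longrightarrow> fold_fiber f z \<inter> fold_fiber f z' = {}"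
  by (auto simp: fold_fiber_def)

lemma fold_comp_cnj: "fold_comp fs (cnj y) = cnj (fold_comp fs y)"
  by (induction fs arbitrary: y) (auto simp: jfold_cnj)

lemma poles_cnj: "cnj y \<in> poles fs \<longleftrightarrow> y \<in> poles fs"
proof (induction fs arbitrary: y)
  case (Cons f fs)
  have "cnj y = of_real (fst f) \<longleftrightarrow> y = of_real (fst f)" by (metis complex_cnj_cnj complex_cnj_complex_of_real)
  thus ?case using Cons by (auto simp: jfold_cnj)
qed auto

lemma fiber_cnj: "fiber fs (cnj b) = cnj ` fiber fs b"
proof -
  have "y \<in> fiber fs (cnj b) \<longleftrightarrow> cnj y \<in> fiber fs b" for y
  proof -
    have "fold_comp fs y = cnj b \<longleftrightarrow> fold_comp fs (cnj y) = b"
      by (metis complex_cnj_cnj fold_comp_cnj)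
    thus ?thesis by (simp add: fiber_def poles_cnj)
  qed
  moreover have "y \<in> cnj ` A \<longleftrightarrow> cnj y \<in> A" for y A
    using image_eqI[of y cnj "cnj y" A] by auto
  ultimately show ?thesis by blast
qed

lemma jfold_holomorphic: "jfold f holomorphic_on - {of_real (fst f)}"
  unfolding jfold_def[abs_def] by (auto intro!: holomorphic_intros)

lemma fold_comp_real: "y \<in> \<real> \<Longrightarrow> fold_comp fs y \<in> \<real>"
  by (induction fs arbitrary: y) (auto simp: jfold_def elim!: Reals_cases)

lemma jfold_has_derivative:
  "y \<noteq> of_real (fst f) \<Longrightarrow>
    (jfold f has_field_derivative 1 - of_real ((snd f)\<^sup>2) / (y - of_real (fst f))\<^sup>2) (at y)"
  unfolding jfold_def[abs_def]
  by (auto intro!: derivative_eq_intros simp: power2_eq_square)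

lemma jfold_deriv_zero:
  assumes "y \<noteq> of_real (fst f)" "1 - of_real ((snd f)\<^sup>2) / (y - of_real (fst f))\<^sup>2 = (0::complex)"
  shows "jfold f y = of_real (fst f - 2 * snd f) \<or> jfold f y = of_real (fst f + 2 * snd f)"
proof -
  define s where "s = y - of_real (fst f)"
  have s: "s \<noteq> 0" using assms by (simp add: s_def)
  have y: "y = of_real (fst f) + s" by (simp add: s_def)
  have "s\<^sup>2 = (of_real (snd f))\<^sup>2" using assms(2) s by (simp add: s_def[symmetric] field_simps)
  hence "s = of_real (snd f) \<or> s = - of_real (snd f)" by (simp add: power2_eq_iff)
  thus ?thesis using s by (auto simp: jfold_def y power2_eq_square field_simps)
qed

text \<open>The ends \<open>a\<close> and \<open>b\<close> are counted among \<open>S\<close>. Their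
  lifts are then vertices at every stage, so each gap inside the current window is bounded by two
  vertices.\<close>

locale window =
  fixes S :: "complex set" and a b :: real
  assumes fin: "finite S" and real: "S \<subseteq> \<real>" and ab: "a < b"
    and aS: "of_real a \<in> S" and bS: "of_real b \<in> S"
begin

abbreviation "len \<equiv> b - a"
abbreviation "adm \<equiv> admissible S a b"

text \<open>A fold with parameter d moves a point at distance at least \<open>len\<close> from its
  pole by at most \<open>d\<^sup>2 / len\<close>; this sum is the total displacement up to the
  factor \<open>len\<close>.\<close>

definition energy :: "(real \<times> real) list \<Rightarrow> real" where
  "energy fs = (\<Sum>f\<leftarrow>fs. (snd f)\<^sup>2)"

lemma adm_pos: "adm fs \<Longrightarrow> list_all (\<lambda>f. snd f > 0) fs"
  by (induction fs) auto

lemma finite_fiber': "adm fs \<Longrightarrow> finite (fiber fs z)"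
  using finite_fiber adm_pos by blast

lemma finite_vert: "adm fs \<Longrightarrow> finite (vert S fs)"
proof (induction fs)
  case (Cons f fs)
  have "vert S (f # fs) \<subseteq> insert (of_real (fst f)) (\<Union>z\<in>vert S fs. fold_fiber f z)"
    by (auto simp: vert_Cons fold_fiber_def)
  thus ?case using Cons by (auto intro!: finite_subset[of "vert S (f # fs)"] fold_fiber_nonempty)
qed (auto simp: fin)

text \<open>Outside the gate the discriminant is the square of a real number. The distances of the
  two preimages to the pole multiply to \<open>(snd f)\<^sup>2\<close>, so the second one is the
  inverse of the lift in the circle of radius \<open>snd f\<close>.\<close>

lemma fold_fiber_real:
  assumes "snd f > 0" "x \<notin> gate f" "y \<in> fold_fiber f (of_real x)"
  shows "y = of_real (rlift f x) \<or> y = of_real (fst f + (snd f)\<^sup>2 / (rlift f x - fst f))"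
proof -
  define s where "s = rlift f x - fst f"
  have s: "s \<noteq> 0" using rlift_ne assms by (auto simp: s_def)
  have x: "x - fst f = s + (snd f)\<^sup>2 / s"
    using rlift_toward[OF assms(1,2)] by (simp add: s_def)
  define r where "r = complex_of_real (s - (snd f)\<^sup>2 / s)"
  have c: "(of_real x - of_real (fst f) :: complex) = of_real (s + (snd f)\<^sup>2 / s)"
    unfolding of_real_diff[symmetric] x ..
  have "(s - (snd f)\<^sup>2 / s)\<^sup>2 = (s + (snd f)\<^sup>2 / s)\<^sup>2 - 4 * (snd f)\<^sup>2"
    using s by (simp add: power2_eq_square field_simps)
  hence "complex_of_real ((s - (snd f)\<^sup>2 / s)\<^sup>2) = of_real ((s + (snd f)\<^sup>2 / s)\<^sup>2 - 4 * (snd f)\<^sup>2)"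
    by (rule arg_cong)
  hence "r\<^sup>2 = (of_real x - of_real (fst f))\<^sup>2 - 4 * of_real ((snd f)\<^sup>2)"
    unfolding r_def c by simp
  from fold_fiber_eq[OF assms(1) this] assms(3)
  have "y = of_real (fst f) + (of_real (s + (snd f)\<^sup>2 / s) + r) / 2 \<or>
        y = of_real (fst f) + (of_real (s + (snd f)\<^sup>2 / s) - r) / 2" by (simp add: c)
  moreover have "s + q + (s - q) = 2 * s" "s + q - (s - q) = 2 * q" for q by simp_all
  ultimately have "y = of_real (fst f + s) \<or> y = of_real (fst f + (snd f)\<^sup>2 / s)"
    unfolding r_def of_real_add[symmetric] of_real_diff[symmetric] by (auto simp: of_real_divide)
  thus ?thesis by (simp add: s_def)
qed

lemma adm_gate:
  assumes "adm (f # fs)" "of_real x \<in> vert S fs"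
  shows "x \<notin> gate f"
  using assms by auto

lemma vert_real_adm: "adm fs \<Longrightarrow> vert S fs \<subseteq> \<real>"
proof (induction fs)
  case (Cons f fs)
  show ?case
  proof
    fix y assume y: "y \<in> vert S (f # fs)"
    show "y \<in> \<real>"
    proof (cases "y = of_real (fst f)")
      case False
      hence j: "jfold f y \<in> vert S fs" using y by (auto simp: vert_Cons)
      then obtain x where x: "jfold f y = of_real x" using Cons by (auto elim!: Reals_cases)
      have "x \<notin> gate f" using adm_gate Cons.prems j x by simp
      from fold_fiber_real[OF _ this, of y] show ?thesis using Cons.prems False x
        by (auto simp: fold_fiber_def)
    qed auto
  qed
qed (use real in auto)

lemma poles_real_adm: "adm fs \<Longrightarrow> poles fs \<subseteq> \<real>"
  using vert_real_adm poles_subset_vert by blast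

lemma rlifts_vert:
  assumes "adm fs" "of_real x \<in> S"
  shows "of_real (rlifts fs x) \<in> vert S fs"
  using assms
proof (induction fs)
  case (Cons f fs)
  hence 1: "of_real (rlifts fs x) \<in> vert S fs" by auto
  have ng: "rlifts fs x \<notin> gate f" using adm_gate Cons.prems 1 by blast
  have "rlift f (rlifts fs x) \<noteq> fst f" using rlift_ne Cons.prems ng by auto
  moreover have "rfold f (rlift f (rlifts fs x)) = rlifts fs x" using rfold_rlift Cons.prems ng by auto
  ultimately show ?case using 1 by (auto simp: vert_Cons)
qed auto

text \<open>Every fold moves the right end to the left by at least
  \<open>(snd f)\<^sup>2 / len\<close>, and the right end never reaches the left one. So the energy
  is bounded independently of the number of folds.\<close>

lemma window_ends:
  assumes "adm fs"
  shows "a \<le> rlifts fs a \<and> rlifts fs a < rlifts fs b \<and> rlifts fs b \<le> b \<and>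
         energy fs \<le> len * (b - rlifts fs b)"
  using assms
proof (induction fs)
  case (Cons f fs)
  note IH = Cons.IH
  have adm: "adm fs" "snd f > 0" "rlifts fs a \<le> fst f - 2 * snd f" "fst f + 2 * snd f \<le> rlifts fs b"
    using Cons.prems by auto
  have IH': "a \<le> rlifts fs a" "rlifts fs a < rlifts fs b" "rlifts fs b \<le> b"
     "energy fs \<le> len * (b - rlifts fs b)" using IH adm by auto
  have ng: "rlifts fs a \<notin> gate f" "rlifts fs b \<notin> gate f" using adm by (auto simp: gate_def)
  have 1: "rlift f (rlifts fs a) \<ge> rlifts fs a" using rlift_toward_le adm by auto
  have 2: "rlift f (rlifts fs b) \<le> rlifts fs b" using rlift_toward_ge adm by auto
  have 3: "rlift f (rlifts fs a) < rlift f (rlifts fs b)"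
    using rlift_strict_mono[OF adm(2) ng] IH' by auto
  have "rlifts fs b - rlift f (rlifts fs b) = (snd f)\<^sup>2 / (rlift f (rlifts fs b) - fst f)"
    using rlift_toward[OF adm(2) ng(2)] .
  moreover have 4: "rlift f (rlifts fs b) - fst f \<ge> snd f" using rlift_ge(1)[OF adm(2,4)] by simp
  moreover have "rlift f (rlifts fs b) - fst f \<le> len" using 2 IH' adm by linarith
  hence "(snd f)\<^sup>2 / (rlift f (rlifts fs b) - fst f) \<ge> (snd f)\<^sup>2 / len"
    using 4 adm(2) ab by (intro divide_left_mono mult_pos_pos) auto
  ultimately have "(snd f)\<^sup>2 / len \<le> rlifts fs b - rlift f (rlifts fs b)" by simp
  hence "(snd f)\<^sup>2 \<le> len * (rlifts fs b - rlift f (rlifts fs b))"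
    using ab by (simp add: field_simps)
  hence "energy (f # fs) \<le> len * (b - rlift f (rlifts fs b))"
    using IH'(4) by (simp add: energy_def algebra_simps)
  thus ?case using 1 2 3 IH' by auto
qed (use ab in \<open>auto simp: energy_def\<close>)

lemma energy_le: assumes "adm fs" shows "energy fs \<le> len\<^sup>2"
proof -
  have "len * (b - rlifts fs b) \<le> len * len"
    using window_ends[OF assms] ab by (intro mult_left_mono) auto
  moreover have "energy fs \<le> len * (b - rlifts fs b)" using window_ends[OF assms] by blast
  ultimately show ?thesis unfolding power2_eq_square by linarith
qed

lemma energy_nonneg: "energy fs \<ge> 0"
  by (auto simp: energy_def intro!: sum_list_nonneg)

lemma energy_Cons: "energy (f # fs) = (snd f)\<^sup>2 + energy fs"
  by (simp add: energy_def)

text \<open>The energy term in the hypothesis is the displacement still to come: the innermost fold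
  uses up its share \<open>(snd f)\<^sup>2 / len\<close>, and what remains is the hypothesis for the
  other folds.\<close>

lemma near_identity:
  assumes "adm fs" "cmod (y - of_real a) \<ge> 2 * len + energy fs / len"
  shows "y \<notin> poles fs \<and> cmod (fold_comp fs y - y) \<le> energy fs / len"
  using assms
proof (induction fs arbitrary: y)
  case (Cons f fs)
  have adm: "adm fs" "snd f > 0" "rlifts fs a \<le> fst f - 2 * snd f" "fst f + 2 * snd f \<le> rlifts fs b"
    using Cons.prems by auto
  note we = window_ends[OF adm(1)]
  have e0: "energy (f # fs) / len \<ge> 0" using energy_nonneg ab by auto
  have m: "cmod (of_real (fst f) - of_real a) \<le> len"
  proof -
    have "\<bar>fst f - a\<bar> \<le> len" using we adm by linarith
    thus ?thesis by (metis norm_of_real of_real_diff)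
  qed
  have "cmod (y - of_real a) \<le> cmod (y - of_real (fst f)) + cmod (of_real (fst f) - of_real a)"
    using norm_triangle_ineq[of "y - of_real (fst f)" "of_real (fst f) - of_real a"]
    by (simp del: of_real_diff)
  moreover have "A \<ge> len" if "2 * len + E \<le> B" "B \<le> A + C" "C \<le> len" "E \<ge> 0" for A B C E
    using that by simp
  ultimately have far: "cmod (y - of_real (fst f)) \<ge> len" using Cons.prems(2) m e0 by blast
  hence ne: "y \<noteq> of_real (fst f)" using ab by auto
  have "cmod (jfold f y - y) = (snd f)\<^sup>2 / cmod (y - of_real (fst f))"
    by (simp add: jfold_def norm_divide norm_power)
  also have "\<dots> \<le> (snd f)\<^sup>2 / len" using far ab by (intro divide_left_mono mult_pos_pos) (auto intro: less_le_trans)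
  finally have mv: "cmod (jfold f y - y) \<le> (snd f)\<^sup>2 / len" .
  have "cmod (y - of_real a) \<le> cmod (jfold f y - of_real a) + cmod (jfold f y - y)"
    using norm_triangle_ineq4[of "jfold f y - of_real a" "jfold f y - y"] by simp
  hence "cmod (jfold f y - of_real a) \<ge> 2 * len + energy fs / len"
    using Cons.prems(2) mv by (simp add: energy_Cons add_divide_distrib)
  note IH = Cons.IH[OF adm(1) this]
  have "cmod (fold_comp fs (jfold f y) - y) \<le> cmod (fold_comp fs (jfold f y) - jfold f y) + cmod (jfold f y - y)"
    using norm_triangle_ineq[of "fold_comp fs (jfold f y) - jfold f y" "jfold f y - y"] by simp
  hence "cmod (fold_comp fs (jfold f y) - y) \<le> energy (f # fs) / len"
    using IH mv by (simp add: energy_Cons add_divide_distrib)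
  thus ?case using IH ne by simp
qed (auto simp: energy_def)

lemma near_identity':
  assumes "adm fs" "cmod (y - of_real a) \<ge> 3 * len"
  shows "y \<notin> poles fs" "cmod (fold_comp fs y - y) \<le> len"
proof -
  have "energy fs / len \<le> len" using energy_le[OF assms(1)] ab by (simp add: field_simps power2_eq_square)
  with near_identity[OF assms(1), of y] assms(2)
  show "y \<notin> poles fs" "cmod (fold_comp fs y - y) \<le> len" by auto
qed

lemma fold_comp_holomorphic: "fold_comp fs holomorphic_on - poles fs"
proof (induction fs)
  case (Cons f fs)
  have "fold_comp fs \<circ> jfold f holomorphic_on - poles (f # fs)"
    by (rule holomorphic_on_compose_gen[OF _ Cons])
       (auto intro: holomorphic_on_subset[OF jfold_holomorphic])
  thus ?case by (simp add: o_def)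
qed auto

text \<open>By the chain rule a critical point of the composition runs into a critical point of some
  fold. The critical value of that fold is a vertex for the folds further out, so the starting point
  is itself a vertex.\<close>

lemma fold_comp_deriv_nz:
  assumes "adm fs" "y \<notin> vert S fs"
  shows "\<exists>D. D \<noteq> 0 \<and> (fold_comp fs has_field_derivative D) (at y)"
  using assms
proof (induction fs arbitrary: y)
  case (Cons f fs)
  have y: "y \<noteq> of_real (fst f)" "jfold f y \<notin> vert S fs" using Cons.prems by (auto simp: vert_Cons)
  obtain D where D: "D \<noteq> 0" "(fold_comp fs has_field_derivative D) (at (jfold f y))"
    using Cons.IH[OF _ y(2)] Cons.prems by auto
  define E where "E = 1 - of_real ((snd f)\<^sup>2) / (y - of_real (fst f))\<^sup>2"
  have "E \<noteq> 0" using jfold_deriv_zero[OF y(1)] y(2) Cons.prems by (auto simp: E_def)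
  moreover have "fold_comp (f # fs) = fold_comp fs \<circ> jfold f" by (simp add: fun_eq_iff)
  hence "(fold_comp (f # fs) has_field_derivative D * E) (at y)"
    using DERIV_chain[OF D(2) jfold_has_derivative[OF y(1)]] by (simp add: E_def)
  ultimately show ?case using D(1) by (intro exI[of _ "D * E"]) (simp del: fold_comp.simps)
next
  case Nil
  thus ?case by (intro exI[of _ 1]) (auto intro!: derivative_eq_intros)
qed

lemma fold_comp_off_vert: "y \<notin> vert S fs \<Longrightarrow> fold_comp fs y \<notin> S"
  by (auto simp: vert_def)

text \<open>A point within \<open>snd f\<close> of the pole lies between the lifted ends anyway. Any
  other point is the lift of its image, and lifting preserves the order.\<close>

lemma vert_ends_window:
  assumes "adm fs" "of_real x \<in> vert {of_real a, of_real b} fs"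
  shows "rlifts fs a \<le> x \<and> x \<le> rlifts fs b"
  using assms
proof (induction fs arbitrary: x)
  case (Cons f fs)
  have adm: "adm fs" "snd f > 0" "rlifts fs a \<le> fst f - 2 * snd f" "fst f + 2 * snd f \<le> rlifts fs b"
    using Cons.prems by auto
  have ng: "rlifts fs a \<notin> gate f" "rlifts fs b \<notin> gate f" using adm by (auto simp: gate_def)
  have l: "rlift f (rlifts fs a) \<le> fst f - snd f" using rlift_le(1) adm by auto
  have r: "rlift f (rlifts fs b) \<ge> fst f + snd f" using rlift_ge(1) adm by auto
  show ?case
  proof (cases "\<bar>x - fst f\<bar> \<le> snd f")
    case True
    thus ?thesis using l r by auto
  next
    case False
    hence "of_real (rfold f x) \<in> vert {of_real a, of_real b} fs"
      using Cons.prems(2) adm(2) by (auto simp: vert_Cons)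
    hence IH: "rlifts fs a \<le> rfold f x" "rfold f x \<le> rlifts fs b" using Cons.IH adm by auto
    have x: "rlift f (rfold f x) = x" using rlift_unique[OF adm(2)] False by auto
    have "x \<noteq> fst f" using False adm(2) by auto
    note ng' = rfold_notin_gate[OF adm(2) this]
    show ?thesis using rlift_mono[OF adm(2) ng(1) ng' IH(1)] rlift_mono[OF adm(2) ng' ng(2) IH(2)] x
      by simp
  qed
qed (use ab in auto)

lemma vert_ends_subset:
  assumes "adm fs"
  shows "vert {of_real a, of_real b} fs \<subseteq> of_real ` {rlifts fs a..rlifts fs b}"
proof
  fix y assume y: "y \<in> vert {of_real a, of_real b} fs"
  have "vert {of_real a, of_real b} fs \<subseteq> vert S fs" using aS bS by (intro vert_mono) auto
  then obtain x where "y = of_real x" using y vert_real_adm[OF assms] by (auto elim!: Reals_cases)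
  thus "y \<in> of_real ` {rlifts fs a..rlifts fs b}" using vert_ends_window[OF assms] y by auto
qed

text \<open>To the right of the window each fold adds a positive amount and stays to the right of
  the next window. With the mirror statement this yields the sign of the far test outside the
  window.\<close>

lemma real_outside_right:
  assumes "adm fs" "x > rlifts fs b"
  shows "\<exists>t. fold_comp fs (of_real x) = of_real t \<and> t \<ge> x"
  using assms
proof (induction fs arbitrary: x)
  case (Cons f fs)
  have adm: "adm fs" "snd f > 0" "fst f + 2 * snd f \<le> rlifts fs b" using Cons.prems by auto
  note r = rlift_ge[OF adm(2,3)]
  have gt: "x > rlift f (rlifts fs b)" using Cons.prems by simp
  hence "rfold f x > rlifts fs b" using rfold_strict_mono[OF adm(2) r(1)] r(2) by simp
  moreover have "rfold f x \<ge> x" using gt r(1) adm(2) by (simp add: rfold_def)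
  ultimately show ?case using Cons.IH[OF adm(1), of "rfold f x"] by force
qed auto

lemma real_outside_left:
  assumes "adm fs" "x < rlifts fs a"
  shows "\<exists>t. fold_comp fs (of_real x) = of_real t \<and> t \<le> x"
  using assms
proof (induction fs arbitrary: x)
  case (Cons f fs)
  have adm: "adm fs" "snd f > 0" "rlifts fs a \<le> fst f - 2 * snd f" using Cons.prems by auto
  note r = rlift_le[OF adm(2,3)]
  have lt: "x < rlift f (rlifts fs a)" using Cons.prems by simp
  hence "rfold f x < rlifts fs a" using rfold_strict_mono'[OF adm(2) r(1)] r(2) by simp
  moreover have "rfold f x \<le> x" using lt r(1) adm(2) by (simp add: rfold_def divide_nonneg_neg)
  ultimately show ?case using Cons.IH[OF adm(1), of "rfold f x"] by force
qed auto

text \<open>With s and t the preimages relative to the pole, \<open>s * t\<close> is positive, so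
  their imaginary parts have opposite signs or vanish. As these add up to \<open>Im z\<close>, the
  one with the sign of \<open>Im z\<close> is at least as large in modulus.\<close>

lemma fold_principal:
  assumes "snd f > 0" "Im z \<noteq> 0"
  obtains y where "y \<in> fold_fiber f z" "Im y * Im z > 0" "\<bar>Im y\<bar> \<ge> \<bar>Im z\<bar>"
proof -
  have z: "z \<noteq> of_real x" for x using assms by auto
  obtain y1 y2 where y: "fold_fiber f z = {y1, y2}" "y1 + y2 = z + of_real (fst f)"
    "(y1 - of_real (fst f)) * (y2 - of_real (fst f)) = of_real ((snd f)\<^sup>2)"
    using fold_fiber_two[OF assms(1) z z] by metis
  define s where "s = y1 - of_real (fst f)"
  define t where "t = y2 - of_real (fst f)"
  have st: "s * t = of_real ((snd f)\<^sup>2)" "s + t = z - of_real (fst f)"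
    using y by (simp_all add: s_def t_def algebra_simps)
  have "s \<noteq> 0" using st(1) assms by auto
  have im: "Im s + Im t = Im z" using st(2) by (metis Im_complex_of_real diff_zero minus_complex.sel(2) plus_complex.sel(2))
  have "t = of_real ((snd f)\<^sup>2) / s" using st(1) \<open>s \<noteq> 0\<close> by (simp add: field_simps)
  hence "t = of_real ((snd f)\<^sup>2 / (cmod s)\<^sup>2) * cnj s"
    using complex_div_cnj[of "of_real ((snd f)\<^sup>2)" s] by simp
  hence t: "Im t = - ((snd f)\<^sup>2 / (cmod s)\<^sup>2) * Im s"
    by (simp only: Im_complex_of_real Re_complex_of_real times_complex.sel cnj.simps)
  define k where "k = (snd f)\<^sup>2 / (cmod s)\<^sup>2"
  have "k \<ge> 0" by (simp add: k_def)
  have t': "Im t = - k * Im s" using t by (simp add: k_def)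
  have "\<exists>u\<in>{s,t}. Im u * Im z > 0 \<and> \<bar>Im u\<bar> \<ge> \<bar>Im z\<bar>"
  proof (cases "Im s * Im z > 0")
    case True
    hence "Im t * Im z \<le> 0" using \<open>k \<ge> 0\<close> t'
      by (smt (verit) mult_minus_left mult_nonneg_nonneg mult.assoc)
    hence "\<bar>Im s\<bar> \<ge> \<bar>Im z\<bar>" using True im by (auto simp: zero_less_mult_iff mult_le_0_iff)
    thus ?thesis using True by auto
  next
    case False
    hence "Im t * Im z > 0" using im assms(2)
      by (smt (verit, best) distrib_right mult_pos_pos mult_neg_neg)
    moreover have "\<bar>Im t\<bar> \<ge> \<bar>Im z\<bar>" using im False calculation by (auto simp: zero_less_mult_iff not_less mult_le_0_iff)
    ultimately show ?thesis by blast
  qed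
  then obtain u where u: "u = s \<or> u = t" "Im u * Im z > 0" "\<bar>Im u\<bar> \<ge> \<bar>Im z\<bar>" by blast
  show ?thesis
  proof (rule that[of "of_real (fst f) + u"])
    show "of_real (fst f) + u \<in> fold_fiber f z" using u(1) by (elim disjE) (simp_all add: y(1) s_def t_def)
  qed (use u(2,3) in simp_all)
qed

lemma principal:
  assumes "adm fs" "Im z \<noteq> 0"
  shows "\<exists>y\<in>fiber fs z. Im y * Im z > 0 \<and> \<bar>Im y\<bar> \<ge> \<bar>Im z\<bar>"
  using assms
proof (induction fs)
  case (Cons f fs)
  then obtain y where y: "y \<in> fiber fs z" "Im y * Im z > 0" "\<bar>Im y\<bar> \<ge> \<bar>Im z\<bar>" by auto
  hence "Im y \<noteq> 0" by auto
  then obtain x where x: "x \<in> fold_fiber f y" "Im x * Im y > 0" "\<bar>Im x\<bar> \<ge> \<bar>Im y\<bar>"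
    using fold_principal[of f y] Cons.prems by auto
  show ?case
    by (rule bexI[of _ x]) (use x y in \<open>auto simp: fiber_Cons zero_less_mult_iff\<close>)
qed (auto simp: zero_less_mult_iff)

text \<open>The outermost fold brings a vertex outside the window into it, by the root nearer to the
  pole; the order preserving lifts then keep it inside. This is where at least one fold is
  required.\<close>

lemma vertex_preimage:
  assumes "adm fs" "fs \<noteq> []" "of_real v \<in> S" "v \<notin> {a..b}"
  shows "\<exists>x. of_real x \<in> fiber fs (of_real v) \<and> rlifts fs a \<le> x \<and> x \<le> rlifts fs b"
  using assms(1,2)
proof (induction fs)
  case (Cons f fs)
  have adm: "adm fs" "snd f > 0" "rlifts fs a \<le> fst f - 2 * snd f" "fst f + 2 * snd f \<le> rlifts fs b"
    using Cons.prems by auto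
  have ng: "rlifts fs a \<notin> gate f" "rlifts fs b \<notin> gate f" using adm by (auto simp: gate_def)
  show ?case
  proof (cases "fs = []")
    case True
    have v: "v \<notin> gate f" using adm True assms(4) by (auto simp: gate_def)
    define s where "s = rlift f v - fst f"
    have s: "\<bar>s\<bar> \<ge> snd f" "v = fst f + s + (snd f)\<^sup>2 / s"
      using abs_rlift_ge[OF adm(2) v] rlift_toward[OF adm(2) v] by (auto simp: s_def)
    \<comment> \<open>The other root of the quadratic. It lies within \<open>snd f\<close> of the
      pole, hence between the lifted ends.\<close>
    define x where "x = fst f + (snd f)\<^sup>2 / s"
    have "s \<noteq> 0" using s adm by auto
    have "rfold f x = v" using s(2) \<open>s \<noteq> 0\<close> adm(2) by (simp add: rfold_def x_def)
    moreover have "x \<noteq> fst f" using \<open>s \<noteq> 0\<close> adm(2) by (simp add: x_def)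
    moreover have "\<bar>x - fst f\<bar> \<le> snd f"
    proof -
      have "(snd f)\<^sup>2 / \<bar>s\<bar> \<le> (snd f)\<^sup>2 / snd f" using s(1) adm(2) by (intro divide_left_mono) auto
      thus ?thesis using adm(2) by (simp add: x_def power2_eq_square)
    qed
    moreover have "rlift f (rlifts fs a) \<le> fst f - snd f" using rlift_le(1) adm by auto
    moreover have "rlift f (rlifts fs b) \<ge> fst f + snd f" using rlift_ge(1) adm by auto
    ultimately show ?thesis using True
      by (intro exI[of _ x]) (auto simp: fiber_Cons fold_fiber_def)
  next
    case False
    then obtain x where x: "of_real x \<in> fiber fs (of_real v)" "rlifts fs a \<le> x" "x \<le> rlifts fs b"
      using Cons.IH adm by auto
    have "x \<notin> gate f" using adm_gate[OF Cons.prems(1)] x(1) fiber_subset_vert[OF assms(3)] by blast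
    hence "of_real (rlift f x) \<in> fiber (f # fs) (of_real v)"
      using x rfold_rlift[OF adm(2), of x] rlift_ne[OF adm(2), of x]
      by (auto simp: fiber_Cons fold_fiber_def intro!: bexI[of _ "of_real x"])
    thus ?thesis using rlift_mono[OF adm(2) ng(1) \<open>x \<notin> gate f\<close>] rlift_mono[OF adm(2) \<open>x \<notin> gate f\<close> ng(2)] x
      by (intro exI[of _ "rlift f x"]) auto
  qed
qed auto

end

section \<open>The mass of a fiber\<close>

lemma factor_le:
  fixes p q d :: real
  assumes "p * q = d * d" "d \<le> p" "0 < d" shows "q \<le> d"
proof (rule ccontr)
  assume "\<not> q \<le> d"
  hence "d * d < d * q" using assms by simp
  also have "\<dots> \<le> p * q" using assms \<open>\<not> q \<le> d\<close> by (intro mult_right_mono) auto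
  finally show False using assms by simp
qed

lemma factor_ge:
  fixes p q d :: real
  assumes "p * q = d * d" "p < d" "0 < d" "0 \<le> p" shows "d \<le> q"
proof (rule ccontr)
  assume "\<not> d \<le> q"
  hence "p * q \<le> p * d" using assms by (intro mult_left_mono) auto
  also have "\<dots> < d * d" using assms by simp
  finally show False using assms by simp
qed

lemma fold_pair:
  assumes "snd f > 0" "z \<noteq> of_real (fst f - 2 * snd f)" "z \<noteq> of_real (fst f + 2 * snd f)"
  obtains s t where "fold_fiber f z = {of_real (fst f) + s, of_real (fst f) + t}" "s \<noteq> t" "cmod s \<ge> snd f"
    "s * t = of_real ((snd f)\<^sup>2)" "s + t = z - of_real (fst f)"
    "Im t = - ((snd f)\<^sup>2 / (cmod s)\<^sup>2) * Im s"
proof -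
  obtain y1 y2 where y: "fold_fiber f z = {y1, y2}" "y1 \<noteq> y2" "y1 + y2 = z + of_real (fst f)"
    "(y1 - of_real (fst f)) * (y2 - of_real (fst f)) = of_real ((snd f)\<^sup>2)"
    using fold_fiber_two[OF assms] by metis
  have conj: "Im t = - ((snd f)\<^sup>2 / (cmod s)\<^sup>2) * Im s" if st: "s * t = of_real ((snd f)\<^sup>2)" for s t
  proof -
    have "s \<noteq> 0" using st assms by auto
    hence "t = of_real ((snd f)\<^sup>2) / s" using st by (simp add: field_simps)
    hence "t = of_real ((snd f)\<^sup>2 / (cmod s)\<^sup>2) * cnj s"
      using complex_div_cnj[of "of_real ((snd f)\<^sup>2)" s] by simp
    thus ?thesis by (simp only: Im_complex_of_real Re_complex_of_real times_complex.sel cnj.simps)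
  qed
  show ?thesis
  proof (cases "cmod (y1 - of_real (fst f)) \<ge> snd f")
    case True
    show ?thesis
      by (rule that[of "y1 - of_real (fst f)" "y2 - of_real (fst f)"])
         (use y True conj[OF y(4)] in \<open>simp_all add: algebra_simps\<close>)
  next
    case False
    have "cmod (y1 - of_real (fst f)) * cmod (y2 - of_real (fst f)) = snd f * snd f"
      unfolding norm_mult[symmetric] y(4) by (simp only: norm_of_real power2_eq_square abs_mult abs_mult_self_eq)
    hence "cmod (y2 - of_real (fst f)) \<ge> snd f"
      using factor_ge[of "cmod (y1 - of_real (fst f))"] False assms(1) by simp
    moreover have y4: "(y2 - of_real (fst f)) * (y1 - of_real (fst f)) = of_real ((snd f)\<^sup>2)"
      using y(4) by (simp add: mult.commute)
    ultimately show ?thesis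
      by (intro that[of "y2 - of_real (fst f)" "y1 - of_real (fst f)"])
         (use y y4 conj[OF y4] in \<open>simp_all add: algebra_simps insert_commute\<close>)
  qed
qed

text \<open>The preimages lie in opposite half-planes and their imaginary parts add up to
  \<open>Im z\<close>, so the gain is twice \<open>\<bar>Im t\<bar>\<close> for the preimage t
  nearer to the pole. For the denominator, \<open>cmod t \<le> snd f\<close> bounds
  \<open>cmod s\<close> by \<open>cmod (z - of_real (fst f)) + snd f\<close>.\<close>

lemma fold_fiber_Im:
  assumes "snd f > 0" "Im z \<noteq> 0"
  shows "(\<Sum>y\<in>fold_fiber f z. \<bar>Im y\<bar>) \<ge> \<bar>Im z\<bar> + 2 * ((snd f)\<^sup>2 * \<bar>Im z\<bar> / (cmod (z - of_real (fst f)) + snd f)\<^sup>2)"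
proof -
  have z: "z \<noteq> of_real x" for x using assms by auto
  obtain s t where st: "fold_fiber f z = {of_real (fst f) + s, of_real (fst f) + t}" "s \<noteq> t" "cmod s \<ge> snd f"
    "s * t = of_real ((snd f)\<^sup>2)" "s + t = z - of_real (fst f)"
    "Im t = - ((snd f)\<^sup>2 / (cmod s)\<^sup>2) * Im s" using fold_pair[OF assms(1) z z] by metis
  define k where "k = (snd f)\<^sup>2 / (cmod s)\<^sup>2"
  have k: "0 \<le> k" "k \<le> 1" using st(3) assms(1) by (auto simp: k_def power_mono divide_le_eq_1)
  have t: "Im t = - k * Im s" using st(6) by (simp add: k_def)
  have "Im (s + t) = Im z" using st(5) by simp
  hence z': "Im z = (1 - k) * Im s" using t by (simp add: algebra_simps)
  hence az: "\<bar>Im z\<bar> = (1 - k) * \<bar>Im s\<bar>" using k by (simp add: abs_mult)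
  have at: "\<bar>Im t\<bar> = k * \<bar>Im s\<bar>" using k by (simp add: t abs_mult)
  have "\<bar>Im s\<bar> + \<bar>Im t\<bar> = \<bar>Im z\<bar> + 2 * \<bar>Im t\<bar>" using az at by (simp add: algebra_simps)
  moreover have "\<bar>Im t\<bar> \<ge> (snd f)\<^sup>2 * \<bar>Im z\<bar> / (cmod (z - of_real (fst f)) + snd f)\<^sup>2"
  proof -
    have "cmod s * cmod t = snd f * snd f"
      unfolding norm_mult[symmetric] st(4) by (simp only: norm_of_real power2_eq_square abs_mult abs_mult_self_eq)
    hence tl: "cmod t \<le> snd f" using factor_le st(3) assms(1) by blast
    have "s = z - of_real (fst f) - t" using st(5) by (simp add: algebra_simps)
    hence "cmod s \<le> cmod (z - of_real (fst f)) + cmod t" by (metis norm_triangle_ineq4)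
    hence "(cmod s)\<^sup>2 \<le> (cmod (z - of_real (fst f)) + snd f)\<^sup>2" using tl by (intro power_mono) auto
    moreover have "(cmod s)\<^sup>2 > 0" using st(3) assms(1) by auto
    ultimately have "(snd f)\<^sup>2 / (cmod (z - of_real (fst f)) + snd f)\<^sup>2 \<le> k"
      unfolding k_def by (intro divide_left_mono mult_pos_pos) (auto intro: less_le_trans)
    moreover have "\<bar>Im z\<bar> \<le> \<bar>Im s\<bar>" unfolding az using k by (intro mult_left_le_one_le) auto
    ultimately have "(snd f)\<^sup>2 / (cmod (z - of_real (fst f)) + snd f)\<^sup>2 * \<bar>Im z\<bar> \<le> k * \<bar>Im s\<bar>"
      using k by (intro mult_mono) auto
    thus ?thesis by (simp add: at)
  qed
  moreover have "(\<Sum>y\<in>fold_fiber f z. \<bar>Im y\<bar>) = \<bar>Im s\<bar> + \<bar>Im t\<bar>" using st(2) by (simp add: st(1))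
  ultimately show ?thesis by linarith
qed

lemma fold_fiber_Im_signed:
  assumes "snd f > 0" "z \<noteq> of_real (fst f - 2 * snd f)" "z \<noteq> of_real (fst f + 2 * snd f)"
  shows "(\<Sum>y\<in>fold_fiber f z. Im y) = Im z"
proof -
  obtain y1 y2 where y: "fold_fiber f z = {y1, y2}" "y1 \<noteq> y2" "y1 + y2 = z + of_real (fst f)"
    using fold_fiber_two[OF assms] by metis
  have "Im (y1 + y2) = Im z" unfolding y(3) by simp
  thus ?thesis using y(2) by (simp add: y(1))
qed

context window
begin

lemma fiber_not_gate_end:
  assumes "adm (f # fs)" "b' \<notin> S" "z \<in> fiber fs b'"
  shows "z \<noteq> of_real (fst f - 2 * snd f)" "z \<noteq> of_real (fst f + 2 * snd f)"
  using assms fiber_disjoint_vert[OF assms(2), of fs] by auto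

lemma sum_fiber_Cons:
  assumes "adm (f # fs)"
  shows "(\<Sum>y\<in>fiber (f # fs) z. h y) = (\<Sum>x\<in>fiber fs z. \<Sum>y\<in>fold_fiber f x. h y :: real)"
  unfolding fiber_Cons using assms finite_fiber'[of fs z] fold_fiber_disjoint
  by (intro sum.UNION_disjoint) (auto simp: fold_fiber_nonempty)

lemma prod_fiber_Cons:
  assumes "adm (f # fs)"
  shows "(\<Prod>y\<in>fiber (f # fs) z. h y) = (\<Prod>x\<in>fiber fs z. \<Prod>y\<in>fold_fiber f x. h y :: complex)"
  unfolding fiber_Cons using assms finite_fiber'[of fs z] fold_fiber_disjoint
  by (intro prod.UNION_disjoint) (auto simp: fold_fiber_nonempty)

lemma card_fiber:
  assumes "adm fs" "z \<notin> S"
  shows "card (fiber fs z) = 2 ^ length fs"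
  using assms
proof (induction fs)
  case (Cons f fs)
  have "card (fold_fiber f x) = 2" if x: "x \<in> fiber fs z" for x
  proof -
    obtain y1 y2 where "fold_fiber f x = {y1, y2}" "y1 \<noteq> y2"
      using fold_fiber_two[OF _ fiber_not_gate_end[OF Cons.prems x]] Cons.prems(1) by (metis admissible.simps(2))
    thus ?thesis by simp
  qed
  hence "card (fiber (f # fs) z) = (\<Sum>x\<in>fiber fs z. 2)"
    unfolding fiber_Cons using Cons.prems finite_fiber'[of fs z] fold_fiber_disjoint
    by (subst card_UN_disjoint) (auto simp: fold_fiber_nonempty)
  thus ?case using Cons by simp
qed auto

text \<open>\<open>D\<close> is the denominator of the rational function
  \<open>fold_comp fs\<close>. Since it does not depend on \<open>z\<close>, it cancels when the
  potentials of two fibers are subtracted.\<close>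

lemma fiber_product:
  assumes "adm fs"
  shows "\<exists>D. \<forall>x. x \<notin> poles fs \<longrightarrow> D x \<noteq> 0 \<and> (\<forall>z. z \<notin> S \<longrightarrow> (\<Prod>y\<in>fiber fs z. x - y) = (fold_comp fs x - z) * D x)"
  using assms
proof (induction fs)
  case (Cons f fs)
  then obtain D where D: "\<And>x. x \<notin> poles fs \<Longrightarrow> D x \<noteq> 0"
    "\<And>x z. x \<notin> poles fs \<Longrightarrow> z \<notin> S \<Longrightarrow> (\<Prod>y\<in>fiber fs z. x - y) = (fold_comp fs x - z) * D x" by auto
  \<comment> \<open>Each of the \<open>2 ^ length fs\<close> points in the outer fiber contributes
    one factor \<open>x - of_real (fst f)\<close>.\<close>
  define D' where "D' = (\<lambda>x. D (jfold f x) * (x - of_real (fst f)) ^ (2 ^ length fs))"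
  have "(\<Prod>y\<in>fiber (f # fs) z. x - y) = (fold_comp (f # fs) x - z) * D' x"
    if x: "x \<notin> poles (f # fs)" and z: "z \<notin> S" for x z
  proof -
    have "(\<Prod>y\<in>fold_fiber f u. x - y) = (jfold f x - u) * (x - of_real (fst f))" if u: "u \<in> fiber fs z" for u
    proof -
      obtain y1 y2 where y: "fold_fiber f u = {y1, y2}" "y1 \<noteq> y2"
        "\<And>x. x \<noteq> of_real (fst f) \<Longrightarrow> (x - y1) * (x - y2) = (jfold f x - u) * (x - of_real (fst f))"
        using fold_fiber_two[OF _ fiber_not_gate_end[OF Cons.prems z u]] Cons.prems(1)
        by (metis admissible.simps(2))
      show ?thesis using y(3)[of x] x y(2) by (simp add: y(1))
    qed
    hence "(\<Prod>y\<in>fiber (f # fs) z. x - y) = (\<Prod>u\<in>fiber fs z. (jfold f x - u) * (x - of_real (fst f)))"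
      unfolding prod_fiber_Cons[OF Cons.prems] by (intro prod.cong) auto
    also have "\<dots> = (\<Prod>u\<in>fiber fs z. jfold f x - u) * (x - of_real (fst f)) ^ (2 ^ length fs)"
      using card_fiber[OF _ z, of fs] Cons.prems by (simp add: prod.distrib)
    moreover have "jfold f x \<notin> poles fs" using x by auto
    ultimately show ?thesis using D(2)[of "jfold f x" z] z by (simp add: D'_def)
  qed
  moreover have "D' x \<noteq> 0" if "x \<notin> poles (f # fs)" for x
    using that D(1)[of "jfold f x"] by (auto simp: D'_def)
  ultimately show ?case by (intro exI[of _ D']) blast
qed (auto intro!: exI[of _ "\<lambda>_. 1"])

definition mass :: "(real \<times> real) list \<Rightarrow> complex \<Rightarrow> real" where
  "mass fs z = (\<Sum>y\<in>fiber fs z. \<bar>Im y\<bar>)"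

lemma nonreal_notin: "Im z \<noteq> 0 \<Longrightarrow> z \<notin> S"
  using real by (auto elim!: Reals_cases)

lemma fiber_nonreal: "Im z \<noteq> 0 \<Longrightarrow> y \<in> fiber fs z \<Longrightarrow> Im y \<noteq> 0"
  using fold_comp_real[of y fs] by (auto simp: fiber_def complex_is_Real_iff)

lemma signed_mass:
  assumes "adm fs" "Im z \<noteq> 0"
  shows "(\<Sum>y\<in>fiber fs z. Im y) = Im z"
  using assms
proof (induction fs)
  case (Cons f fs)
  have "(\<Sum>y\<in>fiber (f # fs) z. Im y) = (\<Sum>x\<in>fiber fs z. Im x)"
    unfolding sum_fiber_Cons[OF Cons.prems(1)]
    using fiber_not_gate_end[OF Cons.prems(1) nonreal_notin[OF Cons.prems(2)]] Cons.prems(1)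
    by (intro sum.cong refl fold_fiber_Im_signed) auto
  thus ?case using Cons by simp
qed auto

lemma mass_ge: "adm fs \<Longrightarrow> Im z \<noteq> 0 \<Longrightarrow> mass fs z \<ge> \<bar>Im z\<bar>"
  unfolding mass_def using sum_abs[of Im "fiber fs z"] signed_mass[of fs z] by simp

lemma mass_nonneg: "mass fs z \<ge> 0"
  by (simp add: mass_def sum_nonneg)

lemma mass_cnj: "mass fs (cnj z) = mass fs z"
  unfolding mass_def fiber_cnj by (subst sum.reindex) (auto simp: inj_on_def)

lemma mass_gain:
  assumes "adm (f # fs)" "Im z \<noteq> 0" "x \<in> fiber fs z"
  shows "mass (f # fs) z \<ge> mass fs z + 2 * ((snd f)\<^sup>2 * \<bar>Im x\<bar> / (cmod (x - of_real (fst f)) + snd f)\<^sup>2)"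
proof -
  define g where "g = (\<lambda>x. 2 * ((snd f)\<^sup>2 * \<bar>Im x\<bar> / (cmod (x - of_real (fst f)) + snd f)\<^sup>2))"
  have f: "snd f > 0" "finite (fiber fs z)" using assms finite_fiber' by auto
  have "mass (f # fs) z \<ge> (\<Sum>x\<in>fiber fs z. \<bar>Im x\<bar> + g x)"
    unfolding mass_def sum_fiber_Cons[OF assms(1)] g_def
    by (intro sum_mono fold_fiber_Im f fiber_nonreal[OF assms(2)])
  moreover have "(\<Sum>x\<in>fiber fs z. g x) \<ge> g x"
    using assms(3) f by (intro member_le_sum) (auto simp: g_def)
  ultimately show ?thesis by (simp add: sum.distrib mass_def g_def)
qed

text \<open>A fold is inverted along a branch by a square root of its discriminant, which has no
  zero because fibers over \<open>D\<close> avoid the vertices; simple connectedness provides the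
  root. A list entry records the sign chosen for one fold. The dichotomy on the real axis is what
  makes a branch through one real point real along the whole interval.\<close>

lemma branches:
  assumes "adm fs" "open D" "simply_connected D" "D \<inter> S = {}" and conn: "connected {x::real. of_real x \<in> D}"
  shows "\<exists>\<Phi> :: bool list \<Rightarrow> complex \<Rightarrow> complex.
    (\<forall>l. length l = length fs \<longrightarrow> \<Phi> l holomorphic_on D \<and>
       ((\<forall>x. of_real x \<in> D \<longrightarrow> \<Phi> l (of_real x) \<in> \<real>) \<or> (\<forall>x. of_real x \<in> D \<longrightarrow> \<Phi> l (of_real x) \<notin> \<real>))) \<and>
    (\<forall>w\<in>D. bij_betw (\<lambda>l. \<Phi> l w) {l. length l = length fs} (fiber fs w))"
  using assms(1)
proof (induction fs)
  case Nil
  show ?case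
    by (rule exI[of _ "\<lambda>_ w. w"]) (auto simp: bij_betw_def)
next
  case (Cons f fs)
  define m where "m = complex_of_real (fst f)"
  define d where "d = snd f"
  have d: "d > 0" and adm: "adm fs" using Cons.prems by (auto simp: d_def)
  obtain \<Phi> :: "bool list \<Rightarrow> complex \<Rightarrow> complex" where \<Phi>:
    "\<And>l. length l = length fs \<Longrightarrow> \<Phi> l holomorphic_on D"
    "\<And>l. length l = length fs \<Longrightarrow> (\<forall>x. of_real x \<in> D \<longrightarrow> \<Phi> l (of_real x) \<in> \<real>) \<or> (\<forall>x. of_real x \<in> D \<longrightarrow> \<Phi> l (of_real x) \<notin> \<real>)"
    "\<And>w. w \<in> D \<Longrightarrow> bij_betw (\<lambda>l. \<Phi> l w) {l. length l = length fs} (fiber fs w)"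
    using Cons.IH adm by metis
  have in_fib: "\<Phi> l w \<in> fiber fs w" if "length l = length fs" "w \<in> D" for l w
    using bij_betwE[OF \<Phi>(3)[OF that(2)]] that(1) by auto
  have nz: "(\<Phi> l w - m)\<^sup>2 - 4 * of_real (d\<^sup>2) \<noteq> 0" if "length l = length fs" "w \<in> D" for l w
    using fold_disc_zero_iff[of "\<Phi> l w" f] fiber_not_gate_end[OF Cons.prems _ in_fib[OF that]] assms(4) that(2)
    by (auto simp: m_def d_def)
  have sqrts: "\<forall>g. g holomorphic_on D \<and> (\<forall>z\<in>D. g z \<noteq> 0) \<longrightarrow> (\<exists>r. r holomorphic_on D \<and> (\<forall>z\<in>D. g z = (r z)\<^sup>2))"
    using simply_connected_eq_holomorphic_sqrt[OF assms(2)] assms(3) by blast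
  have "\<exists>r. r holomorphic_on D \<and> (\<forall>w\<in>D. (r w)\<^sup>2 = (\<Phi> l w - m)\<^sup>2 - 4 * of_real (d\<^sup>2))" if "length l = length fs" for l
  proof -
    have "(\<lambda>w. (\<Phi> l w - m)\<^sup>2 - 4 * of_real (d\<^sup>2)) holomorphic_on D"
      by (intro holomorphic_intros \<Phi>(1) that)
    with sqrts[rule_format, of "\<lambda>w. (\<Phi> l w - m)\<^sup>2 - 4 * of_real (d\<^sup>2)"] nz[OF that] show ?thesis by metis
  qed
  then obtain R where R: "\<And>l. length l = length fs \<Longrightarrow> R l holomorphic_on D"
    "\<And>l w. length l = length fs \<Longrightarrow> w \<in> D \<Longrightarrow> (R l w)\<^sup>2 = (\<Phi> l w - m)\<^sup>2 - 4 * of_real (d\<^sup>2)" by metis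
  define \<Psi> where "\<Psi> = (\<lambda>l w. m + (\<Phi> (tl l) w - m + (if hd l then R (tl l) w else - R (tl l) w)) / 2)"
  have hol: "\<Psi> l holomorphic_on D" if "length l = length (f # fs)" for l
  proof -
    have "length (tl l) = length fs" using that by auto
    thus ?thesis unfolding \<Psi>_def by (cases "hd l") (auto intro!: holomorphic_intros \<Phi>(1) R(1))
  qed
  have ff: "fold_fiber f (\<Phi> l w) = {\<Psi> (True # l) w, \<Psi> (False # l) w}" if "length l = length fs" "w \<in> D" for l w
    using fold_fiber_eq[of f "R l w" "\<Phi> l w"] R(2)[OF that] d by (simp add: \<Psi>_def m_def d_def)
  have inj2: "\<Psi> (True # l) w \<noteq> \<Psi> (False # l) w" if "length l = length fs" "w \<in> D" for l w
    using R(2)[OF that] nz[OF that] by (auto simp: \<Psi>_def)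
  have bij: "bij_betw (\<lambda>l. \<Psi> l w) {l. length l = length (f # fs)} (fiber (f # fs) w)" if w: "w \<in> D" for w
  proof (rule bij_betw_imageI)
    have im: "fiber fs w = (\<lambda>l. \<Phi> l w) ` {l. length l = length fs}"
      using \<Phi>(3)[OF w] by (simp add: bij_betw_def)
    show "(\<lambda>l. \<Psi> l w) ` {l. length l = length (f # fs)} = fiber (f # fs) w"
    proof -
      have L: "{l. length l = length (f # fs)} = (\<Union>l\<in>{l. length l = length fs}. {True # l, False # l})"
        by (auto simp: length_Suc_conv)
      have "fiber (f # fs) w = (\<Union>l\<in>{l. length l = length fs}. fold_fiber f (\<Phi> l w))"
        by (simp add: fiber_Cons im)
      also have "\<dots> = (\<Union>l\<in>{l. length l = length fs}. {\<Psi> (True # l) w, \<Psi> (False # l) w})"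
        using ff w by auto
      finally show ?thesis unfolding L by (simp add: image_UN)
    qed
    show "inj_on (\<lambda>l. \<Psi> l w) {l. length l = length (f # fs)}"
    proof (rule inj_onI)
      fix l l' :: "bool list" assume l: "l \<in> {l. length l = length (f # fs)}" "l' \<in> {l. length l = length (f # fs)}"
        and eq: "\<Psi> l w = \<Psi> l' w"
      obtain c k where lk: "l = c # k" "length k = length fs" using l by (auto simp: length_Suc_conv)
      obtain c' k' where lk': "l' = c' # k'" "length k' = length fs" using l by (auto simp: length_Suc_conv)
      have "\<Psi> l w \<in> fold_fiber f (\<Phi> k w)" using ff[OF lk(2) w] lk by (cases c) auto
      moreover have "\<Psi> l' w \<in> fold_fiber f (\<Phi> k' w)" using ff[OF lk'(2) w] lk' by (cases c') auto
      ultimately have "\<Phi> k w = \<Phi> k' w" using eq by (auto simp: fold_fiber_def)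
      hence kk: "k = k'" using \<Phi>(3)[OF w] lk lk' by (auto simp: bij_betw_def inj_on_def)
      show "l = l'" using inj2[OF lk(2) w] eq lk lk' kk by (cases c; cases c') auto
    qed
  qed
  have re: "(\<forall>x. of_real x \<in> D \<longrightarrow> \<Psi> l (of_real x) \<in> \<real>) \<or> (\<forall>x. of_real x \<in> D \<longrightarrow> \<Psi> l (of_real x) \<notin> \<real>)"
    if l: "length l = length (f # fs)" for l
  proof -
    define k where "k = tl l"
    have k: "length k = length fs" using l by (simp add: k_def)
    have fib: "\<Psi> l w \<in> fold_fiber f (\<Phi> k w)" if "w \<in> D" for w
      using ff[OF k that] l by (cases l; cases "hd l") (auto simp: k_def)
    from \<Phi>(2)[OF k] show ?thesis
    proof
      assume n: "\<forall>x. of_real x \<in> D \<longrightarrow> \<Phi> k (of_real x) \<notin> \<real>"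
      have "\<Psi> l (of_real x) \<notin> \<real>" if x: "of_real x \<in> D" for x
      proof
        assume "\<Psi> l (of_real x) \<in> \<real>"
        then obtain y where "\<Psi> l (of_real x) = of_real y" by (auto elim: Reals_cases)
        hence "\<Phi> k (of_real x) = of_real (rfold f y)" using fib[OF x] by (simp add: fold_fiber_def)
        thus False using n x by (metis Reals_of_real)
      qed
      thus ?thesis by blast
    next
      assume p: "\<forall>x. of_real x \<in> D \<longrightarrow> \<Phi> k (of_real x) \<in> \<real>"
      define X where "X = {x::real. of_real x \<in> D}"
      \<comment> \<open>Over real points with real outer branch the discriminant is real and
        nonzero. By connectedness it has constant sign, and the sign decides whether the square root
        is real.\<close>
      define q where "q = (\<lambda>x::real. (Re (\<Phi> k (of_real x)) - fst f)\<^sup>2 - 4 * d\<^sup>2)"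
      have Rq: "(R k (of_real x))\<^sup>2 = of_real (q x)" if "x \<in> X" for x
      proof -
        have "\<Phi> k (of_real x) \<in> \<real>" using p that by (simp add: X_def)
        then obtain r where "\<Phi> k (of_real x) = of_real r" by (auto elim: Reals_cases)
        thus ?thesis using R(2)[OF k, of "of_real x"] that by (simp add: X_def q_def m_def)
      qed
      have qnz: "q x \<noteq> 0" if "x \<in> X" for x
        using Rq[OF that] nz[OF k, of "of_real x"] R(2)[OF k, of "of_real x"] that by (auto simp: X_def)
      have "continuous_on X (\<lambda>x. \<Phi> k (of_real x))"
        by (rule continuous_on_compose2[OF holomorphic_on_imp_continuous_on[OF \<Phi>(1)[OF k]]])
           (auto simp: X_def intro!: continuous_intros)
      hence "continuous_on X q" unfolding q_def by (intro continuous_intros)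
      hence "connected (q ` X)" using conn by (intro connected_continuous_image) (auto simp: X_def)
      moreover have "0 \<notin> q ` X" using qnz by auto
      ultimately have "\<not> (q x < 0 \<and> q y > 0)" if "x \<in> X" "y \<in> X" for x y
        using connectedD_interval[of "q ` X" "q x" "q y" 0] that by auto
      hence sg: "(\<forall>x\<in>X. q x > 0) \<or> (\<forall>x\<in>X. q x < 0)"
        using qnz by (meson linorder_neqE_linordered_idom)
      have "\<Psi> l (of_real x) \<in> \<real> \<longleftrightarrow> q x > 0" if x: "x \<in> X" for x
      proof -
        have ph: "\<Phi> k (of_real x) \<in> \<real>" using p x by (simp add: X_def)
        have "\<Psi> l (of_real x) \<in> \<real> \<longleftrightarrow> R k (of_real x) \<in> \<real>"
          using ph by (cases "hd l") (auto simp: \<Psi>_def k_def[symmetric] m_def complex_is_Real_iff)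
        also have "\<dots> \<longleftrightarrow> q x > 0"
        proof
          assume "R k (of_real x) \<in> \<real>"
          then obtain r where "R k (of_real x) = of_real r" by (auto elim: Reals_cases)
          hence "of_real (r\<^sup>2) = (of_real (q x) :: complex)" using Rq[OF x] by simp
          hence "r\<^sup>2 = q x" using of_real_eq_iff by blast
          thus "q x > 0" using qnz[OF x] by (metis linorder_neqE_linordered_idom not_less zero_le_power2)
        next
          assume "q x > 0"
          hence "(R k (of_real x))\<^sup>2 = (of_real (sqrt (q x)))\<^sup>2"
            using Rq[OF x] by (metis less_imp_le of_real_power real_sqrt_pow2)
          hence "R k (of_real x) = of_real (sqrt (q x)) \<or> R k (of_real x) = - of_real (sqrt (q x))"
            by (simp only: power2_eq_iff)
          thus "R k (of_real x) \<in> \<real>" by auto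
        qed
        finally show ?thesis .
      qed
      thus ?thesis using sg by (fastforce simp: X_def)
    qed
  qed
  show ?case using hol re bij by (intro exI[of _ \<Psi>]) blast
qed

end

section \<open>Schwarz-Pick estimates\<close>

text \<open>The quotient is the Cayley transform of the upper half-plane to the disc that sends
  \<open>w\<close> to 0. The bound comes from |z - cnj w|^2 - |z - w|^2 = 4 Im z Im w.\<close>

lemma cayley_norm:
  assumes "Im z > 0" "Im w > 0"
  shows "z - cnj w \<noteq> 0" "cmod ((z - w) / (z - cnj w)) < 1"
proof -
  have "Im (z - cnj w) > 0" using assms by simp
  thus nz: "z - cnj w \<noteq> 0" by auto
  have "(cmod (z - cnj w))\<^sup>2 - (cmod (z - w))\<^sup>2 = 4 * Im z * Im w"
    unfolding cmod_power2 by (simp add: power2_eq_square algebra_simps)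
  moreover have "Im z * Im w > 0" using assms by simp
  ultimately have "(cmod (z - w))\<^sup>2 < (cmod (z - cnj w))\<^sup>2" by linarith
  hence "cmod (z - w) < cmod (z - cnj w)" by (rule power2_less_imp_less) simp
  thus "cmod ((z - w) / (z - cnj w)) < 1" using nz by (simp add: norm_divide)
qed

lemma cayley_inverse:
  assumes "Im w > 0" "cmod u < 1"
  shows "Im ((w - cnj w * u) / (1 - u)) > 0"
    "((w - cnj w * u) / (1 - u) - w) / ((w - cnj w * u) / (1 - u) - cnj w) = u"
proof -
  have nz: "1 - u \<noteq> 0" using assms by auto
  have wn: "w - cnj w \<noteq> 0" using assms by (auto simp: complex_eq_iff)
  have e1: "(w - cnj w * u) / (1 - u) - w = (w - cnj w) * u / (1 - u)"
    using nz by (simp add: field_simps)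
  have e2: "(w - cnj w * u) / (1 - u) - cnj w = (w - cnj w) / (1 - u)"
    using nz by (simp add: field_simps)
  show "((w - cnj w * u) / (1 - u) - w) / ((w - cnj w * u) / (1 - u) - cnj w) = u"
    unfolding e1 e2 using nz wn by simp
  have "(cmod u)\<^sup>2 < 1" using assms(2) by (simp add: power_less_one_iff)
  hence c: "(Re u)\<^sup>2 + (Im u)\<^sup>2 < 1" by (simp add: cmod_power2)
  have "Im ((w - cnj w * u) / (1 - u)) = Im w * (1 - ((Re u)\<^sup>2 + (Im u)\<^sup>2)) / ((1 - Re u)\<^sup>2 + (Im u)\<^sup>2)"
    by (simp add: Im_divide power2_eq_square algebra_simps)
  moreover have "(1 - Re u)\<^sup>2 + (Im u)\<^sup>2 > 0"
    using nz by (auto simp: complex_eq_iff sum_power2_gt_zero_iff)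
  ultimately show "Im ((w - cnj w * u) / (1 - u)) > 0" using assms(1) c by simp
qed

lemma schwarz_pick:
  assumes hol: "f holomorphic_on {z. Im z > 0}" and pos: "\<And>z. Im z > 0 \<Longrightarrow> Im (f z) > 0"
    and z: "Im z > 0" and w: "Im w > 0"
  shows "cmod ((f z - f w) / (f z - cnj (f w))) \<le> cmod ((z - w) / (z - cnj w))"
proof -
  define C where "C = (\<lambda>u. (w - cnj w * u) / (1 - u))"
  define g where "g = (\<lambda>u. (f (C u) - f w) / (f (C u) - cnj (f w)))"
  have C: "Im (C u) > 0" if "cmod u < 1" for u using cayley_inverse(1)[OF w that] by (simp add: C_def)
  have "C holomorphic_on ball 0 1" unfolding C_def by (auto intro!: holomorphic_intros)
  hence fC: "(\<lambda>u. f (C u)) holomorphic_on ball 0 1"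
    using holomorphic_on_compose_gen[OF _ hol, of C "ball 0 1"] C by (force simp: o_def)
  have "g holomorphic_on ball 0 1" unfolding g_def
    by (intro holomorphic_intros fC) (use cayley_norm(1)[OF pos[OF C] pos[OF w]] in auto)
  moreover have "g 0 = 0" by (simp add: g_def C_def)
  moreover have "cmod (g u) < 1" if "cmod u < 1" for u
    unfolding g_def by (rule cayley_norm) (use pos C[OF that] w in auto)
  moreover define u where "u = (z - w) / (z - cnj w)"
  have u: "cmod u < 1" using cayley_norm(2)[OF z w] by (simp add: u_def)
  ultimately have "cmod (g u) \<le> cmod u" by (rule Schwarz_Lemma(1)) (use u in auto)
  moreover have "C u = z"
  proof -
    have nz: "z - cnj w \<noteq> 0" using cayley_norm(1)[OF z w] .
    have wn: "w - cnj w \<noteq> 0" using w by (auto simp: complex_eq_iff)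
    have "1 - u = (w - cnj w) / (z - cnj w)" using nz by (simp add: u_def field_simps)
    moreover have "w - cnj w * u = z * (w - cnj w) / (z - cnj w)" using nz by (simp add: u_def field_simps)
    ultimately show ?thesis using nz wn by (simp add: C_def)
  qed
  ultimately show ?thesis by (simp add: g_def u_def)
qed

text \<open>A Euclidean form of Schwarz-Pick that is linear in \<open>Im (f w)\<close>. In the
  notation of the proof, Schwarz-Pick gives \<open>X * (A - B) \<le> 2 * B * Im (f w)\<close>;
  multiplication by \<open>A + B\<close> turns \<open>A - B\<close> into
  \<open>4 * (Im z * Im w)\<close>.\<close>

lemma pick_dist_pos:
  assumes hol: "f holomorphic_on {z. Im z > 0}" and pos: "\<And>z. Im z > 0 \<Longrightarrow> Im (f z) > 0"
    and z: "Im z > 0" and w: "Im w > 0"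
  shows "cmod (f z - f w) \<le> (cmod (z - cnj w))\<^sup>2 / (Im w * Im z) * Im (f w)"
proof -
  define A where "A = cmod (z - cnj w)"
  define B where "B = cmod (z - w)"
  define X where "X = cmod (f z - f w)"
  have A: "A > 0" using cayley_norm(1)[OF z w] by (simp add: A_def)
  have "A\<^sup>2 - B\<^sup>2 = 4 * Im z * Im w"
    unfolding A_def B_def cmod_power2 by (simp add: power2_eq_square algebra_simps)
  hence AB: "(A - B) * (A + B) = 4 * (Im z * Im w)" by (simp add: power2_eq_square algebra_simps)
  have zw: "Im z * Im w > 0" using z w by simp
  have BA: "B < A" using cayley_norm(2)[OF z w] A by (simp add: norm_divide A_def B_def)
  have fnz: "cmod (f z - cnj (f w)) > 0" using cayley_norm(1)[OF pos[OF z] pos[OF w]] by simp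
  have "X / cmod (f z - cnj (f w)) \<le> B / A"
    using schwarz_pick[OF hol pos z w] by (simp add: norm_divide X_def A_def B_def)
  hence "X * A \<le> B * cmod (f z - cnj (f w))" using fnz A by (simp add: field_simps)
  also have "f z - cnj (f w) = (f z - f w) + (f w - cnj (f w))" by simp
  also have "B * cmod \<dots> \<le> B * (X + 2 * Im (f w))"
  proof (intro mult_left_mono order.trans[OF norm_triangle_ineq])
    have "cmod (f w - cnj (f w)) = 2 * Im (f w)"
      using pos[OF w] by (simp add: complex_diff_cnj norm_mult)
    thus "cmod (f z - f w) + cmod (f w - cnj (f w)) \<le> X + 2 * Im (f w)" by (simp add: X_def)
  qed (simp add: B_def)
  finally have "X * (A - B) \<le> 2 * B * Im (f w)" by (simp add: algebra_simps)
  hence "X * (A - B) * (A + B) \<le> 2 * B * Im (f w) * (A + B)"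
    using A by (intro mult_right_mono) (auto simp: B_def add_pos_nonneg less_imp_le)
  hence "X * ((A - B) * (A + B)) \<le> 2 * (B * (A + B)) * Im (f w)" by (simp add: mult_ac)
  hence "X * (4 * (Im z * Im w)) \<le> 2 * (B * (A + B)) * Im (f w)" unfolding AB .
  also have "\<dots> \<le> 2 * (A * (A + A)) * Im (f w)"
    using BA A pos[OF w] by (intro mult_right_mono mult_left_mono mult_mono) (auto simp: B_def)
  finally have "X * (Im z * Im w) \<le> A\<^sup>2 * Im (f w)" by (simp add: power2_eq_square)
  thus ?thesis using zw by (simp add: X_def A_def field_simps)
qed

lemma connected_upper: "connected {z. Im z > 0}"
  by (simp add: convex_connected convex_halfspace_Im_gt)

lemma Im_sign_const:
  assumes "connected D" "continuous_on D f" "\<And>z. z \<in> D \<Longrightarrow> Im (f z) \<noteq> 0"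
  shows "(\<forall>z\<in>D. Im (f z) > 0) \<or> (\<forall>z\<in>D. Im (f z) < 0)"
proof -
  have "connected ((\<lambda>z. Im (f z)) ` D)"
    by (intro connected_continuous_image continuous_intros assms)
  hence "\<not> (Im (f x) < 0 \<and> Im (f y) > 0)" if "x \<in> D" "y \<in> D" for x y
    using connectedD_interval[of "(\<lambda>z. Im (f z)) ` D" "Im (f x)" "Im (f y)" 0] that assms(3) by force
  thus ?thesis using assms(3) by (meson linorder_neqE_linordered_idom)
qed

lemma pick_dist:
  assumes hol: "f holomorphic_on {z. Im z > 0}" and nz: "\<And>z. Im z > 0 \<Longrightarrow> Im (f z) \<noteq> 0"
    and z: "Im z > 0" and w: "Im w > 0"
  shows "cmod (f z - f w) \<le> (cmod (z - cnj w))\<^sup>2 / (Im w * Im z) * \<bar>Im (f w)\<bar>"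
proof -
  have "(\<forall>z\<in>{z. Im z > 0}. Im (f z) > 0) \<or> (\<forall>z\<in>{z. Im z > 0}. Im (f z) < 0)"
    by (rule Im_sign_const[OF connected_upper holomorphic_on_imp_continuous_on[OF hol]]) (use nz in auto)
  thus ?thesis
  proof
    assume "\<forall>z\<in>{z. Im z > 0}. Im (f z) > 0"
    thus ?thesis using pick_dist_pos[OF hol _ z w] w by auto
  next
    assume n: "\<forall>z\<in>{z. Im z > 0}. Im (f z) < 0"
    have "cmod (- f z - (- f w)) \<le> (cmod (z - cnj w))\<^sup>2 / (Im w * Im z) * Im (- f w)"
      by (rule pick_dist_pos[OF _ _ z w]) (use n hol in \<open>auto intro!: holomorphic_intros\<close>)
    moreover have "cmod (- f z - (- f w)) = cmod (f z - f w)" by (metis minus_diff_minus norm_minus_cancel)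
    ultimately show ?thesis using n w by auto
  qed
qed

text \<open>A function that maps each half-plane into a half-plane and is real on an interval around
  \<open>t\<close> satisfies \<open>\<bar>f w - f \<i>\<bar> \<le> A / \<bar>Im w\<bar>\<close>; the factor \<open>(w - t)\<^sup>2 - r\<^sup>2\<close> vanishes at the two real
  points of the circle and absorbs the singularity of this bound.\<close>

lemma pick_real_point:
  assumes "0 < \<eta>" "\<eta> < 1" "\<bar>t\<bar> \<le> 1 / \<eta>"
    and D: "open D" "connected D" "{z. Im z \<noteq> 0} \<subseteq> D" "of_real ` {t - \<eta><..<t + \<eta>} \<subseteq> D" "\<And>z. z \<in> D \<Longrightarrow> cnj z \<in> D"
    and hol: "f holomorphic_on D" and nr: "\<And>z. Im z \<noteq> 0 \<Longrightarrow> Im (f z) \<noteq> 0"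
    and re: "\<And>x. of_real x \<in> D \<Longrightarrow> f (of_real x) \<in> \<real>"
  shows "cmod (f (of_real t) - f \<i>) \<le> 4 / \<eta> * ((1 / \<eta> + 2)\<^sup>2 + 2) * \<bar>Im (f \<i>)\<bar>"
proof -
  define r where "r = \<eta> / 2"
  define y where "y = \<bar>Im (f \<i>)\<bar>"
  define B where "B = (1 / \<eta> + 2)\<^sup>2"
  have refl: "f (cnj z) = cnj (f z)" if z: "z \<in> D" for z
  proof -
    \<comment> \<open>Schwarz reflection: the conjugated function agrees with \<open>f\<close> on a
      real interval, hence on all of \<open>D\<close>.\<close>
    define g where "g = (\<lambda>z. cnj (f (cnj z)))"
    have "z \<in> D \<longleftrightarrow> cnj z \<in> D" for z using D(5)[of z] D(5)[of "cnj z"] unfolding complex_cnj_cnj by iprover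
    hence cD: "cnj ` D = D" unfolding image_cnj_conv_vimage_cnj vimage_def by simp
    have "g holomorphic_on D"
      using holomorphic_on_compose_cnj_cnj[of f D] hol D(1) unfolding cD g_def o_def by simp
    have eqr: "f w = g w" if w: "w \<in> of_real ` {t - \<eta><..<t + \<eta>}" for w
    proof -
      have "w \<in> D" using w D(4) by (rule rev_subsetD)
      moreover from w obtain x where "w = of_real x" by (rule imageE)
      ultimately have x: "w = of_real x" "of_real x \<in> D" by simp_all
      obtain v where "f (of_real x) = of_real v" using re[OF x(2)] by (auto elim: Reals_cases)
      thus ?thesis by (simp add: g_def x(1))
    qed
    have "(of_real t :: complex) islimpt of_real ` {t - \<eta><..<t + \<eta>}"
      unfolding islimpt_approachable
    proof (intro allI impI)
      fix e :: real assume "e > 0"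
      define x where "x = t + min e \<eta> / 2"
      have "x \<noteq> t" "x \<in> {t - \<eta><..<t + \<eta>}" "\<bar>x - t\<bar> < e"
        using \<open>e > 0\<close> assms(1) by (auto simp: x_def min_def)
      moreover have "dist (of_real x) (of_real t :: complex) = \<bar>x - t\<bar>"
        by (simp add: dist_norm flip: of_real_diff)
      ultimately show "\<exists>x'\<in>of_real ` {t - \<eta><..<t + \<eta>}. x' \<noteq> of_real t \<and> dist x' (of_real t :: complex) < e"
        by (intro bexI[of _ "of_real x"] conjI imageI) simp_all
    qed
    moreover have "of_real t \<in> D" using D(4) assms(1) by (auto intro!: subsetD[OF D(4)] imageI)
    moreover have "(\<lambda>z. f z - g z) holomorphic_on D"
      by (intro holomorphic_intros hol \<open>g holomorphic_on D\<close>)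
    ultimately have "f z - g z = 0"
      using analytic_continuation[of "\<lambda>z. f z - g z" D "of_real ` {t - \<eta><..<t + \<eta>}" "of_real t" z]
        D(1,2,4) z eqr by simp
    thus ?thesis by (simp add: g_def)
  qed
  \<comment> \<open>In the lower half-plane reflection replaces \<open>f \<i>\<close> by its
    conjugate, at distance \<open>2 * y\<close>. This is the 2 added to \<open>B\<close>.\<close>
  have bnd: "cmod (f w - f \<i>) \<le> (B + 2) * y / \<bar>Im w\<bar>" if w: "Im w \<noteq> 0" "cmod (w - of_real t) \<le> r" for w
  proof -
    have upper: "cmod (f z - f \<i>) \<le> B * y / Im z" if z: "Im z > 0" "cmod (z - of_real t) \<le> r" for z
    proof -
      have "cmod (z - cnj \<i>) \<le> cmod (z - of_real t) + cmod (of_real t + \<i>)"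
        using norm_triangle_ineq[of "z - of_real t" "of_real t + \<i>"] by simp
      also have "cmod (of_real t + \<i>) \<le> \<bar>t\<bar> + 1"
        using norm_triangle_ineq[of "of_real t" \<i>] by simp
      finally have "cmod (z - cnj \<i>) \<le> 1 / \<eta> + 2" using assms(2,3) z(2) by (simp add: r_def)
      hence "(cmod (z - cnj \<i>))\<^sup>2 \<le> B" unfolding B_def by (intro power_mono) auto
      hence "(cmod (z - cnj \<i>))\<^sup>2 / (Im \<i> * Im z) * \<bar>Im (f \<i>)\<bar> \<le> B / (Im \<i> * Im z) * \<bar>Im (f \<i>)\<bar>"
        using z(1) by (intro mult_right_mono divide_right_mono) auto
      moreover have "cmod (f z - f \<i>) \<le> (cmod (z - cnj \<i>))\<^sup>2 / (Im \<i> * Im z) * \<bar>Im (f \<i>)\<bar>"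
      proof (rule pick_dist)
        show "f holomorphic_on {z. Im z > 0}" by (rule holomorphic_on_subset[OF hol]) (use D(3) in auto)
      qed (use z nr in auto)
      ultimately show ?thesis by (simp add: y_def)
    qed
    have y0: "y \<ge> 0" "B \<ge> 0" by (simp_all add: y_def B_def)
    show ?thesis
    proof (cases "Im w > 0")
      case True
      have "B * y / Im w \<le> (B + 2) * y / Im w"
        using y0 True by (intro divide_right_mono mult_right_mono) auto
      thus ?thesis using upper[OF True w(2)] True by simp
    next
      case False
      hence n: "Im (cnj w) > 0" using w(1) by simp
      have d: "cmod (cnj w - of_real t) \<le> r"
        using w(2) by (metis complex_cnj_complex_of_real complex_cnj_diff complex_mod_cnj)
      have "w \<in> D" using w(1) D(3) by auto
      hence "f w = cnj (f (cnj w))" using refl[of "cnj w"] D(5)[of w] by simp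
      hence "f w - f \<i> = cnj (f (cnj w) - f \<i>) + (cnj (f \<i>) - f \<i>)" by simp
      hence "cmod (f w - f \<i>) \<le> cmod (f (cnj w) - f \<i>) + cmod (cnj (f \<i>) - f \<i>)"
        by (metis complex_mod_cnj norm_triangle_ineq)
      also have "cmod (cnj (f \<i>) - f \<i>) = 2 * y"
      proof -
        have "cnj (f \<i>) - f \<i> = of_real (- 2 * Im (f \<i>)) * \<i>" by (simp add: complex_eq_iff)
        thus ?thesis by (simp add: norm_mult y_def)
      qed
      also have "cmod (f (cnj w) - f \<i>) \<le> B * y / \<bar>Im w\<bar>" using upper[OF n d] False by simp
      also have "2 * y \<le> 2 * y / \<bar>Im w\<bar>"
      proof -
        have "\<bar>Im w\<bar> \<le> cmod (w - of_real t)" using abs_Im_le_cmod[of "w - of_real t"] by simp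
        hence "\<bar>Im w\<bar> \<le> 1" using w(2) assms(2) by (simp add: r_def)
        hence "2 * y * \<bar>Im w\<bar> \<le> 2 * y * 1" using y0 by (intro mult_left_mono) auto
        thus ?thesis using w(1) by (simp add: pos_le_divide_eq)
      qed
      finally show ?thesis by (simp add: add_divide_distrib algebra_simps)
    qed
  qed
  define g where "g = (\<lambda>w. (f w - f \<i>) * ((w - of_real t)\<^sup>2 - of_real (r\<^sup>2)))"
  have r: "r > 0" using assms(1) by (simp add: r_def)
  have sub: "cball (of_real t) r \<subseteq> D"
  proof
    fix w :: complex assume w: "w \<in> cball (of_real t) r"
    show "w \<in> D"
    proof (cases "Im w = 0")
      case True
      have "w = of_real (Re w)" using True by (simp add: complex_eq_iff)
      moreover have "\<bar>Re w - t\<bar> \<le> r"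
        using w abs_Re_le_cmod[of "w - of_real t"] by (simp add: dist_norm norm_minus_commute)
      hence "\<bar>Re w - t\<bar> < \<eta>" using assms(1) unfolding r_def by linarith
      hence "Re w \<in> {t - \<eta><..<t + \<eta>}" unfolding abs_less_iff by simp
      ultimately show ?thesis using D(4) by (metis image_eqI subsetD)
    qed (use D(3) in auto)
  qed
  have gh: "g holomorphic_on D" unfolding g_def by (intro holomorphic_intros hol)
  have "cmod (g (of_real t)) \<le> 2 * r * ((B + 2) * y)"
  proof (rule maximum_modulus_frontier[of g "cball (of_real t) r"])
    show "g holomorphic_on interior (cball (of_real t) r)"
      by (rule holomorphic_on_subset[OF gh]) (use sub interior_subset in blast)
    show "continuous_on (closure (cball (of_real t) r)) g"
      using holomorphic_on_imp_continuous_on[OF gh] sub by (auto intro: continuous_on_subset)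
    show "cmod (g w) \<le> 2 * r * ((B + 2) * y)" if "w \<in> frontier (cball (of_real t) r)" for w :: complex
    proof -
      have wr: "cmod (w - of_real t) = r" using that r by (simp add: dist_norm norm_minus_commute)
      \<comment> \<open>On the circle the auxiliary factor becomes \<open>w - of_real t\<close>
        times 2 i Im w, which cancels the denominator of \<open>bnd\<close>.\<close>
      have "of_real (r\<^sup>2) = (w - of_real t) * cnj (w - of_real t)"
        using wr by (metis complex_norm_square of_real_power)
      hence "(w - of_real t)\<^sup>2 - of_real (r\<^sup>2) = (w - of_real t) * ((w - of_real t) - cnj (w - of_real t))"
        by (simp add: power2_eq_square algebra_simps)
      also have "(w - of_real t) - cnj (w - of_real t) = of_real (2 * Im w) * \<i>"
        by (simp add: complex_eq_iff)
      finally have n: "cmod ((w - of_real t)\<^sup>2 - of_real (r\<^sup>2)) = 2 * r * \<bar>Im w\<bar>"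
        by (simp add: norm_mult wr)
      show ?thesis
      proof (cases "Im w = 0")
        case True
        thus ?thesis using n r by (simp add: g_def norm_mult y_def B_def)
      next
        case False
        have "cmod (g w) \<le> (B + 2) * y / \<bar>Im w\<bar> * (2 * r * \<bar>Im w\<bar>)"
          unfolding g_def norm_mult n using bnd[OF False] wr r by (intro mult_right_mono) auto
        also have "\<dots> = 2 * r * ((B + 2) * y)" using False by simp
        finally show ?thesis .
      qed
    qed
  qed (use r in auto)
  moreover have "cmod (g (of_real t)) = cmod (f (of_real t) - f \<i>) * r\<^sup>2"
    by (simp add: g_def norm_mult norm_power)
  ultimately have "cmod (f (of_real t) - f \<i>) * r\<^sup>2 \<le> 2 * r * ((B + 2) * y)" by simp
  hence "cmod (f (of_real t) - f \<i>) * r \<le> 2 * ((B + 2) * y)"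
    using r by (simp add: power2_eq_square)
  hence "cmod (f (of_real t) - f \<i>) \<le> 2 * ((B + 2) * y) / r" using r by (simp add: pos_le_divide_eq)
  also have "\<dots> = 4 / \<eta> * ((1 / \<eta> + 2)\<^sup>2 + 2) * \<bar>Im (f \<i>)\<bar>"
    unfolding r_def B_def y_def by simp
  finally show ?thesis .
qed

section \<open>Gain of mass from folding one side\<close>

context window
begin

definition mid :: "real \<Rightarrow> (real \<times> real) list \<Rightarrow> real \<Rightarrow> bool" where
  "mid \<eta> fs x \<longleftrightarrow> cmod (fold_comp fs (of_real x)) \<le> 1 / \<eta> \<and> (\<forall>s\<in>S. cmod (fold_comp fs (of_real x) - s) \<ge> \<eta>)"

lemma fold_comp_Re: "fold_comp fs (of_real x) = of_real (Re (fold_comp fs (of_real x)))"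
  using fold_comp_real[of "of_real x" fs] by simp

lemma fold_comp_real_deriv:
  assumes "adm fs" "of_real x \<notin> vert S fs"
  shows "\<exists>D. D \<noteq> 0 \<and> ((\<lambda>x. Re (fold_comp fs (of_real x))) has_real_derivative D) (at x)"
proof -
  obtain D where D: "D \<noteq> 0" "(fold_comp fs has_field_derivative D) (at (of_real x))"
    using fold_comp_deriv_nz[OF assms] by blast
  have v: "((\<lambda>x. fold_comp fs (of_real x)) has_vector_derivative D) (at x)"
    by (rule has_vector_derivative_real_field[OF D(2)])
  have re: "((\<lambda>x. Re (fold_comp fs (of_real x))) has_real_derivative Re D) (at x)"
    using bounded_linear.has_vector_derivative[OF bounded_linear_Re v]
    by (simp add: has_real_derivative_iff_has_vector_derivative)
  have "((\<lambda>x. Im (fold_comp fs (of_real x))) has_real_derivative Im D) (at x)"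
    using bounded_linear.has_vector_derivative[OF bounded_linear_Im v]
    by (simp add: has_real_derivative_iff_has_vector_derivative)
  moreover have "(\<lambda>x. Im (fold_comp fs (of_real x))) = (\<lambda>x. 0)"
    by (subst fold_comp_Re) simp
  ultimately have "Im D = 0" using DERIV_unique[of "\<lambda>x. 0" "Im D" x 0] by simp
  hence "Re D \<noteq> 0" using D(1) by (auto simp: complex_eq_iff)
  thus ?thesis using re by blast
qed

lemma fold_comp_cont:
  assumes "\<And>x. x \<in> X \<Longrightarrow> of_real x \<notin> vert S fs"
  shows "continuous_on X (\<lambda>x. Re (fold_comp fs (of_real x)))"
proof -
  have "continuous_on X (\<lambda>x. fold_comp fs (of_real x))"
    by (rule continuous_on_compose2[OF holomorphic_on_imp_continuous_on[OF fold_comp_holomorphic]])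
       (use assms poles_subset_vert in \<open>auto intro!: continuous_intros\<close>)
  thus ?thesis by (intro continuous_intros)
qed

lemma fold_comp_inj_side:
  assumes "adm fs" "\<And>x. x \<in> {p<..<q} \<Longrightarrow> of_real x \<notin> vert S fs" "x \<in> {p<..<q}" "y \<in> {p<..<q}"
    "fold_comp fs (of_real x) = fold_comp fs (of_real y)"
  shows "x = y"
proof -
  have False if xy: "x < y" "x \<in> {p<..<q}" "y \<in> {p<..<q}"
      "fold_comp fs (of_real x) = fold_comp fs (of_real y)" for x y
  proof -
    define h where "h = (\<lambda>x. Re (fold_comp fs (of_real x)))"
    have h: "\<exists>D. D \<noteq> 0 \<and> (h has_real_derivative D) (at z)" if "z \<in> {x..y}" for z
      unfolding h_def using that xy by (intro fold_comp_real_deriv assms) auto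
    have "continuous_on {x..y} h" unfolding h_def by (rule fold_comp_cont) (use xy assms(2) in auto)
    moreover have "h x = h y" using xy by (simp add: h_def)
    moreover have "h differentiable (at z)" if "x < z" "z < y" for z
      using h[of z] that real_differentiable_def by force
    ultimately obtain z where z: "x < z" "z < y" "DERIV h z :> 0" using Rolle[OF xy(1), of h] by blast
    then obtain D where "D \<noteq> 0" "(h has_real_derivative D) (at z)" using h[of z] by auto
    thus False using z(3) DERIV_unique by blast
  qed
  from this[of x y] this[of y x] show ?thesis using assms(3,4,5) by (metis linorder_neqE_linordered_idom)
qed

lemma enclosing_side:
  assumes "adm fs" "u \<le> v" "\<And>x. x \<in> {u..v} \<Longrightarrow> of_real x \<notin> vert S fs"
    "rlifts fs a \<le> u" "v \<le> rlifts fs b"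
  obtains p q where "p < u" "v < q" "of_real p \<in> vert S fs" "of_real q \<in> vert S fs"
    "\<And>x. x \<in> {p<..<q} \<Longrightarrow> of_real x \<notin> vert S fs" "rlifts fs a \<le> p" "q \<le> rlifts fs b"
proof -
  define VR where "VR = {x::real. of_real x \<in> vert S fs}"
  have "VR = of_real -` vert S fs" by (auto simp: VR_def)
  hence fV: "finite VR" using finite_vert[OF assms(1)] by (simp add: finite_vimageI inj_of_real)
  have e: "rlifts fs a \<in> VR" "rlifts fs b \<in> VR" using rlifts_vert[OF assms(1)] aS bS by (auto simp: VR_def)
  have uv: "u \<notin> VR" "v \<notin> VR" using assms(2,3) by (auto simp: VR_def)
  define P where "P = {x\<in>VR. x < u}"
  define R where "R = {x\<in>VR. x > v}"
  have P: "finite P" "rlifts fs a \<in> P" using fV e uv assms(4) by (auto simp: P_def order.order_iff_strict)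
  have R: "finite R" "rlifts fs b \<in> R" using fV e uv assms(5) by (auto simp: R_def order.order_iff_strict)
  have mp: "Max P \<in> P" using P by (intro Max_in) auto
  have mr: "Min R \<in> R" using R by (intro Min_in) auto
  show ?thesis
  proof (rule that)
    show "Max P < u" "v < Min R" "of_real (Max P) \<in> vert S fs" "of_real (Min R) \<in> vert S fs"
      using mp mr by (auto simp: P_def R_def VR_def)
    show "rlifts fs a \<le> Max P" "Min R \<le> rlifts fs b" using P R by auto
    show "of_real x \<notin> vert S fs" if x: "x \<in> {Max P<..<Min R}" for x
    proof
      assume "of_real x \<in> vert S fs"
      hence xV: "x \<in> VR" by (simp add: VR_def)
      have "\<not> x < u" using Max_ge[OF P(1), of x] x xV by (auto simp: P_def)
      moreover have "\<not> x > v" using Min_le[OF R(1), of x] x xV by (auto simp: R_def)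
      ultimately show False using assms(3)[of x] xV by (auto simp: VR_def)
    qed
  qed
qed

text \<open>The fold takes the whole gap around \<open>u\<close> and \<open>v\<close>. One inverse
  branch \<phi> of the composition passes through both points, and Schwarz-Pick keeps them within
  \<open>K * y\<close> of \<phi>(i), where \<open>y\<close> is the modulus of Im \<phi>(i). So
  \<open>y\<close> is at least a multiple of \<open>v - u\<close>, and by \<open>mass_gain\<close>
  the fiber point \<phi>(i) alone yields the claimed gain.\<close>

lemma side_gain:
  assumes \<eta>: "0 < \<eta>" "\<eta> < 1" and K: "K = 4 / \<eta> * ((1 / \<eta> + 2)\<^sup>2 + 2)"
    and adm: "adm fs" and uv: "u \<le> v" "\<And>x. x \<in> {u..v} \<Longrightarrow> of_real x \<notin> vert S fs"
    "rlifts fs a \<le> u" "v \<le> rlifts fs b" and mu: "mid \<eta> fs u" and mv: "mid \<eta> fs v"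
  shows "\<exists>f. adm (f # fs) \<and> u \<in> gate f \<and> v \<in> gate f \<and>
    mass (f # fs) \<i> \<ge> mass fs \<i> + (v - u) / (K * (7 + 4 * K)\<^sup>2)"
proof -
  have K0: "K > 0"
  proof -
    have "(1 / \<eta> + 2)\<^sup>2 + 2 > 0" by (rule add_nonneg_pos) auto
    thus ?thesis using \<eta> by (simp add: K)
  qed
  obtain p q where pq: "p < u" "v < q" "of_real p \<in> vert S fs" "of_real q \<in> vert S fs"
    "\<And>x. x \<in> {p<..<q} \<Longrightarrow> of_real x \<notin> vert S fs" "rlifts fs a \<le> p" "q \<le> rlifts fs b"
    using enclosing_side[OF adm uv] by metis
  \<comment> \<open>The only fold whose critical values are \<open>p\<close> and
    \<open>q\<close>.\<close>
  define f where "f = ((p + q) / 2, (q - p) / 4)"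
  have fe: "fst f - 2 * snd f = p" "fst f + 2 * snd f = q" by (simp_all add: f_def field_simps)
  have gf: "gate f = {p<..<q}" unfolding gate_def fe ..
  have d0: "snd f > 0" using pq uv by (simp add: f_def)
  have admf: "adm (f # fs)" using adm d0 pq by (simp add: fe gf)
  define t where "t = Re (fold_comp fs (of_real u))"
  define t' where "t' = Re (fold_comp fs (of_real v))"
  have Qu: "fold_comp fs (of_real u) = of_real t" "fold_comp fs (of_real v) = of_real t'"
    unfolding t_def t'_def by (rule fold_comp_Re)+
  define X where "X = {x::real. of_real x \<notin> S}"
  define C where "C = connected_component_set X t"
  \<comment> \<open>The plane slit along the real line outside \<open>C\<close>, the component of
    \<open>X\<close> that contains \<open>t\<close>. It is starlike about \<open>t\<close>, and its
    real points are exactly \<open>C\<close>.\<close>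
  define D where "D = {z. Im z \<noteq> 0} \<union> {z. Re z \<in> C}"
  have "X = - (of_real -` S)" by (auto simp: X_def)
  moreover have "finite (of_real -` S :: real set)" using fin by (simp add: finite_vimageI inj_of_real)
  ultimately have oX: "open X" by (simp add: finite_imp_closed open_Compl)
  have oC: "open C" unfolding C_def by (rule open_connected_component[OF oX])
  have CX: "C \<subseteq> X" unfolding C_def by (rule connected_component_subset)
  have cC: "connected C" unfolding C_def by simp
  have near: "{x - \<eta><..<x + \<eta>} \<subseteq> X" if "\<And>s. s \<in> S \<Longrightarrow> cmod (of_real x - s) \<ge> \<eta>" for x
  proof
    fix y assume y: "y \<in> {x - \<eta><..<x + \<eta>}"
    show "y \<in> X" unfolding X_def
    proof (intro CollectI notI)
      assume "of_real y \<in> S"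
      hence "cmod (of_real x - of_real y) \<ge> \<eta>" using that by blast
      thus False using y by (simp flip: of_real_diff) linarith
    qed
  qed
  have nt: "{t - \<eta><..<t + \<eta>} \<subseteq> X" "{t' - \<eta><..<t' + \<eta>} \<subseteq> X"
    by (rule near, use mu mv Qu in \<open>force simp: mid_def\<close>)+
  have tC: "t \<in> C" using nt \<eta> by (auto simp: C_def connected_component_refl)
  have tC': "t' \<in> C"
  proof -
    have "connected ((\<lambda>x. Re (fold_comp fs (of_real x))) ` {u..v})"
      by (intro connected_continuous_image fold_comp_cont uv) auto
    moreover have "(\<lambda>x. Re (fold_comp fs (of_real x))) ` {u..v} \<subseteq> X"
      using uv(2) fold_comp_off_vert fold_comp_Re by (auto simp: X_def)
    ultimately have "connected_component X t t'"
      unfolding connected_component_def using uv(1) by (intro exI) (auto simp: t_def t'_def)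
    thus ?thesis by (simp add: C_def)
  qed
  have intC: "{x - \<eta><..<x + \<eta>} \<subseteq> C" if "{x - \<eta><..<x + \<eta>} \<subseteq> X" "x \<in> C" for x
  proof -
    have "{x - \<eta><..<x + \<eta>} \<subseteq> connected_component_set X x"
      by (rule connected_component_maximal) (use that \<eta> in auto)
    thus ?thesis using that(2) connected_component_eq[of x X t] by (simp add: C_def)
  qed
  have inD: "of_real x \<in> D \<longleftrightarrow> x \<in> C" for x by (simp add: D_def)
  have "D = {z. Im z > 0} \<union> {z. Im z < 0} \<union> Re -` C" by (auto simp: D_def)
  hence oD: "open D"
    using oC by (simp add: open_halfspace_Im_gt open_halfspace_Im_lt open_Un open_vimage continuous_on_Re)
  have "starlike D" unfolding starlike_def
  proof (intro bexI ballI)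
    fix z assume z: "z \<in> D"
    show "closed_segment (of_real t) z \<subseteq> D"
    proof
      fix w assume "w \<in> closed_segment (of_real t) z"
      then obtain k where k: "0 \<le> k" "k \<le> 1" "w = (1 - k) *\<^sub>R of_real t + k *\<^sub>R z"
        by (auto simp: closed_segment_def)
      show "w \<in> D"
      proof (cases "k = 0 \<or> Im z = 0")
        case False
        thus ?thesis using k by (simp add: D_def)
      next
        case True
        have "Re w \<in> C"
        proof (cases "k = 0")
          case True thus ?thesis using k tC by simp
        next
          case False
          hence "Re z \<in> C" using True z by (simp add: D_def)
          moreover have "convex C" using cC by (simp add: is_interval_connected_1 is_interval_convex_1[symmetric])
          ultimately have "(1 - k) *\<^sub>R t + k *\<^sub>R Re z \<in> C"
            using convexD_alt[OF _ tC, of "Re z" k] k by simp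
          thus ?thesis using k by simp
        qed
        thus ?thesis by (simp add: D_def)
      qed
    qed
  qed (use tC in \<open>simp add: D_def\<close>)
  hence scD: "simply_connected D" by (rule starlike_imp_simply_connected)
  have DS: "D \<inter> S = {}"
  proof -
    have "z \<notin> S" if "z \<in> D" for z
    proof
      assume "z \<in> S"
      then obtain x where "z = of_real x" using real by (auto elim!: Reals_cases)
      thus False using that \<open>z \<in> S\<close> CX by (auto simp: D_def X_def)
    qed
    thus ?thesis by blast
  qed
  obtain \<Phi> :: "bool list \<Rightarrow> complex \<Rightarrow> complex" where \<Phi>:
    "\<And>l. length l = length fs \<Longrightarrow> \<Phi> l holomorphic_on D"
    "\<And>l. length l = length fs \<Longrightarrow> (\<forall>x. of_real x \<in> D \<longrightarrow> \<Phi> l (of_real x) \<in> \<real>) \<or> (\<forall>x. of_real x \<in> D \<longrightarrow> \<Phi> l (of_real x) \<notin> \<real>)"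
    "\<And>w. w \<in> D \<Longrightarrow> bij_betw (\<lambda>l. \<Phi> l w) {l. length l = length fs} (fiber fs w)"
    using branches[OF adm oD scD DS] cC unfolding inD Collect_mem_eq by blast
  have ufib: "of_real u \<in> fiber fs (of_real t)"
    using Qu uv(1) uv(2)[of u] poles_subset_vert by (auto simp: fiber_def)
  have tD: "of_real t \<in> D" "of_real t' \<in> D" using tC tC' inD by auto
  have "of_real u \<in> (\<lambda>l. \<Phi> l (of_real t)) ` {l. length l = length fs}"
    unfolding bij_betw_imp_surj_on[OF \<Phi>(3)[OF tD(1)]] by (rule ufib)
  then obtain l where "of_real u = \<Phi> l (of_real t)" "l \<in> {l. length l = length fs}" by (rule imageE)
  hence l: "length l = length fs" "\<Phi> l (of_real t) = of_real u" by simp_all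
  define \<phi> where "\<phi> = \<Phi> l"
  have hol: "\<phi> holomorphic_on D" using \<Phi>(1) l by (simp add: \<phi>_def)
  have pt: "\<phi> (of_real t) = of_real u" using l by (simp add: \<phi>_def)
  have re: "\<phi> (of_real x) \<in> \<real>" if "of_real x \<in> D" for x
    using \<Phi>(2)[OF l(1)] pt tD(1) that unfolding \<phi>_def by (metis Reals_of_real)
  have fib: "\<phi> w \<in> fiber fs w" if "w \<in> D" for w
    using bij_betwE[OF \<Phi>(3)[OF that]] l(1) by (auto simp: \<phi>_def)
  have offV: "\<phi> w \<notin> vert S fs" if "w \<in> D" for w
    using fib[OF that] fiber_disjoint_vert[of w S fs] DS that by blast
  have nonre: "Im (\<phi> w) \<noteq> 0" if "Im w \<noteq> 0" for w
    using fiber_nonreal[OF that fib] that by (simp add: D_def)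
  have iD: "\<i> \<in> D" by (simp add: D_def)
  have cnjD: "cnj z \<in> D" if "z \<in> D" for z using that by (simp add: D_def)
  have connD: "connected D" using scD by (rule simply_connected_imp_connected)
  have DIm: "{z. Im z \<noteq> 0} \<subseteq> D" by (auto simp: D_def)
  have intD: "of_real ` {x - \<eta><..<x + \<eta>} \<subseteq> D" if "{x - \<eta><..<x + \<eta>} \<subseteq> X" "x \<in> C" for x
    using intC[OF that] inD by blast
  have bt: "\<bar>t\<bar> \<le> 1 / \<eta>" "\<bar>t'\<bar> \<le> 1 / \<eta>" using mu mv Qu by (simp_all add: mid_def)
  define z where "z = \<phi> \<i>"
  define y where "y = \<bar>Im z\<bar>"
  have du: "cmod (of_real u - z) \<le> K * y"
    using pick_real_point[OF \<eta> bt(1) oD connD DIm intD[OF nt(1) tC] cnjD hol nonre re]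
    by (simp add: pt z_def y_def K)
  \<comment> \<open>The branch maps \<open>C\<close> into the gap between \<open>p\<close> and
    \<open>q\<close>, because its values are never vertices. The composition is injective on the
    gap, so the branch leads from \<open>t'\<close> back to \<open>v\<close>.\<close>
  have pt': "\<phi> (of_real t') = of_real v"
  proof -
    define g where "g = (\<lambda>x. Re (\<phi> (of_real x)))"
    have g: "\<phi> (of_real x) = of_real (g x)" if "x \<in> C" for x
      using re[of x] that inD by (auto simp: g_def)
    have "continuous_on C (\<lambda>x. \<phi> (of_real x))"
      by (rule continuous_on_compose2[OF holomorphic_on_imp_continuous_on[OF hol]])
         (auto simp: inD intro!: continuous_intros)
    hence "connected (g ` C)" unfolding g_def by (intro connected_continuous_image continuous_intros cC)
    moreover have "u \<in> g ` C" using tC pt by (force simp: g_def)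
    moreover have "p \<notin> g ` C" "q \<notin> g ` C" using pq(3,4) offV g inD by (metis imageE)+
    ultimately have gC: "g ` C \<subseteq> {p<..<q}"
      using connectedD_interval[of "g ` C" _ u p] connectedD_interval[of "g ` C" u _ q] pq(1,2) uv(1)
      by (smt (verit) greaterThanLessThan_iff subsetI)
    have "fold_comp fs (of_real (g t')) = of_real t'"
      using fib[OF tD(2)] g[OF tC'] by (simp add: fiber_def)
    hence "g t' = v"
    proof (intro fold_comp_inj_side[OF adm pq(5)])
      show "g t' \<in> {p<..<q}" using gC tC' by blast
    qed (use pq(1,2) uv(1) Qu in auto)
    thus ?thesis using g[OF tC'] by simp
  qed
  have dv: "cmod (of_real v - z) \<le> K * y"
    using pick_real_point[OF \<eta> bt(2) oD connD DIm intD[OF nt(2) tC'] cnjD hol nonre re]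
    by (simp add: pt' z_def y_def K)
  have y0: "y > 0" using nonre[of \<i>] by (simp add: y_def z_def)
  have "\<bar>v - u\<bar> = cmod ((of_real v - z) - (of_real u - z))" by (simp flip: of_real_diff)
  also have "\<dots> \<le> cmod (of_real v - z) + cmod (of_real u - z)" by (rule norm_triangle_ineq4)
  finally have vu: "v - u \<le> 2 * K * y" using du dv uv(1) by simp
  \<comment> \<open>So far \<open>z\<close> could be far away compared with the size of the gap.
    This Moebius image again maps half-planes into half-planes, and the same estimate applied to it
    bounds |z - p| by a multiple of \<open>u - p\<close>.\<close>
  define \<psi> where "\<psi> = (\<lambda>w. - 1 / (\<phi> w - of_real p))"
  have np: "\<phi> w - of_real p \<noteq> 0" if "w \<in> D" for w using offV[OF that] pq(3) by auto
  have "cmod (\<psi> (of_real t) - \<psi> \<i>) \<le> K * \<bar>Im (\<psi> \<i>)\<bar>"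
    unfolding K
  proof (rule pick_real_point[OF \<eta> bt(1) oD connD DIm intD[OF nt(1) tC] cnjD])
    show "\<psi> holomorphic_on D" unfolding \<psi>_def by (intro holomorphic_intros hol np)
    show "Im (\<psi> w) \<noteq> 0" if "Im w \<noteq> 0" for w
    proof -
      have "Im (\<phi> w - of_real p) \<noteq> 0" using nonre[OF that] by simp
      thus ?thesis unfolding \<psi>_def by (auto simp: Im_divide sum_power2_eq_zero_iff)
    qed
    show "\<psi> (of_real x) \<in> \<real>" if "of_real x \<in> D" for x
      unfolding \<psi>_def using re[OF that] by (intro Reals_divide Reals_diff) auto
  qed
  moreover have "\<psi> (of_real t) = of_real (- 1 / (u - p))" by (simp add: \<psi>_def pt)
  moreover have psi: "\<psi> \<i> = - 1 / (z - of_real p)" by (simp add: \<psi>_def z_def)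
  moreover define R where "R = cmod (z - of_real p)"
  have Ry: "R \<ge> y" using abs_Im_le_cmod[of "z - of_real p"] by (simp add: R_def y_def)
  have "\<bar>Im (\<psi> \<i>)\<bar> = y / R\<^sup>2" unfolding psi
    by (simp add: Im_divide R_def y_def cmod_power2)
  ultimately have "cmod (of_real (- 1 / (u - p)) - \<psi> \<i>) \<le> K * (y / R\<^sup>2)" by simp
  moreover have "cmod (of_real (- 1 / (u - p))) = 1 / (u - p)" using pq(1) by (simp only: norm_of_real) simp
  moreover have "cmod (\<psi> \<i>) = 1 / R" by (simp add: psi norm_divide R_def)
  ultimately have "1 / (u - p) \<le> K * (y / R\<^sup>2) + 1 / R"
    using norm_triangle_ineq2[of "of_real (- 1 / (u - p))" "\<psi> \<i>"] by linarith
  also have "y / R\<^sup>2 \<le> R / R\<^sup>2" using Ry by (intro divide_right_mono) auto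
  hence "K * (y / R\<^sup>2) \<le> K * (R / R\<^sup>2)" using K0 by (intro mult_left_mono) auto
  also have "R / R\<^sup>2 = 1 / R" by (simp add: power2_eq_square)
  finally have "1 / (u - p) \<le> (K + 1) / R" by (simp add: add_divide_distrib)
  hence "R \<le> (K + 1) * (u - p)" using pq(1) Ry y0 by (simp add: field_simps)
  also have "\<dots> \<le> (K + 1) * (4 * snd f)" using K0 pq uv(1) by (intro mult_left_mono) (auto simp: f_def)
  also have "\<dots> = 4 * (K + 1) * snd f" by simp
  finally have "R \<le> 4 * (K + 1) * snd f" .
  moreover have "cmod (z - of_real (fst f)) \<le> R + 2 * snd f"
  proof -
    have "cmod (z - of_real (fst f)) \<le> R + cmod (of_real p - of_real (fst f))"
      unfolding R_def using norm_triangle_ineq[of "z - of_real p" "of_real p - of_real (fst f)"] by simp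
    also have "cmod (of_real p - of_real (fst f)) = 2 * snd f"
      using fe(1) d0 by (simp flip: of_real_diff)
    finally show ?thesis by simp
  qed
  \<comment> \<open>In units of \<open>snd f\<close>: 4 (K + 1) from \<open>R\<close>, 2 from
    \<open>p\<close> to the centre, and 1 from the denominator in \<open>mass_gain\<close>.\<close>
  ultimately have "cmod (z - of_real (fst f)) + snd f \<le> (7 + 4 * K) * snd f" by (simp add: algebra_simps)
  hence "(cmod (z - of_real (fst f)) + snd f)\<^sup>2 \<le> ((7 + 4 * K) * snd f)\<^sup>2" using d0 by (intro power_mono) auto
  moreover have "(cmod (z - of_real (fst f)) + snd f)\<^sup>2 > 0" using d0 by (intro zero_less_power add_nonneg_pos) auto
  ultimately have "(snd f)\<^sup>2 * y / (cmod (z - of_real (fst f)) + snd f)\<^sup>2 \<ge> (snd f)\<^sup>2 * y / ((7 + 4 * K) * snd f)\<^sup>2"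
    using y0 by (intro divide_left_mono mult_pos_pos) auto
  moreover have "(snd f)\<^sup>2 * y / ((7 + 4 * K) * snd f)\<^sup>2 = y / (7 + 4 * K)\<^sup>2" using d0 by (simp add: power_mult_distrib)
  moreover have "mass (f # fs) \<i> \<ge> mass fs \<i> + 2 * ((snd f)\<^sup>2 * \<bar>Im z\<bar> / (cmod (z - of_real (fst f)) + snd f)\<^sup>2)"
    by (rule mass_gain[OF admf]) (use fib[OF iD] in \<open>auto simp: z_def\<close>)
  ultimately have "mass (f # fs) \<i> \<ge> mass fs \<i> + 2 * (y / (7 + 4 * K)\<^sup>2)" by (simp add: y_def)
  moreover have "(v - u) / (K * (7 + 4 * K)\<^sup>2) \<le> 2 * (y / (7 + 4 * K)\<^sup>2)"
  proof -
    have "(v - u) / (K * (7 + 4 * K)\<^sup>2) \<le> (2 * K * y) / (K * (7 + 4 * K)\<^sup>2)"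
      using vu K0 by (intro divide_right_mono) auto
    thus ?thesis using K0 by simp
  qed
  ultimately show ?thesis using admf gf pq(1,2) uv(1) by (intro exI[of _ f]) auto
qed

text \<open>On a half-plane the mass is a sum of |Im \<Phi>| over holomorphic branches, none of
  which takes a real value there. \<open>pick_dist\<close> gives a Harnack inequality for every
  branch with the same constant.\<close>

lemma mass_harnack:
  assumes "adm fs" "Im z > 0" "Im w > 0"
  shows "mass fs z \<le> (1 + (cmod (z - cnj w))\<^sup>2 / (Im w * Im z)) * mass fs w"
proof -
  define D where "D = {z. Im z > 0}"
  have D: "open D" "simply_connected D" "D \<inter> S = {}" "connected {x::real. of_real x \<in> D}"
    unfolding D_def using nonreal_notin
    by (auto simp: open_halfspace_Im_gt convex_halfspace_Im_gt intro!: convex_imp_simply_connected)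
  obtain \<Phi> :: "bool list \<Rightarrow> complex \<Rightarrow> complex" where \<Phi>:
    "\<And>l. length l = length fs \<Longrightarrow> \<Phi> l holomorphic_on D"
    "\<And>w. w \<in> D \<Longrightarrow> bij_betw (\<lambda>l. \<Phi> l w) {l. length l = length fs} (fiber fs w)"
    using branches[OF assms(1) D] by auto
  have ms: "mass fs w = (\<Sum>l\<in>{l. length l = length fs}. \<bar>Im (\<Phi> l w)\<bar>)" if "w \<in> D" for w
    unfolding mass_def using sum.reindex_bij_betw[OF \<Phi>(2)[OF that], of "\<lambda>y. \<bar>Im y\<bar>"] by simp
  define k where "k = (cmod (z - cnj w))\<^sup>2 / (Im w * Im z)"
  have "\<bar>Im (\<Phi> l z)\<bar> \<le> (1 + k) * \<bar>Im (\<Phi> l w)\<bar>" if l: "length l = length fs" for l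
  proof -
    have "Im (\<Phi> l v) \<noteq> 0" if "Im v > 0" for v
      using bij_betwE[OF \<Phi>(2)[of v]] fiber_nonreal[of v] that l by (auto simp: D_def)
    hence "cmod (\<Phi> l z - \<Phi> l w) \<le> k * \<bar>Im (\<Phi> l w)\<bar>"
      unfolding k_def using \<Phi>(1)[OF l] assms by (intro pick_dist) (auto simp: D_def)
    thus ?thesis using abs_Im_le_cmod[of "\<Phi> l z - \<Phi> l w"] by (simp add: algebra_simps)
  qed
  hence "(\<Sum>l\<in>{l. length l = length fs}. \<bar>Im (\<Phi> l z)\<bar>) \<le> (\<Sum>l\<in>{l. length l = length fs}. (1 + k) * \<bar>Im (\<Phi> l w)\<bar>)"
    by (intro sum_mono) auto
  thus ?thesis using ms[of z] ms[of w] assms by (simp add: D_def k_def sum_distrib_left)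
qed

end

section \<open>The length of the window\<close>

text \<open>The Joukowski map sends the punctured disc to the complement of [-2, 2]. A real value
  forces \<open>u\<close> to be real, and then the arithmetic-geometric mean inequality is
  strict.\<close>

lemma joukowski_interval:
  assumes "u \<noteq> 0" "cmod u < 1" "u + 1 / u = of_real w"
  shows "\<bar>w\<bar> > 2"
proof -
  have "1 / u = cnj u / of_real ((cmod u)\<^sup>2)"
    unfolding complex_norm_square using assms(1) by simp
  hence "Im (u + 1 / u) = Im u * (1 - 1 / (cmod u)\<^sup>2)" by (simp add: Im_divide_of_real algebra_simps)
  hence "Im u * (1 - 1 / (cmod u)\<^sup>2) = 0" using assms(3) by simp
  moreover have "(cmod u)\<^sup>2 < 1" "(cmod u)\<^sup>2 > 0" using assms(1,2) by (auto simp: power_less_one_iff)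
  hence "1 / (cmod u)\<^sup>2 > 1" by simp
  ultimately have "Im u = 0" by auto
  then obtain r where r: "u = of_real r" by (metis complex_is_Real_iff Reals_cases)
  have r0: "r \<noteq> 0" "\<bar>r\<bar> < 1" using assms(1,2) r by auto
  have "of_real (r + 1 / r) = (of_real w :: complex)" using assms(3) by (simp add: r)
  hence w: "w = r + 1 / r" using of_real_eq_iff by metis
  have "(\<bar>r\<bar> - 1)\<^sup>2 > 0" using r0 by simp
  hence "\<bar>r\<bar>\<^sup>2 + 1 > 2 * \<bar>r\<bar>" by (simp add: power2_diff)
  hence "r\<^sup>2 + 1 > 2 * \<bar>r\<bar>" by simp
  moreover have "\<bar>w\<bar> = (r\<^sup>2 + 1) / \<bar>r\<bar>"
  proof -
    have "w = (r\<^sup>2 + 1) / r" using r0 by (simp add: w power2_eq_square field_simps)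
    thus ?thesis by (simp add: abs_divide add_nonneg_nonneg)
  qed
  ultimately show ?thesis using r0 by (simp add: pos_less_divide_eq)
qed

text \<open>Landau's theorem, with the constant that Schottky's theorem gives.\<close>

lemma omitting_deriv_bound:
  assumes hol: "v holomorphic_on ball 0 1" and "v 0 = 1"
    and om: "\<And>u. cmod u < 1 \<Longrightarrow> v u \<noteq> 0 \<and> v u \<noteq> -1"
  shows "cmod (deriv v 0) \<le> 4 * exp (pi * exp (pi * 16))"
proof -
  define M where "M = exp (pi * exp (pi * 16))"
  have bnd: "cmod (v u) \<le> M" if u: "cmod u \<le> 1 / 4" for u
  proof -
    \<comment> \<open>The rescaling makes the function holomorphic on the closed disc. With |f 0|
      \<le> 1 and radius 1/2 the exponent in Schottky's theorem is 2 + 2 + 12 = 16; the Cauchy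
      estimate on radius 1/4 then gives the factor 4.\<close>
    define f where "f = (\<lambda>z. - v (z / 2))"
    have "(\<lambda>z. v (z / 2)) holomorphic_on cball 0 1"
      using holomorphic_on_compose_gen[OF _ hol, of "\<lambda>z. z / 2" "cball 0 1"]
      by (force simp: o_def norm_divide intro!: holomorphic_intros)
    hence "f holomorphic_on cball 0 1" unfolding f_def by (intro holomorphic_intros)
    moreover have "cmod (f 0) \<le> 1" by (simp add: f_def assms(2))
    moreover have "\<not> (f z = 0 \<or> f z = 1)" if "z \<in> cball 0 1" for z
    proof -
      have "cmod (z / 2) < 1" using that by (simp add: norm_divide)
      from om[OF this] show ?thesis by (auto simp: f_def minus_equation_iff[of _ 1])
    qed
    ultimately have "cmod (f (2 * u)) \<le> exp (pi * exp (pi * (2 + 2 * 1 + 12 * (1/2) / (1 - 1/2))))"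
      by (rule Schottky) (use u in \<open>auto simp: norm_mult\<close>)
    thus ?thesis by (simp add: f_def M_def)
  qed
  have "cmod ((deriv ^^ 1) v 0) \<le> fact 1 * M / (1/4) ^ 1"
    by (rule Cauchy_inequality)
       (use bnd holomorphic_on_imp_continuous_on[OF hol] in
         \<open>auto intro!: holomorphic_on_subset[OF hol] continuous_on_subset[of "ball 0 1"]\<close>)
  thus ?thesis by (simp add: M_def)
qed

context window
begin

text \<open>The window cannot shrink away: with \<open>f = fold_comp fs \<circ> \<psi>\<close>, where \<open>\<psi>\<close> maps the unit disc onto
  the complement of the current window, a square root of \<open>(f - b) / (f - a)\<close> omits \<open>0\<close> and \<open>-1\<close>,
  and its derivative at \<open>0\<close> is the ratio of the two window lengths.\<close>

lemma window_length:
  assumes adm: "adm fs"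
  shows "rlifts fs b - rlifts fs a \<ge> len / (2 * exp (pi * exp (pi * 16)))"
proof -
  define \<alpha> where "\<alpha> = rlifts fs a"
  define \<beta> where "\<beta> = rlifts fs b"
  define r where "r = (\<beta> - \<alpha>) / 4"
  have \<alpha>\<beta>: "\<alpha> < \<beta>" using window_ends[OF adm] by (simp add: \<alpha>_def \<beta>_def)
  have r: "r > 0" using \<alpha>\<beta> by (simp add: r_def)
  \<comment> \<open>The Joukowski map scaled so that the omitted segment is the current window;
    since \<open>u + 1 / u\<close> omits a segment of length 4, \<open>r\<close> is a quarter of the
    window length.\<close>
  define \<psi> :: "complex \<Rightarrow> complex" where "\<psi> = (\<lambda>u. of_real ((\<alpha> + \<beta>) / 2) + of_real r * (u + 1 / u))"
  define Q where "Q = fold_comp fs"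
  have off: "\<psi> u \<notin> vert {of_real a, of_real b} fs" if u: "u \<noteq> 0" "cmod u < 1" for u
  proof
    assume "\<psi> u \<in> vert {of_real a, of_real b} fs"
    then obtain x where x: "\<psi> u = of_real x" "\<alpha> \<le> x" "x \<le> \<beta>"
      using vert_ends_subset[OF adm] by (auto simp: \<alpha>_def \<beta>_def)
    have "of_real r * (u + 1 / u) = \<psi> u - of_real ((\<alpha> + \<beta>) / 2)" by (simp add: \<psi>_def)
    hence "of_real r * (u + 1 / u) = of_real (x - (\<alpha> + \<beta>) / 2)" unfolding x(1) by (simp only: of_real_diff)
    hence "u + 1 / u = of_real ((x - (\<alpha> + \<beta>) / 2) / r)" using r by (simp add: field_simps)
    from joukowski_interval[OF u this] have "\<bar>x - (\<alpha> + \<beta>) / 2\<bar> > 2 * r"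
      using r by (simp add: abs_divide pos_less_divide_eq)
    moreover have "\<bar>x - (\<alpha> + \<beta>) / 2\<bar> \<le> 2 * r" using x(2,3) unfolding abs_le_iff by (simp add: r_def field_simps)
    ultimately show False by simp
  qed
  have Qab: "\<psi> u \<notin> poles fs" "Q (\<psi> u) \<noteq> of_real a" "Q (\<psi> u) \<noteq> of_real b" if u: "u \<noteq> 0" "cmod u < 1" for u
    using off[OF u] by (auto simp: vert_def Q_def)
  \<comment> \<open>As \<open>\<psi>\<close> has a pole at 0 and \<open>Q\<close> is close to the
    identity near infinity, 0 is the limit value. In terms of \<open>k\<close> the quotient (Q - b)
    / (Q - a) is \<open>1 - of_real len * k u\<close>.\<close>
  define k where "k = (\<lambda>u. if u = 0 then 0 else 1 / (Q (\<psi> u) - of_real a))"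
  have lim\<psi>: "filterlim \<psi> at_infinity (at 0)"
  proof -
    have "filterlim (\<lambda>u::complex. 1 / u) at_infinity (at 0)"
      using filterlim_inverse_at_infinity[where 'a = complex]
      by (rule filterlim_cong[THEN iffD1, rotated 3]) (auto simp: inverse_eq_divide)
    hence "filterlim (\<lambda>u::complex. of_real r * (1 / u)) at_infinity (at 0)"
      using r by (intro tendsto_mult_filterlim_at_infinity[OF tendsto_const]) auto
    moreover have "((\<lambda>u::complex. of_real ((\<alpha> + \<beta>) / 2) + of_real r * u) \<longlongrightarrow> of_real ((\<alpha> + \<beta>) / 2) + of_real r * 0) (at 0)"
      by (intro tendsto_intros)
    ultimately have "filterlim (\<lambda>u::complex. (of_real ((\<alpha> + \<beta>) / 2) + of_real r * u) + of_real r * (1 / u)) at_infinity (at 0)"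
      by (intro tendsto_add_filterlim_at_infinity)
    thus ?thesis unfolding \<psi>_def by (simp only: distrib_left add.assoc)
  qed
  have near: "eventually (\<lambda>u. cmod (Q (\<psi> u) - \<psi> u) \<le> len) (at 0)"
  proof -
    have "eventually (\<lambda>u. cmod (\<psi> u) \<ge> 3 * len + \<bar>a\<bar>) (at 0)"
    proof -
      have "3 * len + \<bar>a\<bar> > 0" using ab by (intro add_pos_nonneg) auto
      thus ?thesis using lim\<psi> unfolding filterlim_at_infinity[OF order_refl, of \<psi>] by blast
    qed
    thus ?thesis
    proof eventually_elim
      case (elim u)
      have "cmod (\<psi> u) \<le> cmod (\<psi> u - of_real a) + \<bar>a\<bar>"
        using norm_triangle_ineq[of "\<psi> u - of_real a" "of_real a"] by simp
      thus ?case unfolding Q_def using elim by (intro near_identity'(2)[OF adm]) simp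
    qed
  qed
  have lim1: "((\<lambda>u. u * (Q (\<psi> u) - of_real a)) \<longlongrightarrow> of_real r) (at 0)"
  proof -
    have "((\<lambda>u. u * (Q (\<psi> u) - \<psi> u)) \<longlongrightarrow> 0) (at 0)"
    proof (rule Lim_null_comparison)
      show "eventually (\<lambda>u. cmod (u * (Q (\<psi> u) - \<psi> u)) \<le> cmod u * len) (at 0)"
        using near by eventually_elim (auto simp: norm_mult intro!: mult_left_mono)
      show "((\<lambda>u. cmod u * len) \<longlongrightarrow> 0) (at (0::complex))"
        by (rule tendsto_eq_intros refl | simp)+
    qed
    moreover have "((\<lambda>u::complex. u * of_real ((\<alpha> + \<beta>) / 2) + of_real r * (u * u + 1) - u * of_real a) \<longlongrightarrow> of_real r) (at 0)"
      by (rule tendsto_eq_intros refl | simp)+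
    ultimately have "((\<lambda>u. u * (Q (\<psi> u) - \<psi> u) + (u * of_real ((\<alpha> + \<beta>) / 2) + of_real r * (u * u + 1) - u * of_real a)) \<longlongrightarrow> 0 + of_real r) (at 0)"
      by (intro tendsto_add)
    moreover have "eventually (\<lambda>u. u * (Q (\<psi> u) - \<psi> u) + (u * of_real ((\<alpha> + \<beta>) / 2) + of_real r * (u * u + 1) - u * of_real a)
        = u * (Q (\<psi> u) - of_real a)) (at 0)"
    proof (rule eventually_mono[OF eventually_neq_at_within[of 0]])
      fix u :: complex assume "u \<noteq> 0"
      hence "u * \<psi> u = u * of_real ((\<alpha> + \<beta>) / 2) + of_real r * (u * u + 1)"
        by (simp add: \<psi>_def field_simps)
      thus "u * (Q (\<psi> u) - \<psi> u) + (u * of_real ((\<alpha> + \<beta>) / 2) + of_real r * (u * u + 1) - u * of_real a)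
        = u * (Q (\<psi> u) - of_real a)" by (simp add: algebra_simps)
    qed
    ultimately show ?thesis by (simp add: tendsto_cong)
  qed
  have limk: "((\<lambda>u. k u / u) \<longlongrightarrow> 1 / of_real r) (at 0)"
  proof -
    have "((\<lambda>u. 1 / (u * (Q (\<psi> u) - of_real a))) \<longlongrightarrow> 1 / of_real r) (at 0)"
      by (intro tendsto_divide tendsto_const lim1) (use r in auto)
    moreover have "eventually (\<lambda>u. 1 / (u * (Q (\<psi> u) - of_real a)) = k u / u) (at 0)"
      by (rule eventually_mono[OF eventually_neq_at_within[of 0]]) (auto simp: k_def field_simps)
    ultimately show ?thesis by (simp add: tendsto_cong)
  qed
  have kd: "(k has_field_derivative (1 / of_real r)) (at 0)"
    unfolding has_field_derivative_iff using limk by (simp add: k_def)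
  have khol: "k holomorphic_on ball 0 1"
  proof (rule no_isolated_singularity'[of "{0}"])
    have "k \<midarrow>0\<rightarrow> k 0" using DERIV_isCont[OF kd] by (simp add: isCont_def)
    thus "(k \<longlongrightarrow> k z) (at z within ball 0 1)" if "z \<in> {0}" for z
      using that tendsto_within_subset by blast
    have "\<psi> holomorphic_on ball 0 1 - {0}" unfolding \<psi>_def by (auto intro!: holomorphic_intros)
    hence "Q \<circ> \<psi> holomorphic_on ball 0 1 - {0}"
      unfolding Q_def by (rule holomorphic_on_compose_gen[OF _ fold_comp_holomorphic]) (use Qab in auto)
    hence "(\<lambda>u. Q (\<psi> u)) holomorphic_on ball 0 1 - {0}" unfolding o_def .
    hence "(\<lambda>u. 1 / (Q (\<psi> u) - of_real a)) holomorphic_on ball 0 1 - {0}"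
      by (rule holomorphic_on_divide[OF holomorphic_on_const holomorphic_on_diff[OF _ holomorphic_on_const]])
         (use Qab in auto)
    thus "k holomorphic_on ball 0 1 - {0}"
      by (rule holomorphic_transform) (auto simp: k_def)
  qed auto
  have g_nz: "1 - of_real len * k u \<noteq> 0" if "u \<in> ball 0 1" for u
  proof (cases "u = 0")
    case False
    hence nz: "Q (\<psi> u) - of_real a \<noteq> 0" "Q (\<psi> u) - of_real b \<noteq> 0" using Qab that by auto
    have "1 - of_real len * k u = (Q (\<psi> u) - of_real b) / (Q (\<psi> u) - of_real a)"
      using nz False by (simp add: k_def field_simps)
    thus ?thesis using nz by simp
  qed (simp add: k_def)
  have "(\<lambda>u. 1 - of_real len * k u) holomorphic_on ball 0 1" by (intro holomorphic_intros khol)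
  moreover have "simply_connected (ball (0::complex) 1)" by (simp add: convex_imp_simply_connected)
  ultimately obtain v0 where v0: "v0 holomorphic_on ball 0 1" "\<And>u. u \<in> ball 0 1 \<Longrightarrow> 1 - of_real len * k u = (v0 u)\<^sup>2"
    using simply_connected_eq_holomorphic_sqrt[of "ball (0::complex) 1"] g_nz by auto
  have v01: "(v0 0)\<^sup>2 = 1" using v0(2)[of 0] by (simp add: k_def)
  define v where "v = (\<lambda>u. v0 0 * v0 u)"
  have vh: "v holomorphic_on ball 0 1" unfolding v_def by (intro holomorphic_intros v0)
  have v1: "v 0 = 1" using v01 by (simp add: v_def power2_eq_square)
  have v2: "(v u)\<^sup>2 = 1 - of_real len * k u" if "u \<in> ball 0 1" for u
    using v01 v0(2)[OF that] by (simp add: v_def power_mult_distrib)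
  have om: "v u \<noteq> 0 \<and> v u \<noteq> -1" if "cmod u < 1" for u
  proof -
    have "v u \<noteq> 0" using v2[of u] g_nz[of u] that by auto
    \<comment> \<open>The value -1 makes the square 1, so \<open>k u = 0\<close>. This happens only
      at the origin, where \<open>v\<close> is 1.\<close>
    moreover have "v u \<noteq> -1"
    proof
      assume "v u = -1"
      hence "k u = 0" using v2[of u] that ab by simp
      hence "u = 0" using Qab[of u] that by (auto simp: k_def split: if_splits)
      thus False using v1 \<open>v u = -1\<close> by simp
    qed
    ultimately show ?thesis by blast
  qed
  have vd: "(v has_field_derivative deriv v 0) (at 0)"
    using holomorphic_derivI[OF vh, of 0] by simp
  have "((\<lambda>u. (v u)\<^sup>2) has_field_derivative 2 * deriv v 0) (at 0)"
    using DERIV_power[OF vd, of 2] v1 by (simp add: mult_ac)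
  moreover have "((\<lambda>u. (v u)\<^sup>2) has_field_derivative - (of_real len * (1 / of_real r))) (at 0)"
  proof (rule has_field_derivative_transform_within_open[of "\<lambda>u. 1 - of_real len * k u" _ 0 "ball 0 1"])
    show "((\<lambda>u. 1 - of_real len * k u) has_field_derivative - (of_real len * (1 / of_real r))) (at 0)"
      by (auto intro!: derivative_eq_intros kd)
  qed (use v2 in auto)
  ultimately have "2 * deriv v 0 = - (of_real len * (1 / of_real r))" by (rule DERIV_unique)
  hence "cmod (2 * deriv v 0) = cmod (- (of_real (len / r)))" by simp
  hence "2 * cmod (deriv v 0) = \<bar>len / r\<bar>"
    unfolding norm_minus_cancel norm_of_real norm_mult by simp
  hence "len / r / 2 \<le> 4 * exp (pi * exp (pi * 16))"
    using omitting_deriv_bound[OF vh v1 om] ab r by (simp add: abs_divide)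
  hence "len \<le> 8 * r * exp (pi * exp (pi * 16))" using r by (simp add: field_simps)
  thus ?thesis by (simp add: r_def \<alpha>_def \<beta>_def field_simps)
qed

end

section \<open>Logarithmic potentials of the fibers\<close>

lemma half_ineq: "L - m / 2 \<le> (r - q) / 2 - p / 2" if "2 * L - m \<le> r - q - p" for L m r q p :: real
proof -
  have "(2 * L - m) / 2 \<le> (r - q - p) / 2" using that by (rule divide_right_mono) simp
  thus ?thesis by (simp add: diff_divide_distrib)
qed

text \<open>For nonreal \<open>z\<close>, an antiderivative of ln |x - z| in the real variable
  x.\<close>

definition log_prim :: "complex \<Rightarrow> real \<Rightarrow> real" where
  "log_prim z x = (x - Re z) / 2 * ln ((x - Re z)\<^sup>2 + \<bar>Im z\<bar>\<^sup>2) - (x - Re z) + \<bar>Im z\<bar> * arctan ((x - Re z) / \<bar>Im z\<bar>)"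

lemma ln_cmod_real:
  "ln (cmod (of_real x - z)) = ln ((x - Re z)\<^sup>2 + \<bar>Im z\<bar>\<^sup>2) / 2" if "Im z \<noteq> 0"
proof -
  have "(x - Re z)\<^sup>2 + (Im z)\<^sup>2 > 0" using that by (simp add: add_nonneg_pos)
  thus ?thesis by (simp add: cmod_def ln_sqrt)
qed

lemma log_prim_deriv:
  assumes "Im z \<noteq> 0"
  shows "(log_prim z has_real_derivative ln (cmod (of_real x - z))) (at x)"
proof -
  define y where "y = \<bar>Im z\<bar>"
  have y: "y > 0" using assms by (simp add: y_def)
  have p: "(x - Re z)\<^sup>2 + y\<^sup>2 > 0" using y by (simp add: add_nonneg_pos)
  have alg: "(1 / 2) * ln P + w / 2 * (2 * w / P) - 1 + v / P = ln P / 2 + ((w\<^sup>2 + v) / P - 1)" for P w v :: real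
    by (simp add: add_divide_distrib power2_eq_square)
  have d1: "((\<lambda>x. (x - Re z) / 2) has_real_derivative 1 / 2) (at x)"
    by (auto intro!: derivative_eq_intros)
  have "((\<lambda>x. (x - Re z)\<^sup>2 + y\<^sup>2) has_real_derivative 2 * (x - Re z)) (at x)"
    by (auto intro!: derivative_eq_intros)
  from DERIV_chain2[OF DERIV_ln_divide[OF p] this]
  have d2: "((\<lambda>x. ln ((x - Re z)\<^sup>2 + y\<^sup>2)) has_real_derivative 2 * (x - Re z) / ((x - Re z)\<^sup>2 + y\<^sup>2)) (at x)"
    by simp
  have "((\<lambda>x. (x - Re z) / y) has_real_derivative 1 / y) (at x)"
    using y by (auto intro!: derivative_eq_intros)
  from DERIV_chain2[OF DERIV_arctan this]
  have d3: "((\<lambda>x. arctan ((x - Re z) / y)) has_real_derivative (1 / y) / (1 + ((x - Re z) / y)\<^sup>2)) (at x)"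
    by (simp add: divide_inverse mult.commute)
  have d4: "((\<lambda>x. x - Re z) has_real_derivative 1) (at x)"
    by (auto intro!: derivative_eq_intros)
  have "((\<lambda>x. (x - Re z) / 2 * ln ((x - Re z)\<^sup>2 + y\<^sup>2) - (x - Re z) + y * arctan ((x - Re z) / y))
      has_real_derivative ((1 / 2) * ln ((x - Re z)\<^sup>2 + y\<^sup>2) + (x - Re z) / 2 * (2 * (x - Re z) / ((x - Re z)\<^sup>2 + y\<^sup>2))
        - 1 + y * ((1 / y) / (1 + ((x - Re z) / y)\<^sup>2)))) (at x)"
    by (rule DERIV_cong[OF DERIV_add[OF DERIV_diff[OF DERIV_mult[OF d1 d2] d4] DERIV_cmult[OF d3]]])
       (simp add: mult.commute)
  also have "y * ((1 / y) / (1 + ((x - Re z) / y)\<^sup>2)) = y\<^sup>2 / ((x - Re z)\<^sup>2 + y\<^sup>2)"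
    using y p by (simp add: field_simps power2_eq_square)
  also have "(1 / 2) * ln ((x - Re z)\<^sup>2 + y\<^sup>2) + (x - Re z) / 2 * (2 * (x - Re z) / ((x - Re z)\<^sup>2 + y\<^sup>2))
        - 1 + y\<^sup>2 / ((x - Re z)\<^sup>2 + y\<^sup>2) = ln ((x - Re z)\<^sup>2 + y\<^sup>2) / 2
        + (((x - Re z)\<^sup>2 + y\<^sup>2) / ((x - Re z)\<^sup>2 + y\<^sup>2) - 1)"
    by (rule alg)
  also have "\<dots> = ln ((x - Re z)\<^sup>2 + y\<^sup>2) / 2"
    unfolding divide_self[OF less_imp_neq[OF p, symmetric]] by simp
  finally show ?thesis unfolding ln_cmod_real[OF assms] log_prim_def[abs_def] y_def .
qed

lemma log_has_integral:
  assumes "Im z \<noteq> 0" "R \<ge> 0"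
  shows "((\<lambda>x. ln (cmod (of_real x - z))) has_integral (log_prim z R - log_prim z (- R))) {- R..R}"
  by (rule fundamental_theorem_of_calculus)
     (use assms in \<open>auto simp: has_field_derivative_at_within[OF log_prim_deriv]
        has_real_derivative_iff_has_vector_derivative[symmetric]\<close>)

text \<open>The divergent part 2 R ln R - 2 R does not depend on \<open>z\<close>, so it cancels
  between two families with equally many points. The jump of the arctangent is what remains, and it
  measures \<open>\<bar>Im z\<bar>\<close>.\<close>

lemma log_prim_limit:
  assumes "Im z \<noteq> 0"
  shows "((\<lambda>R. log_prim z R - log_prim z (- R) - (2 * R * ln R - 2 * R)) \<longlongrightarrow> pi * \<bar>Im z\<bar>) at_top"
proof -
  have lim: "((\<lambda>R. (R - u) / 2 * ln ((R - u)\<^sup>2 + y\<^sup>2) - (R - u) + y * arctan ((R - u) / y)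
     - ((- R - u) / 2 * ln ((- R - u)\<^sup>2 + y\<^sup>2) - (- R - u) + y * arctan ((- R - u) / y))
     - (2 * R * ln R - 2 * R)) \<longlongrightarrow> pi * y) at_top" if "y > 0" for u y :: real
    using that by real_asymp
  show ?thesis unfolding log_prim_def by (rule lim) (use assms in simp)
qed

lemma log_sum_limit:
  assumes "finite A" "finite B" "card A = card B" "\<And>z. z \<in> A \<union> B \<Longrightarrow> Im z \<noteq> 0"
  shows "((\<lambda>R. integral {- R..R} (\<lambda>x. (\<Sum>z\<in>A. ln (cmod (of_real x - z))) - (\<Sum>z\<in>B. ln (cmod (of_real x - z)))))
    \<longlongrightarrow> pi * ((\<Sum>z\<in>A. \<bar>Im z\<bar>) - (\<Sum>z\<in>B. \<bar>Im z\<bar>))) at_top"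
proof -
  define g where "g = (\<lambda>R z. log_prim z R - log_prim z (- R) - (2 * R * ln R - 2 * R))"
  have "((\<lambda>R. (\<Sum>z\<in>A. g R z) - (\<Sum>z\<in>B. g R z)) \<longlongrightarrow> (\<Sum>z\<in>A. pi * \<bar>Im z\<bar>) - (\<Sum>z\<in>B. pi * \<bar>Im z\<bar>)) at_top"
    unfolding g_def by (intro tendsto_diff tendsto_sum log_prim_limit) (use assms(4) in auto)
  moreover have "eventually (\<lambda>R. (\<Sum>z\<in>A. g R z) - (\<Sum>z\<in>B. g R z) =
     integral {- R..R} (\<lambda>x. (\<Sum>z\<in>A. ln (cmod (of_real x - z))) - (\<Sum>z\<in>B. ln (cmod (of_real x - z))))) at_top"
    using eventually_ge_at_top[of 0]
  proof eventually_elim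
    case (elim R)
    have "((\<lambda>x. (\<Sum>z\<in>A. ln (cmod (of_real x - z))) - (\<Sum>z\<in>B. ln (cmod (of_real x - z)))) has_integral
        (\<Sum>z\<in>A. log_prim z R - log_prim z (- R)) - (\<Sum>z\<in>B. log_prim z R - log_prim z (- R))) {- R..R}"
      by (intro has_integral_diff has_integral_sum log_has_integral assms(1,2)) (use assms(4) elim in auto)
    moreover have "(\<Sum>z\<in>A. g R z) - (\<Sum>z\<in>B. g R z)
       = (\<Sum>z\<in>A. log_prim z R - log_prim z (- R)) - (\<Sum>z\<in>B. log_prim z R - log_prim z (- R))"
      by (simp add: g_def sum_subtractf assms(3))
    ultimately show ?case by (simp add: integral_unique)
  qed
  ultimately show ?thesis by (simp add: tendsto_cong sum_distrib_left[symmetric] right_diff_distrib)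
qed

lemma integral_le_limit:
  fixes h :: "real \<Rightarrow> real"
  assumes cont: "continuous_on UNIV h" and lim: "((\<lambda>R. integral {- R..R} h) \<longlongrightarrow> L) at_top"
    and nonneg: "\<And>x. x < \<alpha> \<or> x > \<beta> \<Longrightarrow> h x \<ge> 0" and "\<alpha> \<le> \<beta>"
  shows "integral {\<alpha>..\<beta>} h \<le> L"
proof (rule tendsto_lowerbound[OF lim])
  show "eventually (\<lambda>R. integral {\<alpha>..\<beta>} h \<le> integral {- R..R} h) at_top"
    using eventually_ge_at_top[of "\<bar>\<alpha>\<bar> + \<bar>\<beta>\<bar>"]
  proof eventually_elim
    case (elim R)
    have int: "h integrable_on {x..y}" for x y
      by (rule integrable_continuous_interval) (use cont continuous_on_subset in blast)
    have R: "- R \<le> \<alpha>" "\<beta> \<le> R" using elim by linarith+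
    have 1: "integral {- R..\<alpha>} h \<ge> 0"
    proof -
      have "integral {- R..\<alpha>} h = integral {- R<..<\<alpha>} h" by (simp add: integral_open_interval_real)
      also have "\<dots> \<ge> 0" by (rule integral_nonneg) (use int nonneg in \<open>auto simp: integrable_on_Icc_iff_Ioo\<close>)
      finally show ?thesis .
    qed
    have 2: "integral {\<beta>..R} h \<ge> 0"
    proof -
      have "integral {\<beta>..R} h = integral {\<beta><..<R} h" by (simp add: integral_open_interval_real)
      also have "\<dots> \<ge> 0" by (rule integral_nonneg) (use int nonneg in \<open>auto simp: integrable_on_Icc_iff_Ioo\<close>)
      finally show ?thesis .
    qed
    have "integral {- R..R} h = integral {- R..\<alpha>} h + integral {\<alpha>..R} h"
      using R assms(4) int by (intro Henstock_Kurzweil_Integration.integral_combine[symmetric]) auto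
    also have "integral {\<alpha>..R} h = integral {\<alpha>..\<beta>} h + integral {\<beta>..R} h"
      using R assms(4) int by (intro Henstock_Kurzweil_Integration.integral_combine[symmetric]) auto
    finally show ?case using 1 2 by simp
  qed
qed auto

text \<open>The tests below are continuous on the whole line, but their formula through
  \<open>fold_comp\<close> fails at the poles. Continuity carries the inequalities across these
  points.\<close>

lemma nonneg_off_finite:
  fixes h :: "real \<Rightarrow> real"
  assumes "continuous_on UNIV h" "finite F" "\<And>x. x \<notin> F \<Longrightarrow> h x \<ge> 0"
  shows "h x \<ge> 0"
proof -
  have "closure (- F) = UNIV" using assms(2) by (simp add: closure_complement empty_interior_finite)
  moreover have "h x \<ge> 0" if "x \<in> closure (- F)"
    by (rule continuous_ge_on_closure[OF continuous_on_subset[OF assms(1)] that]) (use assms(3) in auto)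
  ultimately show ?thesis by auto
qed

section \<open>Tests for closeness to a vertex and to infinity\<close>

context window
begin

definition lsum :: "(real \<times> real) list \<Rightarrow> complex \<Rightarrow> real \<Rightarrow> real" where
  "lsum fs z x = (\<Sum>y\<in>fiber fs z. ln (cmod (of_real x - y)))"

lemma lsum_cont: "Im z \<noteq> 0 \<Longrightarrow> continuous_on UNIV (lsum fs z)"
  unfolding lsum_def[abs_def]
proof (intro continuous_intros ballI)
  fix y x assume "Im z \<noteq> 0" "y \<in> fiber fs z"
  hence "Im (of_real x - y) \<noteq> 0" using fiber_nonreal by auto
  thus "cmod (of_real x - y) \<noteq> 0" by auto
qed

text \<open>By \<open>fiber_product\<close> the potential of a fiber is ln |Q - z| plus a term
  independent of \<open>z\<close>, with Q the composition. The difference thus depends on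
  \<open>x\<close> only through Q(x).\<close>

lemma lsum_diff:
  assumes "adm fs" "Im z \<noteq> 0" "Im w \<noteq> 0" "of_real x \<notin> poles fs"
  shows "lsum fs z x - lsum fs w x =
    ln (cmod (fold_comp fs (of_real x) - z)) - ln (cmod (fold_comp fs (of_real x) - w))"
proof -
  obtain D where "\<forall>x. x \<notin> poles fs \<longrightarrow> D x \<noteq> 0 \<and> (\<forall>z. z \<notin> S \<longrightarrow> (\<Prod>y\<in>fiber fs z. x - y) = (fold_comp fs x - z) * D x)"
    using fiber_product[OF assms(1)] by blast
  hence D: "D (of_real x) \<noteq> 0"
    "\<And>z. z \<notin> S \<Longrightarrow> (\<Prod>y\<in>fiber fs z. of_real x - y) = (fold_comp fs (of_real x) - z) * D (of_real x)"
    using assms(4) by blast+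
  have "lsum fs z x = ln (cmod (fold_comp fs (of_real x) - z)) + ln (cmod (D (of_real x)))" if z: "Im z \<noteq> 0" for z
  proof -
    have nz: "of_real x - y \<noteq> 0" if "y \<in> fiber fs z" for y
    proof -
      have "Im (of_real x - y) \<noteq> 0" using fiber_nonreal[OF z that] by simp
      thus ?thesis by (metis zero_complex.sel(2))
    qed
    have "Im (fold_comp fs (of_real x) - z) \<noteq> 0" by (subst fold_comp_Re) (use z in simp)
    hence Qz: "fold_comp fs (of_real x) - z \<noteq> 0" by (metis zero_complex.sel(2))
    have "lsum fs z x = ln (\<Prod>y\<in>fiber fs z. cmod (of_real x - y))"
      unfolding lsum_def using nz finite_fiber'[OF assms(1)] by (subst ln_prod) auto
    also have "(\<Prod>y\<in>fiber fs z. cmod (of_real x - y)) = cmod (fold_comp fs (of_real x) - z) * cmod (D (of_real x))"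
      unfolding prod_norm D(2)[OF nonreal_notin[OF z]] norm_mult ..
    also have "ln \<dots> = ln (cmod (fold_comp fs (of_real x) - z)) + ln (cmod (D (of_real x)))"
      using Qz D(1) by (intro ln_mult_pos) auto
    finally show ?thesis .
  qed
  thus ?thesis using assms(2,3) by simp
qed

lemma lsum_limit:
  assumes "adm fs" "Im z \<noteq> 0" "Im w \<noteq> 0"
  shows "((\<lambda>R. integral {- R..R} (\<lambda>x. lsum fs z x - lsum fs w x)) \<longlongrightarrow> pi * (mass fs z - mass fs w)) at_top"
  unfolding lsum_def mass_def
  by (rule log_sum_limit) (use assms finite_fiber' card_fiber nonreal_notin fiber_nonreal in auto)

text \<open>Off the poles this is the logarithm of the quotient of the distances from the image of
  \<open>x\<close> to s + i and to s + \<kappa> i.\<close>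

definition near_test :: "(real \<times> real) list \<Rightarrow> real \<Rightarrow> real \<Rightarrow> real \<Rightarrow> real" where
  "near_test fs \<kappa> s x = lsum fs (Complex s 1) x - lsum fs (Complex s \<kappa>) x"

text \<open>The second bracket alone is small exactly where the image of \<open>x\<close> is large.
  Subtracting it from the same expression for the identity yields a function that is large there and
  still has a controlled total integral.\<close>

definition far_test :: "(real \<times> real) list \<Rightarrow> real \<Rightarrow> real \<Rightarrow> real \<Rightarrow> real" where
  "far_test fs \<Lambda> c x = (lsum [] (Complex c \<Lambda>) x - lsum [] (Complex c 1) x) - (lsum fs (Complex c \<Lambda>) x - lsum fs (Complex c 1) x)"

lemma lsum_Nil: "y \<noteq> 0 \<Longrightarrow> lsum [] (Complex s y) x = ln ((x - s)\<^sup>2 + y\<^sup>2) / 2"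
  by (simp add: lsum_def ln_cmod_real)

lemma lsum_diff_real:
  assumes "adm fs" "of_real x \<notin> poles fs" "fold_comp fs (of_real x) = of_real t" "y \<noteq> 0" "y' \<noteq> 0"
  shows "lsum fs (Complex s y) x - lsum fs (Complex s y') x = (ln ((t - s)\<^sup>2 + y\<^sup>2) - ln ((t - s)\<^sup>2 + y'\<^sup>2)) / 2"
  using lsum_diff[OF assms(1), of "Complex s y" "Complex s y'" x] assms(2-5) by (simp add: ln_cmod_real diff_divide_distrib)

lemma near_test_nonneg:
  assumes "adm fs" "0 < \<kappa>" "\<kappa> \<le> 1"
  shows "near_test fs \<kappa> s x \<ge> 0"
proof (rule nonneg_off_finite[of "near_test fs \<kappa> s" "of_real -` poles fs"])
  show "continuous_on UNIV (near_test fs \<kappa> s)" unfolding near_test_def[abs_def]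
    by (intro continuous_on_diff lsum_cont) (use assms in auto)
  show "finite (of_real -` poles fs :: real set)"
    using finite_subset[OF poles_subset_vert finite_vert[OF assms(1)]] by (simp add: finite_vimageI inj_of_real)
  fix x :: real assume x: "x \<notin> of_real -` poles fs"
  have p: "(t - s)\<^sup>2 + \<kappa>\<^sup>2 > 0" for t using assms by (intro add_nonneg_pos) auto
  have "\<kappa>\<^sup>2 \<le> 1\<^sup>2" using assms by (intro power_mono) auto
  hence "ln ((t - s)\<^sup>2 + \<kappa>\<^sup>2) \<le> ln ((t - s)\<^sup>2 + 1\<^sup>2)" for t
    using p[of t] by (subst ln_le_cancel_iff) auto
  moreover define t where "t = Re (fold_comp fs (of_real x))"
  have "near_test fs \<kappa> s x = (ln ((t - s)\<^sup>2 + 1\<^sup>2) - ln ((t - s)\<^sup>2 + \<kappa>\<^sup>2)) / 2"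
    unfolding near_test_def t_def by (rule lsum_diff_real[OF assms(1) _ fold_comp_Re]) (use x assms in auto)
  ultimately show "near_test fs \<kappa> s x \<ge> 0" by (metis diff_ge_0_iff_ge divide_nonneg_nonneg zero_le_numeral)
qed

lemma near_test_large:
  assumes "adm fs" "0 < \<kappa>" "of_real x \<notin> poles fs" "cmod (fold_comp fs (of_real x) - of_real s) < \<kappa>" "\<kappa> = exp (- L) / 2"
  shows "near_test fs \<kappa> s x \<ge> L"
proof -
  define t where "t = Re (fold_comp fs (of_real x))"
  have t: "fold_comp fs (of_real x) = of_real t" unfolding t_def by (rule fold_comp_Re)
  have "\<bar>t - s\<bar> < \<kappa>" using assms(4) by (simp add: t flip: of_real_diff)
  hence "(t - s)\<^sup>2 \<le> \<kappa>\<^sup>2" using assms(2) by (metis abs_ge_zero less_imp_le power2_abs power_mono)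
  moreover have "4 * \<kappa>\<^sup>2 = exp (- (2 * L))" by (simp add: assms(5) power2_eq_square flip: exp_add)
  ultimately have "(t - s)\<^sup>2 + \<kappa>\<^sup>2 \<le> exp (- (2 * L))" using exp_ge_zero[of "- (2 * L)"] by linarith
  moreover have "(t - s)\<^sup>2 + \<kappa>\<^sup>2 > 0" using assms(2) by (simp add: add_nonneg_pos)
  ultimately have "ln ((t - s)\<^sup>2 + \<kappa>\<^sup>2) \<le> - (2 * L)" using ln_le_cancel_iff[of "(t - s)\<^sup>2 + \<kappa>\<^sup>2" "exp (- (2 * L))"] by simp
  moreover have "ln ((t - s)\<^sup>2 + 1\<^sup>2) \<ge> 0" by (intro ln_ge_zero) simp
  ultimately have "2 * L \<le> ln ((t - s)\<^sup>2 + 1\<^sup>2) - ln ((t - s)\<^sup>2 + \<kappa>\<^sup>2)" by linarith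
  hence "(2 * L) / 2 \<le> (ln ((t - s)\<^sup>2 + 1\<^sup>2) - ln ((t - s)\<^sup>2 + \<kappa>\<^sup>2)) / 2" by (rule divide_right_mono) simp
  thus ?thesis unfolding near_test_def
    using lsum_diff_real[OF assms(1,3) t, of 1 \<kappa> s] assms(2) by auto
qed

lemma near_test_integral:
  assumes "adm fs" "0 < \<kappa>" "\<kappa> \<le> 1" "\<alpha> \<le> \<beta>"
  shows "integral {\<alpha>..\<beta>} (near_test fs \<kappa> s) \<le> pi * mass fs (Complex s 1)"
proof -
  have "integral {\<alpha>..\<beta>} (near_test fs \<kappa> s) \<le> pi * (mass fs (Complex s 1) - mass fs (Complex s \<kappa>))"
  proof (rule integral_le_limit)
    show "continuous_on UNIV (near_test fs \<kappa> s)" unfolding near_test_def[abs_def]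
      by (intro continuous_on_diff lsum_cont) (use assms in auto)
    show "((\<lambda>R. integral {- R..R} (near_test fs \<kappa> s)) \<longlongrightarrow> pi * (mass fs (Complex s 1) - mass fs (Complex s \<kappa>))) at_top"
      unfolding near_test_def[abs_def] by (rule lsum_limit) (use assms in auto)
  qed (use assms near_test_nonneg in auto)
  also have "\<dots> \<le> pi * mass fs (Complex s 1)" using mass_nonneg by (intro mult_left_mono) auto
  finally show ?thesis .
qed

lemma far_ratio_mono:
  fixes x t \<Lambda> :: real
  assumes "\<Lambda> \<ge> 1" "\<bar>x\<bar> \<le> \<bar>t\<bar>"
  shows "ln (t\<^sup>2 + \<Lambda>\<^sup>2) - ln (t\<^sup>2 + 1\<^sup>2) \<le> ln (x\<^sup>2 + \<Lambda>\<^sup>2) - ln (x\<^sup>2 + 1\<^sup>2)"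
proof -
  have xt: "x\<^sup>2 \<le> t\<^sup>2" using assms(2) by (rule abs_le_square_iff[THEN iffD1])
  have L: "\<Lambda>\<^sup>2 \<ge> 1" using assms(1) by simp
  have pos: "u\<^sup>2 + \<Lambda>\<^sup>2 > 0" "u\<^sup>2 + 1 > 0" for u :: real
    using L zero_le_power2[of u] by linarith+
  have "(t\<^sup>2 + \<Lambda>\<^sup>2) * (x\<^sup>2 + 1) \<le> (x\<^sup>2 + \<Lambda>\<^sup>2) * (t\<^sup>2 + 1)"
  proof -
    have "0 \<le> (t\<^sup>2 - x\<^sup>2) * (\<Lambda>\<^sup>2 - 1)" using xt L by simp
    thus ?thesis by (simp add: algebra_simps)
  qed
  hence "ln ((t\<^sup>2 + \<Lambda>\<^sup>2) * (x\<^sup>2 + 1)) \<le> ln ((x\<^sup>2 + \<Lambda>\<^sup>2) * (t\<^sup>2 + 1))"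
    using pos by (subst ln_le_cancel_iff) auto
  thus ?thesis using pos[of t] pos[of x] by (simp add: ln_mult_pos)
qed

text \<open>With \<open>c\<close> the left end of the window, folding moves outside points away from
  \<open>c\<close> on both sides. The bracket is a decreasing function of the distance to
  \<open>c\<close>, so it is smaller for the composition than for the identity.\<close>

lemma far_test_outside:
  assumes "adm fs" "\<Lambda> \<ge> 1" "x < rlifts fs a \<or> x > rlifts fs b" "c = rlifts fs a"
  shows "far_test fs \<Lambda> c x \<ge> 0"
proof -
  have ce: "c < rlifts fs b" using window_ends[OF assms(1)] assms(4) by simp
  have np: "of_real x \<notin> poles fs"
    using vert_ends_window[OF assms(1), of x] assms(3) poles_subset_vert[of fs "{of_real a, of_real b}"] by auto
  obtain t where t: "fold_comp fs (of_real x) = of_real t" "\<bar>x - c\<bar> \<le> \<bar>t - c\<bar>"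
    using assms(3)
  proof
    assume "x < rlifts fs a"
    thus ?thesis using real_outside_left[OF assms(1), of x] assms(4) by (auto intro: that)
  next
    assume "x > rlifts fs b"
    thus ?thesis using real_outside_right[OF assms(1), of x] ce by (auto intro: that)
  qed
  show ?thesis unfolding far_test_def
    using lsum_diff_real[OF assms(1) np t(1), of \<Lambda> 1 c] far_ratio_mono[OF assms(2) t(2)] assms(2)
    by (simp add: lsum_Nil diff_divide_distrib[symmetric])
qed

text \<open>In the window the bracket for the identity is at least
  \<open>ln \<Lambda> - ln (len\<^sup>2 + 1) / 2\<close>. The one for the composition never exceeds
  \<open>ln \<Lambda>\<close>, and is at most half of ln 2 once the image has distance at least
  \<Lambda> from \<open>c\<close>.\<close>

lemma far_test_inside:
  assumes "adm fs" "\<Lambda> \<ge> 1" "rlifts fs a \<le> x" "x \<le> rlifts fs b" "c = rlifts fs a" "of_real x \<notin> poles fs"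
  shows "far_test fs \<Lambda> c x \<ge> - (ln (len\<^sup>2 + 1) / 2)"
    "cmod (fold_comp fs (of_real x) - of_real c) \<ge> \<Lambda> \<Longrightarrow> \<Lambda> = 2 * exp L \<Longrightarrow> far_test fs \<Lambda> c x \<ge> L - (ln (len\<^sup>2 + 1) / 2)"
proof -
  define t where "t = Re (fold_comp fs (of_real x))"
  have t: "fold_comp fs (of_real x) = of_real t" unfolding t_def by (rule fold_comp_Re)
  have eq: "far_test fs \<Lambda> c x = (ln ((x - c)\<^sup>2 + \<Lambda>\<^sup>2) - ln ((x - c)\<^sup>2 + 1\<^sup>2)) / 2 - (ln ((t - c)\<^sup>2 + \<Lambda>\<^sup>2) - ln ((t - c)\<^sup>2 + 1\<^sup>2)) / 2"
    unfolding far_test_def using lsum_diff_real[OF assms(1,6) t, of \<Lambda> 1 c] assms(2)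
    by (simp add: lsum_Nil diff_divide_distrib)
  have L: "\<Lambda>\<^sup>2 \<ge> 1" "\<Lambda> > 0" using assms(2) by auto
  have pos: "u\<^sup>2 + \<Lambda>\<^sup>2 > 0" "u\<^sup>2 + 1 > 0" for u :: real
    using L zero_le_power2[of u] by linarith+
  have "x - c \<le> len" "0 \<le> x - c" using window_ends[OF assms(1)] assms(3,4,5) by auto
  hence "(x - c)\<^sup>2 \<le> len\<^sup>2" by (intro power_mono) auto
  hence 1: "ln ((x - c)\<^sup>2 + 1\<^sup>2) \<le> ln (len\<^sup>2 + 1)" using pos by (subst ln_le_cancel_iff) auto
  have 2: "ln ((x - c)\<^sup>2 + \<Lambda>\<^sup>2) \<ge> 2 * ln \<Lambda>"
  proof -
    have "ln (\<Lambda>\<^sup>2) \<le> ln ((x - c)\<^sup>2 + \<Lambda>\<^sup>2)" using L pos by (subst ln_le_cancel_iff) auto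
    thus ?thesis using L by (simp add: ln_realpow)
  qed
  have "ln ((t - c)\<^sup>2 + \<Lambda>\<^sup>2) - ln ((t - c)\<^sup>2 + 1\<^sup>2) \<le> 2 * ln \<Lambda>"
    using far_ratio_mono[OF assms(2), of 0 "t - c"] L by (simp add: ln_realpow)
  hence "2 * 0 - ln (len\<^sup>2 + 1) \<le> ln ((x - c)\<^sup>2 + \<Lambda>\<^sup>2) - ln ((x - c)\<^sup>2 + 1\<^sup>2) - (ln ((t - c)\<^sup>2 + \<Lambda>\<^sup>2) - ln ((t - c)\<^sup>2 + 1\<^sup>2))"
    using 1 2 by linarith
  from half_ineq[OF this] show "far_test fs \<Lambda> c x \<ge> - (ln (len\<^sup>2 + 1) / 2)" unfolding eq by simp
  assume big: "cmod (fold_comp fs (of_real x) - of_real c) \<ge> \<Lambda>" and Lam: "\<Lambda> = 2 * exp L"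
  have "\<bar>t - c\<bar> \<ge> \<Lambda>" using big by (simp add: t flip: of_real_diff)
  hence "\<bar>t - c\<bar>\<^sup>2 \<ge> \<Lambda>\<^sup>2" using L by (intro power_mono) auto
  hence "(t - c)\<^sup>2 \<ge> \<Lambda>\<^sup>2" by simp
  hence "(t - c)\<^sup>2 + \<Lambda>\<^sup>2 \<le> 2 * ((t - c)\<^sup>2 + 1\<^sup>2)" by simp
  moreover have "2 * ((t - c)\<^sup>2 + 1\<^sup>2) > 0" using pos(2)[of "t - c"] by simp
  ultimately have "ln ((t - c)\<^sup>2 + \<Lambda>\<^sup>2) \<le> ln (2 * ((t - c)\<^sup>2 + 1\<^sup>2))"
    using pos(1)[of "t - c"] by (subst ln_le_cancel_iff)
  also have "\<dots> = ln 2 + ln ((t - c)\<^sup>2 + 1\<^sup>2)" using pos[of "t - c"] by (subst ln_mult_pos) auto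
  finally have "ln ((t - c)\<^sup>2 + \<Lambda>\<^sup>2) - ln ((t - c)\<^sup>2 + 1\<^sup>2) \<le> ln 2" by simp
  moreover have "ln \<Lambda> = ln 2 + L" by (simp add: Lam ln_mult_pos)
  moreover have "ln (2::real) \<ge> 0" by simp
  ultimately have "2 * L - ln (len\<^sup>2 + 1) \<le> ln ((x - c)\<^sup>2 + \<Lambda>\<^sup>2) - ln ((x - c)\<^sup>2 + 1\<^sup>2) - (ln ((t - c)\<^sup>2 + \<Lambda>\<^sup>2) - ln ((t - c)\<^sup>2 + 1\<^sup>2))"
    using 1 2 by linarith
  from half_ineq[OF this] show "far_test fs \<Lambda> c x \<ge> L - (ln (len\<^sup>2 + 1) / 2)" unfolding eq .
qed

lemma far_test_cont: "\<Lambda> \<ge> 1 \<Longrightarrow> continuous_on UNIV (far_test fs \<Lambda> c)"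
  unfolding far_test_def[abs_def] by (intro continuous_on_diff lsum_cont) auto

text \<open>The identity contributes \<pi> (\<Lambda> - 1) to the total integral. Since the mass
  over c + \<Lambda> i is at least \<Lambda>, this is absorbed and the bound does not depend on
  \<Lambda>.\<close>

lemma far_test_integral:
  assumes "adm fs" "\<Lambda> \<ge> 1" "c = rlifts fs a"
  shows "integral {rlifts fs a..rlifts fs b} (far_test fs \<Lambda> c) \<le> pi * mass fs (Complex c 1)"
proof -
  have "integral {rlifts fs a..rlifts fs b} (far_test fs \<Lambda> c)
      \<le> pi * (mass [] (Complex c \<Lambda>) - mass [] (Complex c 1)) - pi * (mass fs (Complex c \<Lambda>) - mass fs (Complex c 1))"
  proof (rule integral_le_limit)
    define g where "g = (\<lambda>fs x. lsum fs (Complex c \<Lambda>) x - lsum fs (Complex c 1) x)"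
    have gi: "g fs integrable_on {x..y}" for fs x y
    proof (rule integrable_continuous_interval)
      have "continuous_on UNIV (g fs)"
        unfolding g_def by (intro continuous_on_diff lsum_cont) (use assms in auto)
      thus "continuous_on {x..y} (g fs)" by (rule continuous_on_subset) simp
    qed
    have gl: "((\<lambda>R. integral {- R..R} (g fs)) \<longlongrightarrow> pi * (mass fs (Complex c \<Lambda>) - mass fs (Complex c 1))) at_top" if "adm fs" for fs
      unfolding g_def by (rule lsum_limit[OF that]) (use assms in auto)
    have "far_test fs \<Lambda> c = (\<lambda>x. g [] x - g fs x)" by (simp add: far_test_def g_def fun_eq_iff)
    moreover have "integral {- R..R} (\<lambda>x. g [] x - g fs x) = integral {- R..R} (g []) - integral {- R..R} (g fs)" for R
      by (intro Henstock_Kurzweil_Integration.integral_diff gi)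
    ultimately show "((\<lambda>R. integral {- R..R} (far_test fs \<Lambda> c)) \<longlongrightarrow>
        pi * (mass [] (Complex c \<Lambda>) - mass [] (Complex c 1)) - pi * (mass fs (Complex c \<Lambda>) - mass fs (Complex c 1))) at_top"
      using tendsto_diff[OF gl[of "[]"] gl[OF assms(1)]] by simp
    show "continuous_on UNIV (far_test fs \<Lambda> c)" using far_test_cont assms by blast
    show "far_test fs \<Lambda> c x \<ge> 0" if "x < rlifts fs a \<or> x > rlifts fs b" for x
      using far_test_outside[OF assms(1,2) that assms(3)] .
    show "rlifts fs a \<le> rlifts fs b" using window_ends[OF assms(1)] by simp
  qed
  also have "mass [] (Complex c \<Lambda>) = \<Lambda>" using assms(2) by (simp add: mass_def)
  also have "mass [] (Complex c 1) = 1" by (simp add: mass_def)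
  also have "pi * (\<Lambda> - 1) - pi * (mass fs (Complex c \<Lambda>) - mass fs (Complex c 1)) \<le> pi * mass fs (Complex c 1)"
  proof -
    have "pi * \<Lambda> \<le> pi * mass fs (Complex c \<Lambda>)"
      using mass_ge[OF assms(1), of "Complex c \<Lambda>"] assms(2) by (intro mult_left_mono) auto
    moreover have "pi * (\<Lambda> - 1) - pi * (mass fs (Complex c \<Lambda>) - mass fs (Complex c 1))
      = pi * \<Lambda> - pi - pi * mass fs (Complex c \<Lambda>) + pi * mass fs (Complex c 1)"
      by (simp add: algebra_simps)
    ultimately show ?thesis using pi_gt_zero by linarith
  qed
  finally show ?thesis .
qed

end

section \<open>Growth of the mass\<close>

context window
begin

definition real_vert :: "(real \<times> real) list \<Rightarrow> real set" where
  "real_vert fs = {x. of_real x \<in> vert S fs}"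

lemma finite_real_vert: "adm fs \<Longrightarrow> finite (real_vert fs)"
proof -
  assume "adm fs"
  have "real_vert fs = of_real -` vert S fs" by (auto simp: real_vert_def)
  thus ?thesis using finite_vert[OF \<open>adm fs\<close>] by (simp add: finite_vimageI inj_of_real)
qed

definition apart :: "(real \<times> real) list \<Rightarrow> real \<times> real \<Rightarrow> real \<times> real \<Rightarrow> bool" where
  "apart fs p q \<longleftrightarrow> (\<exists>w\<in>real_vert fs. snd p < w \<and> w < fst q)"

definition good_pair :: "real \<Rightarrow> (real \<times> real) list \<Rightarrow> real \<times> real \<Rightarrow> bool" where
  "good_pair \<eta> fs p \<longleftrightarrow> fst p \<le> snd p \<and> {fst p..snd p} \<inter> real_vert fs = {} \<and>
     rlifts fs a \<le> fst p \<and> snd p \<le> rlifts fs b \<and> mid \<eta> fs (fst p) \<and> mid \<eta> fs (snd p)"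

text \<open>Folding the sides one after the other: a fold only lengthens the other sides, so the
  gains add up.\<close>

lemma fold_all_sides:
  assumes \<eta>: "0 < \<eta>" "\<eta> < 1" and K: "K = 4 / \<eta> * ((1 / \<eta> + 2)\<^sup>2 + 2)"
  shows "adm fs \<Longrightarrow> (\<forall>p\<in>set ps. good_pair \<eta> fs p) \<Longrightarrow> sorted_wrt (apart fs) ps \<Longrightarrow>
    \<exists>gs. adm gs \<and> mass gs \<i> \<ge> mass fs \<i> + (\<Sum>p\<leftarrow>ps. snd p - fst p) / (K * (7 + 4 * K)\<^sup>2)"
proof (induction "length ps" arbitrary: ps fs)
  case 0
  thus ?case by auto
next
  case (Suc n qs fs)
  then obtain p ps where qs: "qs = p # ps" by (cases qs) auto
  note prems = Suc.prems[unfolded qs]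
  obtain u v where p: "p = (u, v)" by force
  have gp: "u \<le> v" "\<And>x. x \<in> {u..v} \<Longrightarrow> of_real x \<notin> vert S fs" "rlifts fs a \<le> u" "v \<le> rlifts fs b"
    "mid \<eta> fs u" "mid \<eta> fs v"
    using prems(2) p by (auto simp: good_pair_def real_vert_def)
  obtain f where f: "adm (f # fs)" "u \<in> gate f" "v \<in> gate f"
    "mass (f # fs) \<i> \<ge> mass fs \<i> + (v - u) / (K * (7 + 4 * K)\<^sup>2)"
    using side_gain[OF \<eta> K prems(1) gp] by blast
  have d: "snd f > 0" and adm: "adm fs" using f(1) by auto
  have K0: "K * (7 + 4 * K)\<^sup>2 > 0"
  proof -
    have "(1 / \<eta> + 2)\<^sup>2 + 2 > 0" by (rule add_nonneg_pos) auto
    hence "K > 0" using \<eta> by (simp add: K)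
    thus ?thesis by (intro mult_pos_pos zero_less_power) auto
  qed
  have right: "w \<ge> fst f + 2 * snd f" if "w \<in> real_vert fs" "v < w" for w
  proof -
    have "w \<notin> gate f" using adm_gate[OF f(1)] that(1) by (simp add: real_vert_def)
    moreover have "w > fst f - 2 * snd f" using that(2) f(3) by (simp add: gate_def)
    ultimately show ?thesis using d by (auto simp: gate_def)
  qed
  \<comment> \<open>The head \<open>p\<close> is the leftmost pair, so all other pairs lie beyond a
    vertex to the right of \<open>v\<close>, that is, to the right of the gate. There the lift is
    increasing and expanding.\<close>
  have pr: "fst q \<ge> fst f + 2 * snd f" if q: "q \<in> set ps" for q
  proof -
    have "apart fs p q" using prems(3) q by simp
    then obtain w where "w \<in> real_vert fs" "v < w" "w < fst q" by (auto simp: apart_def p)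
    thus ?thesis using right[of w] by simp
  qed
  define \<tau> where "\<tau> = (\<lambda>q. (rlift f (fst q), rlift f (snd q)))"
  have ngR: "x \<notin> gate f" if "x \<ge> fst f + 2 * snd f" for x using that by (simp add: gate_def)
  have lift_vert: "rlift f w \<in> real_vert (f # fs)" if w: "w \<in> real_vert fs" "w \<ge> fst f + 2 * snd f" for w
  proof -
    have "rlift f w \<noteq> fst f" using rlift_ne[OF d ngR[OF w(2)]] .
    moreover have "rfold f (rlift f w) = w" using rfold_rlift[OF d ngR[OF w(2)]] .
    ultimately show ?thesis using w(1) by (auto simp: real_vert_def vert_Cons)
  qed
  have good: "good_pair \<eta> (f # fs) (\<tau> q)" if q: "q \<in> set ps" for q
  proof -
    obtain x y where q': "q = (x, y)" by force
    have gq: "x \<le> y" "{x..y} \<inter> real_vert fs = {}" "rlifts fs a \<le> x" "y \<le> rlifts fs b"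
      "mid \<eta> fs x" "mid \<eta> fs y"
    proof -
      have "good_pair \<eta> fs (x, y)" using prems(2) q q' by simp
      thus "x \<le> y" "{x..y} \<inter> real_vert fs = {}" "rlifts fs a \<le> x" "y \<le> rlifts fs b"
        "mid \<eta> fs x" "mid \<eta> fs y" unfolding good_pair_def by simp_all
    qed
    have x: "x \<ge> fst f + 2 * snd f" using pr[OF q] q' by simp
    hence y: "y \<ge> fst f + 2 * snd f" using gq(1) by simp
    have ends: "rlifts fs a \<notin> gate f" "rlifts fs b \<notin> gate f" using f(1) by (auto simp: gate_def)
    have "of_real t \<notin> vert S (f # fs)" if t: "rlift f x \<le> t" "t \<le> rlift f y" for t
    proof -
      have tm: "t \<ge> fst f + snd f" "t \<noteq> fst f" using rlift_ge(1)[OF d x] t(1) d by auto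
      have "x \<le> rfold f t"
      proof (cases "rlift f x = t")
        case True thus ?thesis using rlift_ge(2)[OF d x] by simp
      next
        case False
        hence "rfold f (rlift f x) < rfold f t" using t(1) rlift_ge(1)[OF d x] by (intro rfold_strict_mono d) auto
        thus ?thesis using rlift_ge(2)[OF d x] by simp
      qed
      moreover have "rfold f t \<le> y"
      proof (cases "rlift f y = t")
        case True thus ?thesis using rlift_ge(2)[OF d y] by simp
      next
        case False
        hence "rfold f t < rfold f (rlift f y)" using t(2) tm by (intro rfold_strict_mono d) auto
        thus ?thesis using rlift_ge(2)[OF d y] by simp
      qed
      ultimately have "rfold f t \<notin> real_vert fs" using gq(2) by auto
      thus ?thesis using tm(2) by (simp add: vert_Cons real_vert_def)
    qed
    moreover have "rlift f x \<le> rlift f y" using rlift_mono[OF d ngR[OF x] ngR[OF y] gq(1)] .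
    moreover have "rlift f (rlifts fs a) \<le> rlift f x" using rlift_mono[OF d ends(1) ngR[OF x] gq(3)] .
    moreover have "rlift f y \<le> rlift f (rlifts fs b)" using rlift_mono[OF d ngR[OF y] ends(2) gq(4)] .
    moreover have "mid \<eta> (f # fs) (rlift f x)" "mid \<eta> (f # fs) (rlift f y)"
      using gq(5,6) rlift_ge(2)[OF d x] rlift_ge(2)[OF d y] by (simp_all add: mid_def)
    ultimately show ?thesis by (auto simp: good_pair_def \<tau>_def q' real_vert_def)
  qed
  have ap: "apart (f # fs) (\<tau> q) (\<tau> q')" if qq: "q \<in> set ps" "q' \<in> set ps" "apart fs q q'" for q q'
  proof -
    obtain w where w: "w \<in> real_vert fs" "snd q < w" "w < fst q'" using qq(3) by (auto simp: apart_def)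
    have q1: "snd q \<ge> fst f + 2 * snd f"
      using pr[OF qq(1)] prems(2) qq(1) by (force simp: good_pair_def)
    hence wr: "w \<ge> fst f + 2 * snd f" using w by simp
    have "rlift f (snd q) < rlift f w" "rlift f w < rlift f (fst q')"
      using rlift_strict_mono[OF d ngR ngR] q1 wr w pr[OF qq(2)] by auto
    thus ?thesis using lift_vert[OF w(1) wr] by (auto simp: apart_def \<tau>_def)
  qed
  have "sorted_wrt (apart fs) ps" using prems(3) by simp
  hence "sorted_wrt (\<lambda>q q'. apart (f # fs) (\<tau> q) (\<tau> q')) ps"
    by (rule sorted_wrt_mono_rel[rotated]) (rule ap)
  hence srt: "sorted_wrt (apart (f # fs)) (map \<tau> ps)" unfolding sorted_wrt_map .
  have "\<forall>p\<in>set (map \<tau> ps). good_pair \<eta> (f # fs) p"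
  proof
    fix p' assume "p' \<in> set (map \<tau> ps)"
    then obtain q where "q \<in> set ps" "p' = \<tau> q" unfolding set_map by (rule imageE)
    thus "good_pair \<eta> (f # fs) p'" using good by simp
  qed
  moreover have "n = length (map \<tau> ps)" using Suc.hyps(2) qs by simp
  ultimately obtain gs where gs: "adm gs"
    "mass gs \<i> \<ge> mass (f # fs) \<i> + (\<Sum>p\<leftarrow>map \<tau> ps. snd p - fst p) / (K * (7 + 4 * K)\<^sup>2)"
    using Suc.hyps(1)[OF _ f(1) _ srt] by blast
  have "(\<Sum>p\<leftarrow>ps. snd p - fst p) \<le> (\<Sum>p\<leftarrow>map \<tau> ps. snd p - fst p)"
    unfolding map_map o_def
  proof (rule sum_list_mono)
    fix q assume q: "q \<in> set ps"
    have "snd q - fst q \<le> rlift f (snd q) - rlift f (fst q)"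
      using pr[OF q] prems(2) q by (intro rlift_expand d) (auto simp: good_pair_def)
    thus "snd q - fst q \<le> snd (\<tau> q) - fst (\<tau> q)" by (simp add: \<tau>_def)
  qed
  hence "(\<Sum>p\<leftarrow>ps. snd p - fst p) / (K * (7 + 4 * K)\<^sup>2) \<le> (\<Sum>p\<leftarrow>map \<tau> ps. snd p - fst p) / (K * (7 + 4 * K)\<^sup>2)"
    using K0 by (intro divide_right_mono) auto
  hence "mass gs \<i> \<ge> mass fs \<i> + (v - u) / (K * (7 + 4 * K)\<^sup>2) + (\<Sum>p\<leftarrow>ps. snd p - fst p) / (K * (7 + 4 * K)\<^sup>2)"
    using gs(2) f(4) by linarith
  thus ?case using gs(1) by (intro exI[of _ gs]) (simp add: qs p add_divide_distrib)
qed

definition side :: "(real \<times> real) list \<Rightarrow> real \<Rightarrow> real set" where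
  "side fs p = {x. p < x \<and> x \<le> rlifts fs b \<and> (\<forall>w\<in>real_vert fs. \<not> (p < w \<and> w \<le> x))}"

lemma mass_bound_shift:
  assumes "adm fs" "\<bar>c\<bar> \<le> r0" "mass fs \<i> \<le> M"
  shows "mass fs (Complex c 1) \<le> (5 + r0\<^sup>2) * M"
proof -
  have "(cmod (Complex c 1 - cnj \<i>))\<^sup>2 = c\<^sup>2 + 4" by (simp add: cmod_power2)
  hence "mass fs (Complex c 1) \<le> (5 + c\<^sup>2) * mass fs \<i>"
    using mass_harnack[OF assms(1), of "Complex c 1" \<i>] by (simp add: add.commute)
  also have "c\<^sup>2 \<le> r0\<^sup>2" using assms(2) by (metis abs_ge_zero power2_abs power_mono)
  hence "(5 + c\<^sup>2) * mass fs \<i> \<le> (5 + r0\<^sup>2) * M" using assms(3) mass_nonneg by (intro mult_mono) auto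
  finally show ?thesis .
qed

text \<open>By Chebyshev's inequality for the sum of all tests, the points of the window that are
  not \<open>mid\<close> cover at most half of the length guaranteed by
  \<open>window_length\<close>. The rest is covered by the hulls of the \<open>mid\<close> points on
  the sides, and two points per side span at least half of its hull. The number \<eta> depends only
  on \<open>M\<close> and the window data, not on the folds.\<close>

lemma mid_sides:
  assumes "M \<ge> 0"
  shows "\<exists>\<eta>. 0 < \<eta> \<and> \<eta> < 1 \<and> (\<forall>fs. adm fs \<and> mass fs \<i> \<le> M \<longrightarrow>
    (\<exists>ps. (\<forall>p\<in>set ps. good_pair \<eta> fs p) \<and> sorted_wrt (apart fs) ps \<and>
       (\<Sum>p\<leftarrow>ps. snd p - fst p) \<ge> len / (8 * exp (pi * exp (pi * 16)))))"
proof -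
  define E where "E = exp (pi * exp (pi * 16))"
  have E: "E > 0" by (simp add: E_def)
  define r0 where "r0 = \<bar>a\<bar> + \<bar>b\<bar> + (\<Sum>s\<in>S. cmod s)"
  have r0S: "cmod s \<le> r0" if "s \<in> S" for s
  proof -
    have "cmod s \<le> (\<Sum>s\<in>S. cmod s)" using fin that by (intro member_le_sum) auto
    thus ?thesis by (simp add: r0_def)
  qed
  have r00: "r0 \<ge> 0" by (simp add: r0_def sum_nonneg)
  define C0 where "C0 = ln (len\<^sup>2 + 1) / 2"
  have C0: "C0 \<ge> 0" by (simp add: C0_def)
  define B where "B = (real (card S) + 1) * (pi * ((5 + r0\<^sup>2) * M)) + C0 * len"
  have B: "B \<ge> 0" using assms C0 ab unfolding B_def by (intro add_nonneg_nonneg mult_nonneg_nonneg) auto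
  \<comment> \<open>\<open>B\<close> will bound the integral of the tests. This level makes
    \<open>B / L\<close> at most \<open>len / (4 * E)\<close>, half of the guaranteed window
    length.\<close>
  define L where "L = 4 * B * E / len + 1"
  have L: "L > 0" using B E ab by (simp add: L_def add_nonneg_pos)
  have BL: "B / L \<le> len / (4 * E)"
  proof -
    have "4 * B * E / len \<le> L" by (simp add: L_def)
    hence "B * (4 * E) \<le> len * L" using ab by (simp add: field_simps)
    thus ?thesis using L E by (simp add: field_simps)
  qed
  define \<kappa> where "\<kappa> = exp (- L) / 2"
  define \<Lambda> where "\<Lambda> = 2 * exp L"
  have eL: "exp (- L) < 1" "exp L \<ge> 1" using L by simp_all
  have \<kappa>: "0 < \<kappa>" "\<kappa> < 1" proof -
    have "exp (- L) / 2 < 1 / 2" using eL(1) by (rule divide_strict_right_mono) simp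
    thus "\<kappa> < 1" unfolding \<kappa>_def by (rule less_trans) simp
  qed (simp add: \<kappa>_def)
  have \<Lambda>: "\<Lambda> \<ge> 1" using eL(2) unfolding \<Lambda>_def by linarith
  \<comment> \<open>The second entry ensures that an image of modulus above
    \<open>1 / \<eta>\<close> has distance at least \<Lambda> from the left end, whose modulus is at
    most \<open>r0\<close>.\<close>
  define \<eta> where "\<eta> = min \<kappa> (1 / (\<Lambda> + r0))"
  have \<eta>: "0 < \<eta>" "\<eta> < 1" "\<eta> \<le> \<kappa>" "1 / \<eta> \<ge> \<Lambda> + r0"
  proof -
    have p: "\<Lambda> + r0 > 0" using \<Lambda> r00 by simp
    show "0 < \<eta>" using p \<kappa> by (simp add: \<eta>_def)
    have "1 / (1 / (\<Lambda> + r0)) \<le> 1 / \<eta>" using p \<open>0 < \<eta>\<close> by (intro divide_left_mono) (auto simp: \<eta>_def)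
    thus "1 / \<eta> \<ge> \<Lambda> + r0" by simp
  qed (use \<kappa> in \<open>auto simp: \<eta>_def\<close>)
  have "\<exists>ps. (\<forall>p\<in>set ps. good_pair \<eta> fs p) \<and> sorted_wrt (apart fs) ps \<and>
       (\<Sum>p\<leftarrow>ps. snd p - fst p) \<ge> len / (8 * E)" if adm: "adm fs" and mM: "mass fs \<i> \<le> M" for fs
  proof -
    define \<alpha> where "\<alpha> = rlifts fs a"
    define \<beta> where "\<beta> = rlifts fs b"
    note we = window_ends[OF adm, folded \<alpha>_def \<beta>_def]
    have \<alpha>\<beta>: "\<alpha> < \<beta>" "\<beta> - \<alpha> \<le> len" using we by auto
    have wl: "\<beta> - \<alpha> \<ge> len / (2 * E)" using window_length[OF adm] by (simp add: \<alpha>_def \<beta>_def E_def)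
    have fV: "finite (real_vert fs)" using finite_real_vert[OF adm] .
    have aV: "\<alpha> \<in> real_vert fs" using rlifts_vert[OF adm aS] by (simp add: real_vert_def \<alpha>_def)
    have pV: "of_real x \<notin> poles fs" if "x \<notin> real_vert fs" for x
      using that poles_subset_vert by (auto simp: real_vert_def)
    \<comment> \<open>\<open>C0\<close> compensates the possible negative part of the far test in
      the window, so \<open>H\<close> is nonnegative everywhere.\<close>
    define H where "H = (\<lambda>x. (\<Sum>s\<in>S. near_test fs \<kappa> (Re s) x) + (far_test fs \<Lambda> \<alpha> x + C0))"
    have nt: "near_test fs \<kappa> s x \<ge> 0" for s x using near_test_nonneg[OF adm] \<kappa> by simp
    have ntc: "continuous_on UNIV (near_test fs \<kappa> s)" for s unfolding near_test_def[abs_def]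
      by (intro continuous_on_diff lsum_cont) (use \<kappa> in auto)
    have Hc: "continuous_on UNIV H" unfolding H_def
      by (intro continuous_intros ntc far_test_cont \<Lambda>)
    have ft: "far_test fs \<Lambda> \<alpha> x + C0 \<ge> 0" for x
    proof (rule nonneg_off_finite[of "\<lambda>x. far_test fs \<Lambda> \<alpha> x + C0" "real_vert fs"])
      show "continuous_on UNIV (\<lambda>x. far_test fs \<Lambda> \<alpha> x + C0)" by (intro continuous_intros far_test_cont \<Lambda>)
      show "far_test fs \<Lambda> \<alpha> x + C0 \<ge> 0" if x: "x \<notin> real_vert fs" for x
      proof (cases "\<alpha> \<le> x \<and> x \<le> \<beta>")
        case True
        thus ?thesis using far_test_inside(1)[OF adm \<Lambda>, of x \<alpha>] pV[OF x] by (simp add: \<alpha>_def \<beta>_def C0_def)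
      next
        case False
        hence "far_test fs \<Lambda> \<alpha> x \<ge> 0" by (intro far_test_outside[OF adm \<Lambda>]) (auto simp: \<alpha>_def \<beta>_def)
        thus ?thesis using C0 by simp
      qed
    qed (rule fV)
    have H0: "H x \<ge> 0" for x unfolding H_def by (rule add_nonneg_nonneg[OF sum_nonneg ft]) (rule nt)
    have HL: "H x \<ge> L" if x: "\<alpha> \<le> x" "x \<le> \<beta>" "x \<notin> real_vert fs" "\<not> mid \<eta> fs x" for x
    proof -
      from x(4) consider s where "s \<in> S" "cmod (fold_comp fs (of_real x) - s) < \<eta>"
        | "cmod (fold_comp fs (of_real x)) > 1 / \<eta>" by (auto simp: mid_def not_le)
      thus ?thesis
      proof cases
        case 1
        have "s = of_real (Re s)" using 1(1) real by auto
        hence "near_test fs \<kappa> (Re s) x \<ge> L"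
          using 1 \<eta>(3) by (intro near_test_large[OF adm \<kappa>(1) pV[OF x(3)]]) (auto simp: \<kappa>_def)
        moreover have "near_test fs \<kappa> (Re s) x \<le> (\<Sum>s\<in>S. near_test fs \<kappa> (Re s) x)"
          using 1(1) fin nt by (intro member_le_sum) auto
        ultimately show ?thesis unfolding H_def using ft[of x] by linarith
      next
        case 2
        have "(\<Sum>s\<in>S. cmod s) \<ge> 0" by (intro sum_nonneg) auto
        hence "\<bar>\<alpha>\<bar> \<le> r0" using we unfolding r0_def by linarith
        have "cmod (fold_comp fs (of_real x)) \<le> cmod (fold_comp fs (of_real x) - of_real \<alpha>) + \<bar>\<alpha>\<bar>"
          using norm_triangle_ineq[of "fold_comp fs (of_real x) - of_real \<alpha>" "of_real \<alpha>"] by simp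
        hence "cmod (fold_comp fs (of_real x) - of_real \<alpha>) \<ge> \<Lambda>" using 2 \<eta>(4) \<open>\<bar>\<alpha>\<bar> \<le> r0\<close> by linarith
        hence "far_test fs \<Lambda> \<alpha> x \<ge> L - C0" unfolding C0_def
          using x pV[OF x(3)] by (intro far_test_inside(2)[OF adm \<Lambda>]) (auto simp: \<alpha>_def \<beta>_def \<Lambda>_def)
        moreover have "(\<Sum>s\<in>S. near_test fs \<kappa> (Re s) x) \<ge> 0" using nt by (intro sum_nonneg) auto
        ultimately show ?thesis unfolding H_def by linarith
      qed
    qed
    have ci: "g integrable_on {\<alpha>..\<beta>}" if "continuous_on UNIV g" for g :: "real \<Rightarrow> real"
      by (rule integrable_continuous_interval) (rule continuous_on_subset[OF that], simp)
    have HB: "integral {\<alpha>..\<beta>} H \<le> B"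
    proof -
      have "integral {\<alpha>..\<beta>} H = (\<Sum>s\<in>S. integral {\<alpha>..\<beta>} (near_test fs \<kappa> (Re s))) + (integral {\<alpha>..\<beta>} (far_test fs \<Lambda> \<alpha>) + integral {\<alpha>..\<beta>} (\<lambda>x. C0))"
      proof -
        have i1: "(\<lambda>x. \<Sum>s\<in>S. near_test fs \<kappa> (Re s) x) integrable_on {\<alpha>..\<beta>}"
          by (intro ci continuous_on_sum ntc)
        have i2: "far_test fs \<Lambda> \<alpha> integrable_on {\<alpha>..\<beta>}" by (intro ci far_test_cont \<Lambda>)
        have i3: "(\<lambda>x. C0) integrable_on {\<alpha>..\<beta>}" by (intro ci continuous_on_const)
        have "integral {\<alpha>..\<beta>} (\<lambda>x. \<Sum>s\<in>S. near_test fs \<kappa> (Re s) x) = (\<Sum>s\<in>S. integral {\<alpha>..\<beta>} (near_test fs \<kappa> (Re s)))"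
          by (rule integral_sum[OF fin]) (intro ci ntc)
        thus ?thesis unfolding H_def
          using Henstock_Kurzweil_Integration.integral_add[OF i1 integrable_add[OF i2 i3]]
            Henstock_Kurzweil_Integration.integral_add[OF i2 i3] by simp
      qed
      moreover have "integral {\<alpha>..\<beta>} (\<lambda>x. C0) = C0 * (\<beta> - \<alpha>)" using \<alpha>\<beta> by simp
      moreover have "C0 * (\<beta> - \<alpha>) \<le> C0 * len" using C0 \<alpha>\<beta> by (intro mult_left_mono) auto
      moreover have "integral {\<alpha>..\<beta>} (far_test fs \<Lambda> \<alpha>) \<le> pi * ((5 + r0\<^sup>2) * M)"
      proof -
        have "(\<Sum>s\<in>S. cmod s) \<ge> 0" by (intro sum_nonneg) auto
        hence "\<bar>\<alpha>\<bar> \<le> r0" using we unfolding r0_def by linarith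
        hence "pi * mass fs (Complex \<alpha> 1) \<le> pi * ((5 + r0\<^sup>2) * M)"
          by (intro mult_left_mono mass_bound_shift[OF adm _ mM]) auto
        moreover have "integral {\<alpha>..\<beta>} (far_test fs \<Lambda> \<alpha>) \<le> pi * mass fs (Complex \<alpha> 1)"
          unfolding \<beta>_def \<alpha>_def by (rule far_test_integral[OF adm \<Lambda> refl])
        ultimately show ?thesis by (rule order_trans[rotated])
      qed
      moreover have "(\<Sum>s\<in>S. integral {\<alpha>..\<beta>} (near_test fs \<kappa> (Re s))) \<le> (\<Sum>s\<in>S. pi * ((5 + r0\<^sup>2) * M))"
      proof (rule sum_mono)
        fix s assume s: "s \<in> S"
        have "\<bar>Re s\<bar> \<le> r0" using abs_Re_le_cmod[of s] r0S[OF s] by simp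
        hence "pi * mass fs (Complex (Re s) 1) \<le> pi * ((5 + r0\<^sup>2) * M)"
          by (intro mult_left_mono mass_bound_shift[OF adm _ mM]) auto
        moreover have "integral {\<alpha>..\<beta>} (near_test fs \<kappa> (Re s)) \<le> pi * mass fs (Complex (Re s) 1)"
          by (rule near_test_integral[OF adm \<kappa>(1)]) (use \<kappa> \<alpha>\<beta> in simp_all)
        ultimately show "integral {\<alpha>..\<beta>} (near_test fs \<kappa> (Re s)) \<le> pi * ((5 + r0\<^sup>2) * M)"
          by (rule order_trans[rotated])
      qed
      moreover have "(\<Sum>s\<in>S. pi * ((5 + r0\<^sup>2) * M)) + pi * ((5 + r0\<^sup>2) * M) + C0 * len = B"
        unfolding B_def sum_constant by (simp only: distrib_right mult_1)
      ultimately show ?thesis by linarith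
    qed
    define P where "P = {p\<in>real_vert fs. \<alpha> \<le> p \<and> (\<exists>x\<in>side fs p. mid \<eta> fs x)}"
    define Mp where "Mp = (\<lambda>p. {x\<in>side fs p. mid \<eta> fs x})"
    have fP: "finite P" using fV by (simp add: P_def)
    have Mp: "Mp p \<noteq> {}" "Mp p \<subseteq> {p..\<beta>}" if "p \<in> P" for p
      using that by (auto simp: P_def Mp_def side_def \<beta>_def)
    have bdd: "bdd_below (Mp p)" "bdd_above (Mp p)" if "p \<in> P" for p
      using Mp(2)[OF that] by (meson bdd_below_Icc bdd_below_mono bdd_above_Icc bdd_above_mono)+
    define u where "u = (\<lambda>p. Inf (Mp p))"
    define v where "v = (\<lambda>p. Sup (Mp p))"
    have uv: "u p \<le> v p" "\<alpha> \<le> u p" "v p \<le> \<beta>" "Mp p \<subseteq> {u p..v p}" if p: "p \<in> P" for p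
    proof -
      show sub: "Mp p \<subseteq> {u p..v p}" using bdd[OF p] by (auto simp: u_def v_def cInf_lower cSup_upper)
      show "u p \<le> v p" using sub Mp(1)[OF p] by fastforce
      show "v p \<le> \<beta>" unfolding v_def by (rule cSup_least[OF Mp(1)[OF p]]) (use Mp(2)[OF p] in auto)
      have "p \<le> u p" unfolding u_def by (rule cInf_greatest[OF Mp(1)[OF p]]) (use Mp(2)[OF p] in auto)
      thus "\<alpha> \<le> u p" using p by (simp add: P_def)
    qed
    have cover: "\<exists>p\<in>P. x \<in> Mp p" if x: "\<alpha> \<le> x" "x \<le> \<beta>" "x \<notin> real_vert fs" "mid \<eta> fs x" for x
    proof -
      define W where "W = {w\<in>real_vert fs. w < x}"
      have "\<alpha> \<in> W" using aV x by (auto simp: W_def order.order_iff_strict)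
      have fW: "finite W" using fV by (simp add: W_def)
      have mW: "Max W \<in> W" using fW \<open>\<alpha> \<in> W\<close> by (intro Max_in) auto
      have "x \<in> side fs (Max W)"
        unfolding side_def
      proof (intro CollectI conjI ballI notI)
        show "Max W < x" "x \<le> rlifts fs b" using mW x by (auto simp: W_def \<beta>_def)
        fix w assume w: "w \<in> real_vert fs" "Max W < w \<and> w \<le> x"
        hence "w \<in> W" using x(3) by (auto simp: W_def order.order_iff_strict)
        thus False using Max_ge[OF fW] w by fastforce
      qed
      moreover have "\<alpha> \<le> Max W" using Max_ge[OF fW \<open>\<alpha> \<in> W\<close>] .
      ultimately have "Max W \<in> P" "x \<in> Mp (Max W)" using mW x by (auto simp: P_def Mp_def W_def)
      thus ?thesis by blast
    qed
    have sumlen: "(\<Sum>p\<in>P. v p - u p) \<ge> len / (4 * E)"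
    proof -
      have ind: "((indicat_real {u p..v p}) has_integral (v p - u p)) {\<alpha>..\<beta>}" if p: "p \<in> P" for p
      proof -
        have "((\<lambda>x. 1::real) has_integral (v p - u p)) {u p..v p}"
          using has_integral_const_real[of "1::real" "u p" "v p"] uv(1)[OF p] by simp
        hence "((\<lambda>x. if x \<in> {u p..v p} then 1 else 0 :: real) has_integral (v p - u p)) {\<alpha>..\<beta>}"
          using uv[OF p] by (subst has_integral_restrict) auto
        moreover have "(\<lambda>x. if x \<in> {u p..v p} then 1 else 0 :: real) = indicat_real {u p..v p}"
          by (simp add: fun_eq_iff indicator_def)
        ultimately show ?thesis by simp
      qed
      have hi1: "((\<lambda>x. H x / L + (\<Sum>p\<in>P. indicat_real {u p..v p} x)) has_integral
           (integral {\<alpha>..\<beta>} H / L + (\<Sum>p\<in>P. v p - u p))) {\<alpha>..\<beta>}"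
        by (intro has_integral_add has_integral_sum fP ind has_integral_divide integrable_integral ci Hc)
      have hi2: "((\<lambda>x. if x \<in> real_vert fs then 0 else 1 :: real) has_integral (\<beta> - \<alpha>)) {\<alpha>..\<beta>}"
        by (rule has_integral_spike_finite[OF fV, of _ _ "\<lambda>x. 1"])
           (use has_integral_const_real[of "1::real" \<alpha> \<beta>] \<alpha>\<beta> in auto)
      \<comment> \<open>Chebyshev's inequality written as a pointwise bound: off the vertices,
        either a hull contains \<open>x\<close> or \<open>H x \<ge> L\<close>. With hulls in place
        of the set of \<open>mid\<close> points, only intervals have to be measured.\<close>
      have hi3: "(if x \<in> real_vert fs then 0 else 1) \<le> H x / L + (\<Sum>p\<in>P. indicat_real {u p..v p} x)"
        if x: "x \<in> {\<alpha>..\<beta>}" for x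
      proof -
        have s0: "(\<Sum>p\<in>P. indicat_real {u p..v p} x) \<ge> 0" by (intro sum_nonneg) auto
        have h0: "H x / L \<ge> 0" using H0 L by simp
        consider "x \<in> real_vert fs" | "x \<notin> real_vert fs" "mid \<eta> fs x" | "x \<notin> real_vert fs" "\<not> mid \<eta> fs x" by blast
        thus ?thesis
        proof cases
          case 2
          then obtain p where p: "p \<in> P" "x \<in> Mp p" using cover[of x] x by auto
          hence "indicat_real {u p..v p} x = 1" using uv(4)[OF p(1)] by (auto simp: indicator_def)
          moreover have "indicat_real {u p..v p} x \<le> (\<Sum>p\<in>P. indicat_real {u p..v p} x)"
            using fP p(1) by (intro member_le_sum) auto
          ultimately show ?thesis using h0 2 by simp
        next
          case 3
          hence "H x / L \<ge> 1" using HL[of x] x L by simp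
          thus ?thesis using s0 3 by simp
        qed (use s0 h0 in simp)
      qed
      have "\<beta> - \<alpha> \<le> integral {\<alpha>..\<beta>} H / L + (\<Sum>p\<in>P. v p - u p)"
        by (rule has_integral_le[OF hi2 hi1 hi3])
      moreover have "integral {\<alpha>..\<beta>} H / L \<le> B / L" using HB L by (intro divide_right_mono) auto
      moreover have "len / (2 * E) = len / (4 * E) + len / (4 * E)"
        using E by (simp add: add_divide_distrib[symmetric] field_simps)
      ultimately show ?thesis using wl BL by linarith
    qed
    have "\<exists>x y. x \<in> Mp p \<and> y \<in> Mp p \<and> x \<le> y \<and> y - x \<ge> (v p - u p) / 2" if p: "p \<in> P" for p
    proof (cases "v p = u p")
      case True
      thus ?thesis using Mp(1)[OF p] by auto
    next
      case False
      hence pos: "(v p - u p) / 4 > 0" using uv(1)[OF p] by simp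
      \<comment> \<open>Infimum and supremum need not be attained; giving up a quarter of the hull
        at each end leaves half of it.\<close>
      obtain x where x: "x \<in> Mp p" "x < u p + (v p - u p) / 4"
        using cInf_lessD[OF Mp(1)[OF p], of "u p + (v p - u p) / 4"] pos by (auto simp: u_def)
      obtain y where y: "y \<in> Mp p" "y > v p - (v p - u p) / 4"
        using less_cSupD[OF Mp(1)[OF p], of "v p - (v p - u p) / 4"] pos by (auto simp: v_def)
      have "y - x \<ge> 2 * ((v p - u p) / 4)" using x(2) y(2) by (simp add: field_simps)
      moreover have "y - x \<ge> (v p - u p) / 2" using calculation by simp
      moreover have "x \<le> y" using calculation pos by linarith
      ultimately show ?thesis using x(1) y(1) by blast
    qed
    then obtain X Y where XY: "\<And>p. p \<in> P \<Longrightarrow> X p \<in> Mp p" "\<And>p. p \<in> P \<Longrightarrow> Y p \<in> Mp p"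
      "\<And>p. p \<in> P \<Longrightarrow> X p \<le> Y p" "\<And>p. p \<in> P \<Longrightarrow> Y p - X p \<ge> (v p - u p) / 2" by metis
    define ps where "ps = map (\<lambda>p. (X p, Y p)) (sorted_list_of_set P)"
    have sP: "set (sorted_list_of_set P) = P" using fP by simp
    have gd: "good_pair \<eta> fs (X p, Y p)" if p: "p \<in> P" for p
      using XY(1)[OF p] XY(2)[OF p] XY(3)[OF p] p by (auto simp: good_pair_def Mp_def side_def P_def \<alpha>_def)
    have ap: "apart fs (X p, Y p) (X q, Y q)" if "p \<in> P" "q \<in> P" "p < q" for p q
    proof -
      have "q \<in> real_vert fs" "\<not> (p < q \<and> q \<le> Y p)" "q < X q"
        using XY(1)[OF that(2)] XY(2)[OF that(1)] that(2) by (auto simp: Mp_def side_def P_def)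
      hence "Y p < q" "q < X q" "q \<in> real_vert fs" using that(3) by auto
      thus ?thesis unfolding apart_def fst_conv snd_conv by blast
    qed
    have srt: "sorted_wrt (apart fs) ps" unfolding ps_def sorted_wrt_map
      by (rule sorted_wrt_mono_rel[of _ "(<)"]) (use ap sP strict_sorted_list_of_set in auto)
    have "(\<Sum>p\<leftarrow>ps. snd p - fst p) = (\<Sum>p\<in>P. Y p - X p)"
      unfolding ps_def map_map o_def fst_conv snd_conv
      using sum_list_distinct_conv_sum_set[of "sorted_list_of_set P" "\<lambda>p. Y p - X p"] sP by simp
    moreover have "(\<Sum>p\<in>P. Y p - X p) \<ge> (\<Sum>p\<in>P. (v p - u p) / 2)" using XY(4) by (intro sum_mono) auto
    moreover have "(\<Sum>p\<in>P. (v p - u p) / 2) = (\<Sum>p\<in>P. v p - u p) / 2" by (simp add: sum_divide_distrib)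
    moreover have "(\<Sum>p\<in>P. v p - u p) / 2 \<ge> len / (4 * E) / 2" using sumlen by (rule divide_right_mono) simp
    moreover have "len / (4 * E) / 2 = len / (8 * E)" by simp
    moreover have "w \<le> t" if "t = sy" "sh \<le> sy" "sh = hh" "q \<le> hh" "q = w" for t sy sh hh q w :: real
      using that by simp
    ultimately have "(\<Sum>p\<leftarrow>ps. snd p - fst p) \<ge> len / (8 * E)" by blast
    moreover have "\<forall>p\<in>set ps. good_pair \<eta> fs p" using gd unfolding ps_def set_map sP by blast
    ultimately show ?thesis using srt by blast
  qed
  thus ?thesis using \<eta>(1,2) unfolding E_def by blast
qed

text \<open>Under a bound on the mass, \<open>mid_sides\<close> and \<open>fold_all_sides\<close>
  give a gain per round that does not depend on the folds made before, so finitely many rounds break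
  the bound.\<close>

lemma mass_unbounded: "\<exists>fs. adm fs \<and> mass fs \<i> \<ge> M"
proof (rule ccontr)
  assume "\<not> ?thesis"
  hence lt: "mass fs \<i> < M" if "adm fs" for fs using that by (meson not_le)
  have M0: "M \<ge> 0" using lt[of "[]"] mass_nonneg[of "[]" \<i>] by simp
  obtain \<eta> where \<eta>: "0 < \<eta>" "\<eta> < 1" and ps: "\<And>fs. adm fs \<Longrightarrow> mass fs \<i> \<le> M \<Longrightarrow>
    (\<exists>ps. (\<forall>p\<in>set ps. good_pair \<eta> fs p) \<and> sorted_wrt (apart fs) ps \<and>
       (\<Sum>p\<leftarrow>ps. snd p - fst p) \<ge> len / (8 * exp (pi * exp (pi * 16))))"
    using mid_sides[OF M0] by blast
  define K where "K = 4 / \<eta> * ((1 / \<eta> + 2)\<^sup>2 + 2)"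
  define Z where "Z = K * (7 + 4 * K)\<^sup>2"
  have Z: "Z > 0"
  proof -
    have "(1 / \<eta> + 2)\<^sup>2 + 2 > 0" by (rule add_nonneg_pos) auto
    hence "K > 0" using \<eta> by (simp add: K_def)
    thus ?thesis unfolding Z_def by (intro mult_pos_pos zero_less_power) auto
  qed
  define g where "g = len / (8 * exp (pi * exp (pi * 16))) / Z"
  have g: "g > 0" using Z ab by (simp add: g_def)
  have step: "\<exists>gs. adm gs \<and> mass gs \<i> \<ge> mass fs \<i> + g" if fs: "adm fs" for fs
  proof -
    obtain ps where ps: "\<forall>p\<in>set ps. good_pair \<eta> fs p" "sorted_wrt (apart fs) ps"
      "(\<Sum>p\<leftarrow>ps. snd p - fst p) \<ge> len / (8 * exp (pi * exp (pi * 16)))"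
      using ps[OF fs] lt[OF fs] by auto
    obtain gs where gs: "adm gs" "mass gs \<i> \<ge> mass fs \<i> + (\<Sum>p\<leftarrow>ps. snd p - fst p) / Z"
      using fold_all_sides[OF \<eta> K_def fs ps(1,2)] by (auto simp: Z_def)
    have "g \<le> (\<Sum>p\<leftarrow>ps. snd p - fst p) / Z" unfolding g_def using ps(3) Z by (intro divide_right_mono) auto
    thus ?thesis using gs by (intro exI[of _ gs]) auto
  qed
  have "\<exists>fs. adm fs \<and> mass fs \<i> \<ge> real n * g" for n
  proof (induction n)
    case 0
    show ?case by (intro exI[of _ "[]"]) (simp add: mass_nonneg)
  next
    case (Suc n)
    then obtain fs where fs: "adm fs" "mass fs \<i> \<ge> real n * g" by blast
    obtain gs where "adm gs" "mass gs \<i> \<ge> mass fs \<i> + g" using step[OF fs(1)] by blast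
    thus ?case using fs(2) by (intro exI[of _ gs]) (simp add: algebra_simps)
  qed
  moreover obtain n where "real n * g > M" using reals_Archimedean3[OF g] by blast
  ultimately show False using lt by (meson less_le_not_le order_trans not_le)
qed

end

section \<open>Blocks\<close>

context window
begin

text \<open>Harnack's inequality carries a large mass over \<open>\<i>\<close> to a compact part of
  the upper half-plane, and conjugation to the lower one.\<close>

lemma mass_unbounded_compact:
  assumes "N \<ge> 1"
  shows "\<exists>fs. adm fs \<and> fs \<noteq> [] \<and> (\<forall>z. \<bar>Im z\<bar> \<ge> 1 / N \<and> cmod z \<le> N \<longrightarrow> mass fs z \<ge> M)"
proof -
  define k where "k = 1 + N * (N + 1)\<^sup>2"
  have k: "k > 0" using assms by (simp add: k_def add_pos_nonneg)
  \<comment> \<open>The surplus 2 excludes the empty list, whose mass over \<open>\<i>\<close> is 1,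
    and absorbs the mass 1 from the factor \<open>k\<close> being compared at
    \<open>\<i>\<close>.\<close>
  obtain fs where fs: "adm fs" "mass fs \<i> \<ge> k * \<bar>M\<bar> + 2" using mass_unbounded by blast
  have "k * \<bar>M\<bar> \<ge> 0" using k by simp
  hence "mass fs \<i> > 1" using fs(2) by linarith
  hence "fs \<noteq> []" by (auto simp: mass_def)
  have up: "mass fs z \<ge> M" if z: "Im z \<ge> 1 / N" "cmod z \<le> N" for z
  proof -
    have zp: "Im z > 0" using z(1) assms by (intro less_le_trans[OF _ z(1)]) simp
    have "cmod (\<i> - cnj z) \<le> N + 1" using norm_triangle_ineq4[of \<i> "cnj z"] z(2) by simp
    hence "(cmod (\<i> - cnj z))\<^sup>2 \<le> (N + 1)\<^sup>2" by (intro power_mono) auto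
    moreover have "1 / Im z \<le> N" using z(1) zp assms by (simp add: field_simps)
    ultimately have "(cmod (\<i> - cnj z))\<^sup>2 * (1 / Im z) \<le> (N + 1)\<^sup>2 * N"
      using zp by (intro mult_mono) auto
    hence "1 + (cmod (\<i> - cnj z))\<^sup>2 / (Im z * Im \<i>) \<le> k" by (simp add: k_def mult.commute)
    hence "(1 + (cmod (\<i> - cnj z))\<^sup>2 / (Im z * Im \<i>)) * mass fs z \<le> k * mass fs z"
      using mass_nonneg by (intro mult_right_mono)
    hence "mass fs \<i> \<le> k * mass fs z" using mass_harnack[OF fs(1), of \<i> z] zp by simp
    hence "k * \<bar>M\<bar> \<le> k * mass fs z" using fs(2) by linarith
    hence "\<bar>M\<bar> \<le> mass fs z" using k by simp
    thus ?thesis by simp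
  qed
  have "mass fs z \<ge> M" if z: "\<bar>Im z\<bar> \<ge> 1 / N" "cmod z \<le> N" for z
  proof (cases "Im z \<ge> 0")
    case True
    thus ?thesis using up[of z] z by simp
  next
    case False
    hence "mass fs (cnj z) \<ge> M" using up[of "cnj z"] z by simp
    thus ?thesis by (simp add: mass_cnj)
  qed
  thus ?thesis using fs(1) \<open>fs \<noteq> []\<close> by blast
qed

text \<open>The signed sum over the fiber is \<open>Im z\<close>. Adding it or subtracting it
  doubles the terms in one half-plane and cancels those in the other.\<close>

lemma half_mass:
  assumes "adm fs" "Im z \<noteq> 0" "\<sigma> = 1 \<or> \<sigma> = -1"
  shows "2 * (\<Sum>y\<in>{y\<in>fiber fs z. \<sigma> * Im y > 0}. \<bar>Im y\<bar>) = mass fs z + \<sigma> * Im z"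
proof -
  have f: "finite (fiber fs z)" using finite_fiber'[OF assms(1)] .
  have "mass fs z + \<sigma> * Im z = (\<Sum>y\<in>fiber fs z. \<bar>Im y\<bar> + \<sigma> * Im y)"
    unfolding mass_def using signed_mass[OF assms(1,2)] by (simp add: sum.distrib flip: sum_distrib_left)
  also have "\<dots> = (\<Sum>y\<in>fiber fs z. if \<sigma> * Im y > 0 then 2 * \<bar>Im y\<bar> else 0)"
    using assms(3) by (intro sum.cong) auto
  also have "\<dots> = (\<Sum>y\<in>{y\<in>fiber fs z. \<sigma> * Im y > 0}. 2 * \<bar>Im y\<bar>)"
    by (rule sum.inter_filter[OF f, symmetric])
  finally show ?thesis by (simp add: sum_distrib_left)
qed

end

text \<open>The interface that hides the folds from the limit construction. The lower bound \<alpha>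
  for the new preimages of vertices matters: the next block acts at a scale far below \<alpha> and
  displaces them only slightly.\<close>

definition is_block :: "complex set \<Rightarrow> real \<Rightarrow> real \<Rightarrow> real \<Rightarrow> real \<Rightarrow> (complex \<Rightarrow> complex) \<Rightarrow> complex set \<Rightarrow> bool" where
  "is_block S \<alpha> \<rho> M N B P \<longleftrightarrow>
     finite P \<and> P \<subseteq> \<real> \<and> B holomorphic_on - P \<and>
     finite {y. y \<notin> P \<and> B y \<in> S} \<and> {y. y \<notin> P \<and> B y \<in> S} \<subseteq> \<real> \<and>
     (\<forall>y. B (cnj y) = cnj (B y)) \<and>
     (\<forall>y. cmod y \<ge> 5 * \<rho> \<longrightarrow> y \<notin> P \<and> cmod (B y - y) \<le> \<rho>) \<and>
     (\<forall>z. Im z \<noteq> 0 \<longrightarrow> (\<exists>y. y \<notin> P \<and> B y = z \<and> Im y * Im z > 0 \<and> \<bar>Im y\<bar> \<ge> \<bar>Im z\<bar>)) \<and>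
     (\<forall>z \<sigma>. \<bar>Im z\<bar> \<ge> 1 / N \<and> cmod z \<le> N \<and> (\<sigma> = 1 \<or> \<sigma> = -1) \<longrightarrow>
        (\<exists>Y. finite Y \<and> (\<forall>y\<in>Y. y \<notin> P \<and> B y = z \<and> \<sigma> * Im y > 0) \<and> (\<Sum>y\<in>Y. \<bar>Im y\<bar>) \<ge> M)) \<and>
     (\<forall>v. of_real v \<in> S \<longrightarrow> (\<exists>x. \<alpha> \<le> x \<and> x < \<rho> \<and> of_real x \<notin> P \<and> B (of_real x) = of_real v))"

lemma block_exists:
  assumes S: "finite S" "S \<subseteq> \<real>" and "\<rho> > 0" "N \<ge> 1"
  shows "\<exists>\<alpha> B P. 0 < \<alpha> \<and> \<alpha> < \<rho> \<and> is_block S \<alpha> \<rho> M N B P"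
proof -
  \<comment> \<open>Its minimum \<open>t\<close> leaves the interval from 0 to \<open>t\<close> free
    of old vertices. The window from \<open>t / 4\<close> to \<open>t / 2\<close> then contains no
    point of \<open>S\<close>, as \<open>vertex_preimage\<close> requires.\<close>
  define T where "T = insert \<rho> {s. 0 < s \<and> of_real s \<in> S}"
  have "finite {s::real. of_real s \<in> S}"
    using finite_vimageI[OF S(1), of "of_real :: real \<Rightarrow> complex"] by (simp add: vimage_def inj_of_real)
  hence "finite {s. 0 < s \<and> of_real s \<in> S}" by (rule finite_subset[rotated]) auto
  hence fT: "finite T" by (simp add: T_def)
  define t where "t = Min T"
  have tT: "t \<in> T" unfolding t_def using fT by (intro Min_in) (auto simp: T_def)
  have t: "t > 0" "t \<le> \<rho>" using tT fT \<open>\<rho> > 0\<close> by (auto simp: T_def t_def)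
  have notS: "of_real v \<notin> S" if "0 < v" "v < t" for v
  proof
    assume "of_real v \<in> S"
    hence "v \<in> T" using that by (simp add: T_def)
    thus False using Min_le[OF fT] that by (force simp: t_def)
  qed
  define \<alpha> where "\<alpha> = t / 4"
  define \<beta> where "\<beta> = t / 2"
  define S' where "S' = S \<union> {of_real \<alpha>, of_real \<beta>}"
  interpret w: window S' \<alpha> \<beta>
    by unfold_locales (use S t in \<open>auto simp: S'_def \<alpha>_def \<beta>_def\<close>)
  \<comment> \<open>By \<open>half_mass\<close> each half-plane receives half of the mass up to
    \<open>\<bar>Im z\<bar> / 2\<close>, and \<open>\<bar>Im z\<bar> \<le> N\<close>.\<close>
  have M2: "\<exists>fs. w.adm fs \<and> fs \<noteq> [] \<and> (\<forall>z. \<bar>Im z\<bar> \<ge> 1 / N \<and> cmod z \<le> N \<longrightarrow> w.mass fs z \<ge> 2 * M + N)"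
    by (rule w.mass_unbounded_compact[OF assms(4)])
  then obtain fs where adm: "w.adm fs" and ne: "fs \<noteq> []"
    and mass: "\<And>z. \<bar>Im z\<bar> \<ge> 1 / N \<Longrightarrow> cmod z \<le> N \<Longrightarrow> w.mass fs z \<ge> 2 * M + N" by blast
  have SS': "S \<subseteq> S'" by (auto simp: S'_def)
  have V: "{y. y \<notin> poles fs \<and> fold_comp fs y \<in> S} \<subseteq> vert S' fs" using SS' by (auto simp: vert_def)
  have "is_block S \<alpha> \<rho> M N (fold_comp fs) (poles fs)"
    unfolding is_block_def
  proof (intro conjI allI impI)
    show "finite (poles fs)" using finite_subset[OF poles_subset_vert w.finite_vert[OF adm]] .
    show "poles fs \<subseteq> \<real>" by (rule w.poles_real_adm[OF adm])
    show "fold_comp fs holomorphic_on - poles fs" by (rule w.fold_comp_holomorphic)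
    show "finite {y. y \<notin> poles fs \<and> fold_comp fs y \<in> S}" using finite_subset[OF V w.finite_vert[OF adm]] .
    show "{y. y \<notin> poles fs \<and> fold_comp fs y \<in> S} \<subseteq> \<real>" using V w.vert_real_adm[OF adm] by blast
    show "fold_comp fs (cnj y) = cnj (fold_comp fs y)" for y by (rule fold_comp_cnj)
    fix y :: complex assume y: "5 * \<rho> \<le> cmod y"
    have "cmod (y - of_real \<alpha>) \<ge> cmod y - \<alpha>" using norm_triangle_ineq2[of y "of_real \<alpha>"] t by (simp add: \<alpha>_def)
    hence far: "cmod (y - of_real \<alpha>) \<ge> 3 * (\<beta> - \<alpha>)" using y t by (simp add: \<alpha>_def \<beta>_def)
    show "y \<notin> poles fs" by (rule w.near_identity'(1)[OF adm far])
    have "cmod (fold_comp fs y - y) \<le> \<beta> - \<alpha>" by (rule w.near_identity'(2)[OF adm far])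
    thus "cmod (fold_comp fs y - y) \<le> \<rho>" using t by (simp add: \<alpha>_def \<beta>_def)
  next
    fix z :: complex assume "Im z \<noteq> 0"
    from w.principal[OF adm this] obtain y where y: "y \<in> fiber fs z" "Im y * Im z > 0" "\<bar>Im y\<bar> \<ge> \<bar>Im z\<bar>" by blast
    thus "\<exists>y. y \<notin> poles fs \<and> fold_comp fs y = z \<and> 0 < Im y * Im z \<and> \<bar>Im z\<bar> \<le> \<bar>Im y\<bar>"
      unfolding fiber_def by blast
  next
    fix z :: complex and \<sigma> :: real
    assume z: "1 / N \<le> \<bar>Im z\<bar> \<and> cmod z \<le> N \<and> (\<sigma> = 1 \<or> \<sigma> = - 1)"
    have "1 / N > 0" using assms(4) by simp
    hence nz: "Im z \<noteq> 0" using z by auto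
    define Y where "Y = {y\<in>fiber fs z. \<sigma> * Im y > 0}"
    have "\<bar>\<sigma> * Im z\<bar> \<le> N" using z abs_Im_le_cmod[of z] by (auto simp: abs_mult)
    moreover have "2 * (\<Sum>y\<in>Y. \<bar>Im y\<bar>) = w.mass fs z + \<sigma> * Im z"
      unfolding Y_def by (rule w.half_mass[OF adm nz]) (use z in blast)
    moreover have "w.mass fs z \<ge> 2 * M + N" using mass z by blast
    ultimately have "(\<Sum>y\<in>Y. \<bar>Im y\<bar>) \<ge> M" by linarith
    moreover have "finite Y" using w.finite_fiber'[OF adm] by (simp add: Y_def)
    ultimately show "\<exists>Y. finite Y \<and> (\<forall>y\<in>Y. y \<notin> poles fs \<and> fold_comp fs y = z \<and> 0 < \<sigma> * Im y) \<and> M \<le> (\<Sum>y\<in>Y. \<bar>Im y\<bar>)"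
      by (intro exI[of _ Y]) (auto simp: Y_def fiber_def)
  next
    fix v :: real assume v: "of_real v \<in> S"
    have "v \<notin> {\<alpha>..\<beta>}" using notS[of v] v t by (auto simp: \<alpha>_def \<beta>_def)
    then obtain x where x: "of_real x \<in> fiber fs (of_real v)" "rlifts fs \<alpha> \<le> x" "x \<le> rlifts fs \<beta>"
      using w.vertex_preimage[OF adm ne, of v] v SS' by blast
    have "\<alpha> \<le> x" "x \<le> \<beta>" using w.window_ends[OF adm] x by auto
    moreover have "\<beta> < \<rho>" using t by (simp add: \<beta>_def)
    ultimately show "\<exists>x. \<alpha> \<le> x \<and> x < \<rho> \<and> of_real x \<notin> poles fs \<and> fold_comp fs (of_real x) = of_real v"
      using x(1) by (intro exI[of _ x]) (auto simp: fiber_def)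
  qed
  moreover have "0 < \<alpha>" "\<alpha> < \<rho>" using t by (auto simp: \<alpha>_def)
  ultimately show ?thesis by blast
qed

section \<open>The outermost rational map, of degree 4\<close>

definition R0 :: "complex \<Rightarrow> complex" where
  "R0 x = x ^ 3 * (2 - x) / (2 * x - 1)"

text \<open>The finite points over 0, 1 and infinity. Besides the zeros 0 and 2 and the pole 1/2
  these are 1 and -1, because \<open>R0 x - 1\<close> is - (x - 1)^3 (x + 1) / (2 x - 1). The triple
  points 0, 1 and infinity exhaust the ramification, so \<open>R0\<close> is a Belyi
  function.\<close>

definition R0_vert :: "complex set" where
  "R0_vert = {- 1, 0, 1 / 2, 1, 2}"

lemma R0_cnj: "R0 (cnj x) = cnj (R0 x)"
  by (simp add: R0_def)

lemma R0_holomorphic: "R0 holomorphic_on - {1 / 2}"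
proof -
  have "2 * x - 1 \<noteq> 0" if "x \<noteq> 1 / 2" for x :: complex
    using that by (auto simp: field_simps)
  thus ?thesis unfolding R0_def[abs_def] by (auto intro!: holomorphic_intros)
qed

lemma R0_omits:
  assumes "x \<notin> R0_vert" shows "R0 x \<noteq> 0" "R0 x \<noteq> 1"
proof -
  have nz: "2 * x - 1 \<noteq> 0" using assms by (auto simp: R0_vert_def field_simps)
  show "R0 x \<noteq> 0" using assms nz by (auto simp: R0_def R0_vert_def)
  show "R0 x \<noteq> 1"
  proof
    assume "R0 x = 1"
    hence "x ^ 3 * (2 - x) = 2 * x - 1" using nz by (simp add: R0_def)
    moreover have "x ^ 3 * (2 - x) - (2 * x - 1) = - ((x - 1) ^ 3 * (x + 1))"
      by (simp add: power3_eq_cube algebra_simps)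
    ultimately have "(x - 1) ^ 3 * (x + 1) = 0" by simp
    hence "x - 1 = 0 \<or> x + 1 = 0" by simp
    hence "x = 1 \<or> x = -1" by (simp add: eq_neg_iff_add_eq_0)
    thus False using assms by (auto simp: R0_vert_def)
  qed
qed

text \<open>Real roots \<open>x\<^sub>i\<close> of \<open>x\<^sup>3 (2 - x) = c (2 x - 1)\<close> would satisfy
  \<open>\<Sum> x\<^sub>i\<^sup>2 = \<Sum> 1 / x\<^sub>i\<^sup>2 = 4\<close> and hence all be \<open>\<plusminus>1\<close>.\<close>

lemma R0_nonreal_root:
  assumes "c \<noteq> 0" "c \<noteq> 1"
  shows "\<exists>x. Im x \<noteq> 0 \<and> R0 x = c"
proof (rule ccontr)
  assume neg: "\<not> ?thesis"
  \<comment> \<open>The numerator of \<open>c - R0 x\<close>. Its coefficients are such that the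
    roots and their reciprocals have the same sum 2 and the same second elementary symmetric
    function 0.\<close>
  define p where "p = [:- c, 2 * c, 0, - 2, 1:]"
  have pv: "poly p x = (2 * x - 1) * c - x ^ 3 * (2 - x)" for x
    by (simp add: p_def power3_eq_cube algebra_simps)
  have half: "poly p (1 / 2) \<noteq> 0" unfolding pv by (simp add: power3_eq_cube)
  have real: "x \<in> \<real>" if "poly p x = 0" for x
  proof -
    have nz: "2 * x - 1 \<noteq> 0"
    proof
      assume "2 * x - 1 = 0"
      hence "x * 2 = 1" by (simp add: mult.commute)
      hence x2: "x = 1 / 2" by (simp add: eq_divide_eq)
      have "poly p (1 / 2) = 0" using that unfolding x2 .
      thus False using half by blast
    qed
    have "(2 * x - 1) * c = x ^ 3 * (2 - x)" using that unfolding pv by simp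
    hence "R0 x = c" using nz by (simp add: R0_def nonzero_divide_eq_eq mult.commute)
    hence "Im x = 0" using neg by blast
    thus ?thesis by (simp add: complex_is_Real_iff)
  qed
  have "p \<noteq> 0" by (simp add: p_def)
  then obtain A where A: "size A = degree p" "p = smult (lead_coeff p) (\<Prod>x\<in>#A. [:- x, 1:])"
    using alg_closed_imp_factorization[of p] by blast
  have dp: "degree p = 4" "lead_coeff p = 1" by (simp_all add: p_def)
  have "size A = Suc (Suc (Suc (Suc 0)))" using A(1) dp by simp
  moreover obtain xs where xs: "mset xs = A" using ex_mset by blast
  ultimately have "length xs = Suc (Suc (Suc (Suc 0)))" by (simp flip: size_mset)
  then obtain x1 x2 x3 x4 where "xs = [x1, x2, x3, x4]" by (auto simp: length_Suc_conv)
  hence A4: "A = {#x1, x2, x3, x4#}" using xs by simp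
  have pA: "p = [:- x1, 1:] * ([:- x2, 1:] * ([:- x3, 1:] * [:- x4, 1:]))"
    using A(2) unfolding dp(2) A4 by simp
  have pr: "poly p x = (x - x1) * ((x - x2) * ((x - x3) * (x - x4)))" for x
    by (simp add: pA algebra_simps)
  have xr: "x1 \<in> \<real>" "x2 \<in> \<real>" "x3 \<in> \<real>" "x4 \<in> \<real>" by (rule real, simp add: pr)+
  obtain r1 where r1: "x1 = of_real r1" using xr(1) by (rule Reals_cases)
  obtain r2 where r2: "x2 = of_real r2" using xr(2) by (rule Reals_cases)
  obtain r3 where r3: "x3 = of_real r3" using xr(3) by (rule Reals_cases)
  obtain r4 where r4: "x4 = of_real r4" using xr(4) by (rule Reals_cases)
  note r = r1 r2 r3 r4
  have aux: "T + R = - 2 * c" if "c * 2 + R = - T" for T R :: complex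
  proof -
    have "T + R = T + (c * 2 + R) - c * 2" by simp
    thus ?thesis unfolding that by simp
  qed
  have "- c = x1 * (x2 * (x3 * x4)) \<and> c * 2 + (x1 * (x2 * x4) + (x1 * (x3 * x4) + x2 * (x3 * x4))) = - (x1 * (x2 * x3)) \<and>
      x1 * x2 + (x1 * x3 + (x1 * x4 + (x2 * x3 + (x2 * x4 + x3 * x4)))) = 0 \<and> x1 + (x2 + (x3 + x4)) = 2"
    using pA unfolding p_def by (simp add: algebra_simps)
  hence eqs0: "- c = x1 * (x2 * (x3 * x4))"
    "c * 2 + (x1 * (x2 * x4) + (x1 * (x3 * x4) + x2 * (x3 * x4))) = - (x1 * (x2 * x3))"
    "x1 * x2 + (x1 * x3 + (x1 * x4 + (x2 * x3 + (x2 * x4 + x3 * x4)))) = 0" "x1 + (x2 + (x3 + x4)) = 2" by blast+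
  have eqs: "x1 * (x2 * (x3 * x4)) = - c" "x1 + x2 + x3 + x4 = 2"
    "x1 * x2 + x1 * x3 + x1 * x4 + x2 * x3 + x2 * x4 + x3 * x4 = 0"
    "x1 * x2 * x3 + x1 * x2 * x4 + x1 * x3 * x4 + x2 * x3 * x4 = - 2 * c"
    using eqs0(1,3,4) aux[OF eqs0(2)] by (simp_all add: add.assoc mult.assoc)
  define q where "q = r1 * (r2 * (r3 * r4))"
  have cq: "c = of_real (- q)" 
  proof -
    have "c = - (x1 * (x2 * (x3 * x4)))" using eqs(1) by simp
    thus ?thesis by (simp add: r q_def)
  qed
  have e1: "r1 + r2 + r3 + r4 = 2"
  proof -
    have "complex_of_real (r1 + r2 + r3 + r4) = of_real 2" using eqs(2) by (simp add: r)
    thus ?thesis by (simp only: of_real_eq_iff)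
  qed
  have e2: "r1 * r2 + r1 * r3 + r1 * r4 + r2 * r3 + r2 * r4 + r3 * r4 = 0"
  proof -
    have "complex_of_real (r1 * r2 + r1 * r3 + r1 * r4 + r2 * r3 + r2 * r4 + r3 * r4) = of_real 0"
      using eqs(3) by (simp add: r)
    thus ?thesis by (simp only: of_real_eq_iff)
  qed
  have e3: "r1 * r2 * r3 + r1 * r2 * r4 + r1 * r3 * r4 + r2 * r3 * r4 = 2 * q"
  proof -
    have "complex_of_real (r1 * r2 * r3 + r1 * r2 * r4 + r1 * r3 * r4 + r2 * r3 * r4) = of_real (2 * q)"
      using eqs(4) by (simp add: r cq)
    thus ?thesis by (simp only: of_real_eq_iff)
  qed
  have q0: "q \<noteq> 0" using assms(1) cq by auto
  hence nz: "r1 \<noteq> 0" "r2 \<noteq> 0" "r3 \<noteq> 0" "r4 \<noteq> 0" by (auto simp: q_def)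
  have s1: "r1\<^sup>2 + r2\<^sup>2 + r3\<^sup>2 + r4\<^sup>2 = 4"
  proof -
    have "r1\<^sup>2 + r2\<^sup>2 + r3\<^sup>2 + r4\<^sup>2 = (r1 + r2 + r3 + r4)\<^sup>2 - 2 * (r1 * r2 + r1 * r3 + r1 * r4 + r2 * r3 + r2 * r4 + r3 * r4)"
      by (simp add: power2_eq_square algebra_simps)
    thus ?thesis by (simp add: e1 e2)
  qed
  have f1: "1 / r1 + 1 / r2 + 1 / r3 + 1 / r4 = 2"
  proof -
    have "1 / r1 + 1 / r2 + 1 / r3 + 1 / r4 = (r1 * r2 * r3 + r1 * r2 * r4 + r1 * r3 * r4 + r2 * r3 * r4) / q"
      using nz by (simp add: q_def field_simps)
    thus ?thesis using q0 by (simp add: e3)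
  qed
  have f2: "1 / r1 * (1 / r2) + 1 / r1 * (1 / r3) + 1 / r1 * (1 / r4) + 1 / r2 * (1 / r3) + 1 / r2 * (1 / r4) + 1 / r3 * (1 / r4) = 0"
  proof -
    have "1 / r1 * (1 / r2) + 1 / r1 * (1 / r3) + 1 / r1 * (1 / r4) + 1 / r2 * (1 / r3) + 1 / r2 * (1 / r4) + 1 / r3 * (1 / r4)
      = (r1 * r2 + r1 * r3 + r1 * r4 + r2 * r3 + r2 * r4 + r3 * r4) / q"
      using nz by (simp add: q_def field_simps)
    thus ?thesis by (simp add: e2)
  qed
  have s2: "(1 / r1)\<^sup>2 + (1 / r2)\<^sup>2 + (1 / r3)\<^sup>2 + (1 / r4)\<^sup>2 = 4"
  proof -
    have "p1\<^sup>2 + p2\<^sup>2 + p3\<^sup>2 + p4\<^sup>2 = (p1 + p2 + p3 + p4)\<^sup>2 - 2 * (p1 * p2 + p1 * p3 + p1 * p4 + p2 * p3 + p2 * p4 + p3 * p4)"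
      for p1 p2 p3 p4 :: real by (simp add: power2_eq_square algebra_simps)
    from this[of "1 / r1" "1 / r2" "1 / r3" "1 / r4"] show ?thesis unfolding f1 f2 by simp
  qed
  have sq: "(r - 1 / r)\<^sup>2 = r\<^sup>2 + (1 / r)\<^sup>2 - 2" if "r \<noteq> 0" for r :: real
    using that by (simp add: power2_diff)
  have "(r1 - 1 / r1)\<^sup>2 + ((r2 - 1 / r2)\<^sup>2 + ((r3 - 1 / r3)\<^sup>2 + (r4 - 1 / r4)\<^sup>2)) = 0"
    unfolding sq[OF nz(1)] sq[OF nz(2)] sq[OF nz(3)] sq[OF nz(4)] using s1 s2 by simp
  hence "(r1 - 1 / r1)\<^sup>2 = 0"
    by (simp add: add_nonneg_eq_0_iff del: power_eq_0_iff)
  hence "r1 = 1 / r1" by simp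
  hence "r1 * r1 = 1" using nz(1) by (simp add: field_simps)
  hence "r1 = 1 \<or> r1 = -1" by (simp add: square_eq_1_iff)
  moreover have "poly p x1 = 0" by (simp add: pr)
  ultimately have "poly p 1 = 0 \<or> poly p (-1) = 0" using r(1) by auto
  thus False using assms(2) unfolding pv by (auto simp: power3_eq_cube algebra_simps)
qed

section \<open>The limit function\<close>

text \<open>Cauchy's inequality on discs of radius \<open>r\<close> bounds the derivative by
  \<open>M / r\<close>. The lemma is applied to the difference between a composition and the
  identity.\<close>

lemma perturb_lipschitz:
  assumes g: "g holomorphic_on U" "open U" "\<And>w. w \<in> U \<Longrightarrow> cmod (g w) \<le> M" and r: "0 < r"
    and sub: "cball y (R + r) \<subseteq> U" and z: "z \<in> cball y R" "z' \<in> cball y R"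
  shows "cmod (g z - g z') \<le> M / r * cmod (z - z')"
proof (rule field_differentiable_bound[of "cball y R" g "deriv g"])
  show "convex (cball y R)" by simp
  fix w assume w: "w \<in> cball y R"
  have cw: "cball w r \<subseteq> U"
  proof
    fix x assume "x \<in> cball w r"
    hence "dist y x \<le> R + r" using w dist_triangle[of y x w] by simp
    thus "x \<in> U" using sub by auto
  qed
  have wU: "w \<in> U" using cw r by auto
  show "(g has_field_derivative deriv g w) (at w within cball y R)"
    using holomorphic_derivI[OF g(1,2) wU] has_field_derivative_at_within by blast
  have "cmod ((deriv ^^ 1) g w) \<le> fact 1 * M / r ^ 1"
  proof (rule Cauchy_inequality)
    show "g holomorphic_on ball w r" using g(1) cw ball_subset_cball holomorphic_on_subset by blast
    show "continuous_on (cball w r) g"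
      using holomorphic_on_imp_continuous_on[OF g(1)] cw continuous_on_subset by blast
    show "cmod (g x) \<le> M" if "cmod (w - x) = r" for x
    proof -
      have "x \<in> cball w r" using that by (simp add: dist_norm)
      thus ?thesis using g(3) cw by blast
    qed
  qed (rule r)
  thus "cmod (deriv g w) \<le> M / r" by simp
qed (use z in auto)

text \<open>\<open>B 0\<close> is the outermost block and \<open>S n\<close> is the vertex set of
  the first n blocks. The factor 100 places later blocks far below the vertices that block n creates
  between \<open>\<alpha> n\<close> and \<open>\<rho> n\<close>. The last two parameters of
  \<open>is_block\<close> make the mass grow while the regions over which it is required exhaust the
  nonreal points.\<close>

locale block_sequence =
  fixes S :: "nat \<Rightarrow> complex set" and \<rho> \<alpha> :: "nat \<Rightarrow> real"
    and B :: "nat \<Rightarrow> complex \<Rightarrow> complex" and P :: "nat \<Rightarrow> complex set"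
  assumes S_0: "S 0 = R0_vert" and S_fin: "finite (S n)" and S_real: "S n \<subseteq> \<real>"
    and \<alpha>_pos: "0 < \<alpha> n" and \<alpha>_less: "\<alpha> n < \<rho> n" and \<rho>_Suc: "\<rho> (Suc n) \<le> \<alpha> n / 100"
    and \<rho>_0: "\<rho> 0 \<le> 1"
    and block: "is_block (S n) (\<alpha> n) (\<rho> n) (real n) (real n + 1) (B n) (P n)"
    and S_Suc: "S (Suc n) = P n \<union> {y. y \<notin> P n \<and> B n y \<in> S n}"
begin

lemma P_fin: "finite (P n)" and B_hol: "B n holomorphic_on - P n"
  and B_cnj: "B n (cnj y) = cnj (B n y)"
  and B_near: "cmod y \<ge> 5 * \<rho> n \<Longrightarrow> y \<notin> P n" "cmod y \<ge> 5 * \<rho> n \<Longrightarrow> cmod (B n y - y) \<le> \<rho> n"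
  using block[of n] unfolding is_block_def by blast+

lemma B_principal: "Im z \<noteq> 0 \<Longrightarrow> \<exists>y. y \<notin> P n \<and> B n y = z \<and> Im y * Im z > 0 \<and> \<bar>Im y\<bar> \<ge> \<bar>Im z\<bar>"
  using block[of n] unfolding is_block_def by blast

lemma B_mass: "\<bar>Im z\<bar> \<ge> 1 / (real n + 1) \<Longrightarrow> cmod z \<le> real n + 1 \<Longrightarrow> \<sigma> = 1 \<or> \<sigma> = -1 \<Longrightarrow>
    \<exists>Y. finite Y \<and> (\<forall>y\<in>Y. y \<notin> P n \<and> B n y = z \<and> \<sigma> * Im y > 0) \<and> (\<Sum>y\<in>Y. \<bar>Im y\<bar>) \<ge> real n"
  using block[of n] unfolding is_block_def by blast

lemma B_vertex: "of_real v \<in> S n \<Longrightarrow> \<exists>x. \<alpha> n \<le> x \<and> x < \<rho> n \<and> of_real x \<notin> P n \<and> B n (of_real x) = of_real v"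
  using block[of n] unfolding is_block_def by blast

lemma \<rho>_pos: "0 < \<rho> n"
  using \<alpha>_pos[of n] \<alpha>_less[of n] by linarith

lemma \<rho>_dec: "100 * \<rho> (Suc n) \<le> \<rho> n"
  using \<rho>_Suc[of n] \<alpha>_less[of n] by simp

lemma \<rho>_mono: "\<rho> (m + k) \<le> \<rho> m"
proof (induction k)
  case (Suc k)
  have "\<rho> (Suc (m + k)) \<le> \<rho> (m + k)" using \<rho>_dec[of "m + k"] \<rho>_pos[of "Suc (m + k)"] by linarith
  thus ?case using Suc by simp
qed simp

lemma \<rho>_le: "\<rho> n \<le> (1 / 2) ^ n"
proof (induction n)
  case (Suc n)
  have "2 * \<rho> (Suc n) \<le> \<rho> n" using \<rho>_dec[of n] \<rho>_pos[of "Suc n"] by linarith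
  thus ?case using Suc by simp
qed (use \<rho>_0 in simp)

lemma \<rho>_tendsto: "\<rho> \<longlonglongrightarrow> 0"
proof (rule tendsto_sandwich[OF _ _ tendsto_const])
  show "(\<lambda>n. (1 / 2 :: real) ^ n) \<longlonglongrightarrow> 0" by (intro LIMSEQ_realpow_zero) auto
qed (auto intro!: always_eventually less_imp_le[OF \<rho>_pos] \<rho>_le simp del: power_one_over)

text \<open>A bound for the displacement by the blocks from \<open>m\<close> to
  \<open>m + k - 1\<close> away from 0. As the radii decay by the factor 100, it stays below
  \<open>2 * \<rho> m\<close>.\<close>

definition s :: "nat \<Rightarrow> nat \<Rightarrow> real" where
  "s m k = (\<Sum>j<k. \<rho> (m + j))"

lemma s_bound: "s m k + 2 * \<rho> (m + k) \<le> 2 * \<rho> m"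
proof (induction k)
  case (Suc k)
  have "2 * \<rho> (Suc (m + k)) \<le> \<rho> (m + k)" using \<rho>_dec[of "m + k"] \<rho>_pos[of "Suc (m + k)"] by linarith
  thus ?case using Suc by (simp add: s_def)
qed (simp add: s_def)

lemma s_nonneg: "s m k \<ge> 0" unfolding s_def by (intro sum_nonneg) (use \<rho>_pos in \<open>auto intro: less_imp_le\<close>)

lemma s_le: "s m k \<le> 2 * \<rho> m" using s_bound[of m k] \<rho>_pos[of "m + k"] by linarith

text \<open>A new block is added on the inside. To compare consecutive compositions one has to know
  how the outer one distorts distances, which is the purpose of
  \<open>cmp_lipschitz\<close>.\<close>

fun cmp :: "nat \<Rightarrow> nat \<Rightarrow> complex \<Rightarrow> complex" where
  "cmp m 0 y = y"
| "cmp m (Suc k) y = cmp m k (B (m + k) y)"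

lemma cmp_add: "cmp m (k + j) y = cmp m k (cmp (m + k) j y)"
  by (induction j arbitrary: y) (auto simp: add.assoc)

lemma cmp_cnj: "cmp m k (cnj y) = cnj (cmp m k y)"
  by (induction k arbitrary: y) (auto simp: B_cnj)

lemma far_step:
  assumes "cmod y \<ge> 5 * \<rho> m + s m (Suc k)"
  shows "y \<notin> P (m + k)" "cmod (B (m + k) y - y) \<le> \<rho> (m + k)" "cmod (B (m + k) y) \<ge> cmod y - \<rho> (m + k)"
proof -
  have "cmod y \<ge> 5 * \<rho> (m + k)" using assms \<rho>_mono[of m k] s_nonneg[of m "Suc k"] by linarith
  thus "y \<notin> P (m + k)" "cmod (B (m + k) y - y) \<le> \<rho> (m + k)" by (rule B_near)+
  thus "cmod (B (m + k) y) \<ge> cmod y - \<rho> (m + k)"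
    using norm_triangle_ineq2[of y "B (m + k) y"] by (simp add: norm_minus_commute)
qed

lemma cmp_near: "cmod y \<ge> 5 * \<rho> m + s m k \<Longrightarrow> cmod (cmp m k y - y) \<le> s m k"
proof (induction k arbitrary: y)
  case (Suc k)
  note f = far_step[OF Suc.prems]
  have "cmod (B (m + k) y) \<ge> 5 * \<rho> m + s m k" using f(3) Suc.prems by (simp add: s_def)
  from Suc.IH[OF this] have "cmod (cmp m k (B (m + k) y) - B (m + k) y) \<le> s m k" .
  hence "cmod ((cmp m k (B (m + k) y) - B (m + k) y) + (B (m + k) y - y)) \<le> s m k + \<rho> (m + k)"
    using f(2) by (intro norm_triangle_le) linarith
  thus ?case by (simp add: s_def)
qed (simp add: s_def)

lemma cmp_hol: "cmp m k holomorphic_on {y. cmod y > 5 * \<rho> m + s m k}"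
proof (induction k)
  case (Suc k)
  have "B (m + k) holomorphic_on {y. cmod y > 5 * \<rho> m + s m (Suc k)}"
    by (rule holomorphic_on_subset[OF B_hol]) (use far_step(1) in \<open>auto intro: less_imp_le\<close>)
  moreover have "B (m + k) ` {y. cmod y > 5 * \<rho> m + s m (Suc k)} \<subseteq> {y. cmod y > 5 * \<rho> m + s m k}"
  proof
    fix w assume "w \<in> B (m + k) ` {y. cmod y > 5 * \<rho> m + s m (Suc k)}"
    then obtain y where y: "w = B (m + k) y" "cmod y > 5 * \<rho> m + s m (Suc k)" by blast
    have "cmod (B (m + k) y) \<ge> cmod y - \<rho> (m + k)" by (rule far_step(3)) (use y(2) in simp)
    thus "w \<in> {y. cmod y > 5 * \<rho> m + s m k}" using y by (simp add: s_def)
  qed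
  ultimately have hol: "cmp m k \<circ> B (m + k) holomorphic_on {y. cmod y > 5 * \<rho> m + s m (Suc k)}"
    by (rule holomorphic_on_compose_gen[OF _ Suc])
  have eq: "cmp m (Suc k) = cmp m k \<circ> B (m + k)" by (simp add: fun_eq_iff)
  show ?case unfolding eq by (rule hol)
qed (simp add: holomorphic_on_ident)

text \<open>Three values of \<open>c\<close> recur: with 7 finite compositions are near the
  identity; about points for 11, discs of radius \<open>3 * \<rho> m\<close> stay in the set for 7;
  about points for 30, discs of radius \<open>16 * \<rho> m\<close> stay in the set for 11. The
  margins are for Cauchy estimates.\<close>

definition far :: "real \<Rightarrow> nat \<Rightarrow> complex set" where
  "far c m = {y. cmod y > c * \<rho> m}"

lemma open_far: "open (far c m)"
  unfolding far_def by (intro open_Collect_less continuous_intros)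

lemma cmp_far: "cmp m k holomorphic_on far 7 m" "y \<in> far 7 m \<Longrightarrow> cmod (cmp m k y - y) \<le> 2 * \<rho> m"
proof -
  have "cmod y > 5 * \<rho> m + s m k" if "y \<in> far 7 m" for y
    using that s_le[of m k] by (simp add: far_def)
  thus "cmp m k holomorphic_on far 7 m" using holomorphic_on_subset[OF cmp_hol] by blast
  assume "y \<in> far 7 m"
  hence "cmod y \<ge> 5 * \<rho> m + s m k" using s_le[of m k] by (simp add: far_def)
  from cmp_near[OF this] show "cmod (cmp m k y - y) \<le> 2 * \<rho> m" using s_le[of m k] by linarith
qed

lemma cball_far:
  assumes "y \<in> far c m" "t \<le> (c - c') * \<rho> m"
  shows "cball y t \<subseteq> far c' m"
proof
  fix x assume "x \<in> cball y t"
  hence "cmod (y - x) \<le> (c - c') * \<rho> m" using assms(2) by (simp add: dist_norm)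
  hence "cmod (y - x) \<le> c * \<rho> m - c' * \<rho> m" by (simp add: left_diff_distrib)
  moreover have "cmod y - cmod x \<le> cmod (y - x)" by (rule norm_triangle_ineq2)
  ultimately show "x \<in> far c' m" using assms(1) by (simp add: far_def)
qed

text \<open>The perturbation of the identity is at most \<open>2 * \<rho> m\<close>, and a Cauchy
  estimate with radius \<open>2 * \<rho> m\<close> makes it 1-Lipschitz, uniformly in
  \<open>k\<close>.\<close>

lemma cmp_lipschitz:
  assumes "y \<in> far 11 m" "z \<in> cball y (\<rho> m)"
  shows "cmod (cmp m k z - cmp m k y) \<le> 2 * cmod (z - y)"
proof -
  define g where "g = (\<lambda>y. cmp m k y - y)"
  have "cmod (g z - g y) \<le> 2 * \<rho> m / (2 * \<rho> m) * cmod (z - y)"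
  proof (rule perturb_lipschitz[of g "far 7 m" _ _ y "\<rho> m"])
    show "g holomorphic_on far 7 m" unfolding g_def by (intro holomorphic_intros cmp_far(1))
    show "cball y (\<rho> m + 2 * \<rho> m) \<subseteq> far 7 m" by (rule cball_far[OF assms(1)]) (use \<rho>_pos[of m] in simp)
  qed (use open_far cmp_far(2) \<rho>_pos[of m] assms(2) in \<open>auto simp: g_def\<close>)
  hence "cmod (g z - g y) \<le> cmod (z - y)" using \<rho>_pos[of m] by simp
  hence "cmod ((g z - g y) + (z - y)) \<le> cmod (z - y) + cmod (z - y)" by (intro norm_triangle_le) simp
  thus ?thesis by (simp add: g_def)
qed

lemma cmp_step:
  assumes "y \<in> far 11 m"
  shows "cmod (cmp m (Suc k) y - cmp m k y) \<le> 2 * \<rho> (m + k)"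
proof -
  have "cmod y \<ge> 5 * \<rho> (m + k)" using assms \<rho>_mono[of m k] \<rho>_pos[of m] by (simp add: far_def)
  hence b: "cmod (B (m + k) y - y) \<le> \<rho> (m + k)" by (rule B_near)
  hence "B (m + k) y \<in> cball y (\<rho> m)" using \<rho>_mono[of m k] by (simp add: dist_norm norm_minus_commute)
  from cmp_lipschitz[OF assms this, of k] b show ?thesis by simp
qed

lemma cmp_cauchy:
  assumes "y \<in> far 11 m"
  shows "cmod (cmp m (k + j) y - cmp m k y) \<le> 4 * \<rho> (m + k) - 4 * \<rho> (m + k + j)"
proof (induction j)
  case (Suc j)
  have "cmod ((cmp m (Suc (k + j)) y - cmp m (k + j) y) + (cmp m (k + j) y - cmp m k y))
      \<le> 2 * \<rho> (m + k + j) + (4 * \<rho> (m + k) - 4 * \<rho> (m + k + j))"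
    using Suc cmp_step[OF assms, of "k + j"] by (intro norm_triangle_le add_mono) (simp_all add: add.assoc)
  moreover have "4 * \<rho> (m + k + Suc j) \<le> 2 * \<rho> (m + k + j)"
    using \<rho>_dec[of "m + k + j"] \<rho>_pos[of "m + k + j"] \<rho>_pos[of "Suc (m + k + j)"] by (simp del: cmp.simps)
  ultimately show ?case by (simp del: cmp.simps)
qed simp

definition L :: "nat \<Rightarrow> complex \<Rightarrow> complex" where
  "L m y = lim (\<lambda>k. cmp m k y)"

lemma cmp_bound: "y \<in> far 11 m \<Longrightarrow> cmod (cmp m (k + j) y - cmp m k y) \<le> 4 * \<rho> (m + k)"
  using cmp_cauchy[of y m k j] \<rho>_pos[of "m + k + j"] by linarith

lemma cmp_tendsto:
  assumes "y \<in> far 11 m"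
  shows "(\<lambda>k. cmp m k y) \<longlonglongrightarrow> L m y"
proof -
  have "Cauchy (\<lambda>k. cmp m k y)"
  proof (rule CauchyI)
    fix e :: real assume e: "e > 0"
    have "eventually (\<lambda>k. \<rho> k < e / 8) sequentially" using \<rho>_tendsto e by (intro order_tendstoD) auto
    then obtain K where K: "\<And>k. k \<ge> K \<Longrightarrow> \<rho> k < e / 8" by (auto simp: eventually_sequentially)
    have b: "cmod (cmp m i y - cmp m K y) < e / 2" if "i \<ge> K" for i
    proof -
      have "cmod (cmp m (K + (i - K)) y - cmp m K y) \<le> 4 * \<rho> (m + K)" by (rule cmp_bound[OF assms])
      thus ?thesis using that K[of "m + K"] by simp
    qed
    have "cmod (cmp m i y - cmp m j y) < e" if "i \<ge> K" "j \<ge> K" for i j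
    proof -
      have "cmod ((cmp m i y - cmp m K y) - (cmp m j y - cmp m K y)) \<le> cmod (cmp m i y - cmp m K y) + cmod (cmp m j y - cmp m K y)"
        by (rule norm_triangle_ineq4)
      moreover have "x < e" if "x \<le> p + q" "p < e / 2" "q < e / 2" for x p q using that by simp
      ultimately show ?thesis using b[OF that(1)] b[OF that(2)] by (simp del: cmp.simps)
    qed
    thus "\<exists>K. \<forall>i\<ge>K. \<forall>j\<ge>K. cmod (cmp m i y - cmp m j y) < e" by blast
  qed
  thus ?thesis unfolding L_def using Cauchy_convergent_iff convergent_LIMSEQ_iff by blast
qed

lemma L_bound:
  assumes "y \<in> far 11 m"
  shows "cmod (L m y - cmp m k y) \<le> 4 * \<rho> (m + k)"
proof (rule tendsto_upperbound)
  have "(\<lambda>j. cmp m (j + k) y) \<longlonglongrightarrow> L m y" using cmp_tendsto[OF assms] by (rule LIMSEQ_ignore_initial_segment)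
  thus "(\<lambda>j. cmod (cmp m (j + k) y - cmp m k y)) \<longlonglongrightarrow> cmod (L m y - cmp m k y)" by (intro tendsto_intros)
  show "eventually (\<lambda>j. cmod (cmp m (j + k) y - cmp m k y) \<le> 4 * \<rho> (m + k)) sequentially"
    using cmp_bound[OF assms, of k] by (simp add: add.commute)
qed simp

lemma L_hol: "L m holomorphic_on far 11 m"
proof (rule holomorphic_uniform_sequence[OF open_far])
  show "cmp m k holomorphic_on far 11 m" for k
    by (rule holomorphic_on_subset[OF cmp_far(1)]) (use \<rho>_pos[of m] in \<open>auto simp: far_def\<close>)
  fix y assume "y \<in> far 11 m"
  then obtain d where d: "d > 0" "cball y d \<subseteq> far 11 m" using open_far open_contains_cball by blast
  have "uniform_limit (cball y d) (cmp m) (L m) sequentially"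
  proof (rule uniform_limitI)
    fix e :: real assume "e > 0"
    hence "eventually (\<lambda>k. \<rho> (k + m) < e / 4) sequentially"
      by (intro order_tendstoD[OF LIMSEQ_ignore_initial_segment[OF \<rho>_tendsto]]) auto
    thus "\<forall>\<^sub>F k in sequentially. \<forall>x\<in>cball y d. dist (cmp m k x) (L m x) < e"
    proof eventually_elim
      case (elim k)
      show ?case
      proof
        fix x assume "x \<in> cball y d"
        hence "cmod (L m x - cmp m k x) \<le> 4 * \<rho> (m + k)" using d by (intro L_bound) auto
        thus "dist (cmp m k x) (L m x) < e" using elim by (simp add: dist_norm norm_minus_commute add.commute)
      qed
    qed
  qed
  thus "\<exists>d>0. cball y d \<subseteq> far 11 m \<and> uniform_limit (cball y d) (cmp m) (L m) sequentially"
    using d by blast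
qed

lemma L_near:
  assumes "y \<in> far 11 m"
  shows "cmod (L m y - y) \<le> 2 * \<rho> m"
proof (rule tendsto_upperbound)
  show "(\<lambda>k. cmod (cmp m k y - y)) \<longlonglongrightarrow> cmod (L m y - y)" by (intro tendsto_intros cmp_tendsto assms)
  have "y \<in> far 7 m" using assms \<rho>_pos[of m] by (simp add: far_def)
  thus "eventually (\<lambda>k. cmod (cmp m k y - y) \<le> 2 * \<rho> m) sequentially" using cmp_far(2) by simp
qed simp

lemma far_mono: "c' \<le> c \<Longrightarrow> y \<in> far c m \<Longrightarrow> y \<in> far c' m"
proof -
  assume "c' \<le> c" "y \<in> far c m"
  moreover have "c' * \<rho> m \<le> c * \<rho> m" using \<open>c' \<le> c\<close> \<rho>_pos[of m] by (intro mult_right_mono) auto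
  ultimately show "y \<in> far c' m" unfolding far_def mem_Collect_eq by linarith
qed

lemma far_cnj: "cnj y \<in> far c m \<longleftrightarrow> y \<in> far c m"
  by (simp add: far_def)

lemma L_cnj: "y \<in> far 11 m \<Longrightarrow> L m (cnj y) = cnj (L m y)"
proof -
  assume y: "y \<in> far 11 m"
  have "(\<lambda>k. cnj (cmp m k y)) \<longlonglongrightarrow> cnj (L m y)" by (intro tendsto_cnj cmp_tendsto y)
  hence "(\<lambda>k. cmp m k (cnj y)) \<longlonglongrightarrow> cnj (L m y)" by (simp add: cmp_cnj)
  thus ?thesis using cmp_tendsto[of "cnj y" m] y far_cnj LIMSEQ_unique by blast
qed

text \<open>The Cauchy radius is now four times the bound \<open>2 * \<rho> m\<close> of the
  perturbation. A Lipschitz constant below 1 gives local injectivity of \<open>L m\<close>.\<close>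

lemma L_lipschitz:
  assumes "y \<in> far 30 m" "z \<in> cball y (8 * \<rho> m)" "z' \<in> cball y (8 * \<rho> m)"
  shows "cmod ((L m z - z) - (L m z' - z')) \<le> cmod (z - z') / 4"
proof -
  define g where "g = (\<lambda>y. L m y - y)"
  have "cmod (g z - g z') \<le> 2 * \<rho> m / (8 * \<rho> m) * cmod (z - z')"
  proof (rule perturb_lipschitz[of g "far 11 m" _ _ y "8 * \<rho> m"])
    show "g holomorphic_on far 11 m" unfolding g_def by (intro holomorphic_intros L_hol)
    show "cball y (8 * \<rho> m + 8 * \<rho> m) \<subseteq> far 11 m" by (rule cball_far[OF assms(1)]) (use \<rho>_pos[of m] in simp)
  qed (use open_far L_near \<rho>_pos[of m] assms in \<open>auto simp: g_def\<close>)
  thus ?thesis using \<rho>_pos[of m] by (simp add: g_def)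
qed

lemma L_inj:
  assumes "y \<in> far 30 m" "z \<in> cball y (8 * \<rho> m)" "L m z = L m y"
  shows "z = y"
proof -
  have "y \<in> cball y (8 * \<rho> m)" using \<rho>_pos[of m] by simp
  from L_lipschitz[OF assms(1,2) this] have "cmod (y - z) \<le> cmod (z - y) / 4" using assms(3) by simp
  thus ?thesis by (simp add: norm_minus_commute)
qed

text \<open>Close to the real axis, compare \<open>y\<close> with its conjugate: by symmetry the
  imaginary part of the perturbation is at most a quarter of \<open>\<bar>Im y\<bar>\<close>.
  Further away, the displacement \<open>2 * \<rho> m\<close> is too small to reach the axis.\<close>

lemma L_nonreal:
  assumes y: "y \<in> far 30 m" "Im y \<noteq> 0"
  shows "Im (L m y) \<noteq> 0"
proof (cases "\<bar>Im y\<bar> \<le> 4 * \<rho> m")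
  case True
  define g where "g = L m y - y"
  have y11: "y \<in> far 11 m" using far_mono[of 11 30] y by simp
  have d: "cmod (y - cnj y) = 2 * \<bar>Im y\<bar>"
    by (simp add: complex_diff_cnj norm_mult)
  have "cnj y \<in> cball y (8 * \<rho> m)" using d True by (simp add: dist_norm)
  moreover have "y \<in> cball y (8 * \<rho> m)" using \<rho>_pos[of m] by simp
  ultimately have "cmod ((L m y - y) - (L m (cnj y) - cnj y)) \<le> cmod (y - cnj y) / 4"
    by (intro L_lipschitz[OF y(1)])
  moreover have "(L m y - y) - (L m (cnj y) - cnj y) = g - cnj g" by (simp add: g_def L_cnj[OF y11])
  moreover have "cmod (g - cnj g) = 2 * \<bar>Im g\<bar>" by (simp add: complex_diff_cnj norm_mult)
  ultimately have "2 * \<bar>Im g\<bar> \<le> 2 * \<bar>Im y\<bar> / 4" using d by simp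
  moreover have "Im (L m y) = Im y + Im g" by (simp add: g_def)
  ultimately show ?thesis using y(2) by auto
next
  case False
  have "cmod (L m y - y) \<le> 2 * \<rho> m" using L_near far_mono[of 11 30] y by simp
  hence "\<bar>Im (L m y) - Im y\<bar> \<le> 2 * \<rho> m" using abs_Im_le_cmod[of "L m y - y"] by simp
  show ?thesis
  proof
    assume "Im (L m y) = 0"
    thus False using \<open>\<bar>Im (L m y) - Im y\<bar> \<le> 2 * \<rho> m\<close> False \<rho>_pos[of m] by simp
  qed
qed

lemma cmp0: "cmp 0 m holomorphic_on - S m" "y \<notin> S m \<Longrightarrow> cmp 0 m y \<notin> R0_vert"
proof -
  have "cmp 0 m holomorphic_on - S m \<and> cmp 0 m ` (- S m) \<subseteq> - R0_vert"
  proof (induction m)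
    case 0
    show ?case by (auto simp: S_0 holomorphic_on_ident)
  next
    case (Suc m)
    have sub: "- S (Suc m) \<subseteq> - P m" "B m ` (- S (Suc m)) \<subseteq> - S m" by (auto simp: S_Suc)
    have eq: "cmp 0 (Suc m) = cmp 0 m \<circ> B m" by (simp add: fun_eq_iff)
    have hol: "cmp 0 m \<circ> B m holomorphic_on - S (Suc m)"
      by (rule holomorphic_on_compose_gen[OF holomorphic_on_subset[OF B_hol sub(1)] _ sub(2)]) (use Suc in blast)
    have "cmp 0 m (B m y) \<notin> R0_vert" if "y \<notin> S (Suc m)" for y using that sub(2) Suc by blast
    hence "(cmp 0 m \<circ> B m) ` (- S (Suc m)) \<subseteq> - R0_vert" unfolding o_def by blast
    with hol show ?case unfolding eq by blast
  qed
  thus "cmp 0 m holomorphic_on - S m" "y \<notin> S m \<Longrightarrow> cmp 0 m y \<notin> R0_vert" by blast+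
qed

lemma cmp0_tendsto:
  assumes "y \<in> far 11 m" "isCont (cmp 0 m) (L m y)"
  shows "(\<lambda>k. cmp 0 k y) \<longlonglongrightarrow> cmp 0 m (L m y)"
proof -
  have "(\<lambda>k. cmp 0 m (cmp m k y)) \<longlonglongrightarrow> cmp 0 m (L m y)"
    using isCont_tendsto_compose[OF assms(2) cmp_tendsto[OF assms(1)]] .
  hence "(\<lambda>k. cmp 0 (k + m) y) \<longlonglongrightarrow> cmp 0 m (L m y)"
    using cmp_add[of 0 m _ y] by (simp add: add.commute)
  thus ?thesis by (rule LIMSEQ_offset)
qed

lemma cmp0_isCont: "y \<notin> S m \<Longrightarrow> isCont (cmp 0 m) y"
  using continuous_on_eq_continuous_at[of "- S m" "cmp 0 m"] holomorphic_on_imp_continuous_on[OF cmp0(1)[of m]]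
    finite_imp_closed[OF S_fin[of m]] by (auto simp: open_Compl)

section \<open>Meromorphy of the limit\<close>

definition F0 :: "complex \<Rightarrow> complex" where
  "F0 z = R0 (lim (\<lambda>k. cmp 0 k (1 / z)))"

text \<open>At these points the limit factors through level \<open>m\<close>: the tail is defined at
  \<open>1 / z\<close>, and its value is neither a pole nor a vertex of the first \<open>m\<close>
  blocks. There \<open>F0\<close> is holomorphic and omits 0 and 1.\<close>

definition good :: "nat \<Rightarrow> complex set" where
  "good m = {z. z \<noteq> 0 \<and> 1 / z \<in> far 30 m \<and> L m (1 / z) \<notin> S m}"

lemma F0_good: "z \<in> good m \<Longrightarrow> F0 z = R0 (cmp 0 m (L m (1 / z)))"
  unfolding F0_def using cmp0_tendsto[of "1 / z" m] far_mono[of 11 30 "1 / z" m] cmp0_isCont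
  by (auto simp: good_def intro!: arg_cong[of _ _ R0] limI)

lemma F0_omits: "z \<in> good m \<Longrightarrow> F0 z \<noteq> 0 \<and> F0 z \<noteq> 1"
  using F0_good[of z m] R0_omits cmp0(2)[of "L m (1 / z)" m] by (auto simp: good_def)

definition annulus :: "nat \<Rightarrow> complex set" where
  "annulus m = {z. z \<noteq> 0 \<and> 1 / z \<in> far 30 m}"

lemma open_annulus: "open (annulus m)"
proof -
  have "annulus m = {z. z \<noteq> 0} \<inter> (\<lambda>z. 1 / z) -` far 30 m" by (auto simp: annulus_def)
  moreover have "open ({z. z \<noteq> 0} \<inter> (\<lambda>z::complex. 1 / z) -` far 30 m)"
    by (rule continuous_open_preimage[OF _ _ open_far]) (auto intro!: continuous_intros open_Collect_neq)
  ultimately show ?thesis by simp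
qed

lemma L_inverse_hol: "(\<lambda>z. L m (1 / z)) holomorphic_on annulus m"
proof -
  have "L m \<circ> (\<lambda>z. 1 / z) holomorphic_on annulus m"
    by (rule holomorphic_on_compose_gen[OF _ L_hol[of m]])
       (use far_mono[of 11 30] in \<open>auto simp: annulus_def intro!: holomorphic_intros\<close>)
  thus ?thesis by (simp add: o_def)
qed

lemma open_good: "open (good m)"
proof -
  have "good m = annulus m \<inter> (\<lambda>z. L m (1 / z)) -` (- S m)" by (auto simp: good_def annulus_def)
  moreover have "open (annulus m \<inter> (\<lambda>z. L m (1 / z)) -` (- S m))"
    by (rule continuous_open_preimage[OF holomorphic_on_imp_continuous_on[OF L_inverse_hol] open_annulus])
       (use S_fin finite_imp_closed in auto)
  ultimately show ?thesis by simp
qed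

lemma F0_hol: "F0 holomorphic_on good m"
proof -
  have "(\<lambda>z. L m (1 / z)) holomorphic_on good m"
    by (rule holomorphic_on_subset[OF L_inverse_hol]) (auto simp: good_def annulus_def)
  hence "cmp 0 m \<circ> (\<lambda>z. L m (1 / z)) holomorphic_on good m"
    by (rule holomorphic_on_compose_gen[OF _ cmp0(1)]) (auto simp: good_def)
  hence "R0 \<circ> (cmp 0 m \<circ> (\<lambda>z. L m (1 / z))) holomorphic_on good m"
    by (rule holomorphic_on_compose_gen[OF _ R0_holomorphic])
       (use cmp0(2) in \<open>force simp: good_def R0_vert_def\<close>)
  thus ?thesis by (rule holomorphic_transform) (simp add: F0_good)
qed

lemma exists_level: "e > 0 \<Longrightarrow> \<exists>m. \<rho> m < e"
  using order_tendstoD(2)[OF \<rho>_tendsto, of e] by (auto simp: eventually_sequentially)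

text \<open>The tail is injective near \<open>1 / z0\<close>, so it meets the finite set
  \<open>S m\<close> only at isolated points.\<close>

lemma eventually_good_level:
  assumes "z0 \<noteq> 0" "1 / z0 \<in> far 30 m"
  shows "eventually (\<lambda>z. z \<in> good m) (at z0)"
proof -
  define y0 where "y0 = 1 / z0"
  have y0f: "y0 \<in> far 30 m" using assms(2) by (simp add: y0_def)
  have "y0 \<in> far 11 m" by (rule far_mono[OF _ y0f]) simp
  hence cont: "isCont (L m) y0"
    using continuous_on_eq_continuous_at[OF open_far[of 11 m], of "L m"] holomorphic_on_imp_continuous_on[OF L_hol[of m]] by blast
  have "eventually (\<lambda>y. L m y \<noteq> L m y0) (at y0)"
    unfolding eventually_at
  proof (intro exI[of _ "8 * \<rho> m"] conjI ballI impI)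
    fix y assume "y \<noteq> y0 \<and> dist y y0 < 8 * \<rho> m"
    thus "L m y \<noteq> L m y0" using L_inj[OF y0f, of y] by (auto simp: dist_commute)
  qed (use \<rho>_pos[of m] in auto)
  moreover have "eventually (\<lambda>y. L m y \<in> - (S m - {L m y0})) (at y0)"
    by (rule topological_tendstoD[OF isContD[OF cont] open_Compl[OF finite_imp_closed]])
       (use S_fin in simp_all)
  moreover have "eventually (\<lambda>y. y \<in> far 30 m) (at y0)"
    using eventually_at_topological open_far y0f by blast
  ultimately have ev: "eventually (\<lambda>y. y \<in> far 30 m \<and> L m y \<notin> S m) (at y0)"
    by eventually_elim auto
  have "filterlim (\<lambda>z. 1 / z) (at y0) (at z0)"
    unfolding filterlim_at
  proof
    show "((\<lambda>z. 1 / z) \<longlongrightarrow> y0) (at z0)" unfolding y0_def by (intro tendsto_intros assms(1))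
    have "eventually (\<lambda>z. z \<noteq> 0) (at z0)" by (rule eventually_neq_at_within)
    thus "eventually (\<lambda>z. 1 / z \<in> UNIV \<and> 1 / z \<noteq> y0) (at z0)"
      using eventually_neq_at_within[of z0 z0 UNIV] by eventually_elim (auto simp: y0_def)
  qed
  hence "eventually (\<lambda>z. 1 / z \<in> far 30 m \<and> L m (1 / z) \<notin> S m) (at z0)"
    using ev by (rule filterlim_iff[THEN iffD1, rule_format])
  moreover have "eventually (\<lambda>z. z \<noteq> 0) (at z0)" by (rule eventually_neq_at_within)
  ultimately show ?thesis by eventually_elim (auto simp: good_def)
qed

lemma eventually_good: "\<exists>m. eventually (\<lambda>z. z \<in> good m) (at z0)"
proof (cases "z0 = 0")
  case True
  \<comment> \<open>For \<open>1 / z\<close> of modulus above this bound, the displacement by the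
    whole limit still leaves a value larger than every vertex in \<open>S 0\<close>.\<close>
  define K where "K = 40 * \<rho> 0 + (\<Sum>s\<in>S 0. cmod s)"
  have K: "K > 0" using \<rho>_pos[of 0] by (simp add: K_def add_pos_nonneg sum_nonneg)
  have "z \<in> good 0" if z: "z \<noteq> 0" "dist z 0 < 1 / K" for z
  proof -
    have "cmod (1 / z) > K" using z K by (simp add: norm_divide field_simps)
    hence b: "cmod (1 / z) > 40 * \<rho> 0 + (\<Sum>s\<in>S 0. cmod s)" by (simp add: K_def)
    have s0: "(\<Sum>s\<in>S 0. cmod s) \<ge> 0" by (intro sum_nonneg) auto
    hence f: "1 / z \<in> far 30 0" using b \<rho>_pos[of 0] unfolding far_def mem_Collect_eq by linarith
    have "L 0 (1 / z) \<notin> S 0"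
    proof
      assume "L 0 (1 / z) \<in> S 0"
      hence "cmod (L 0 (1 / z)) \<le> (\<Sum>s\<in>S 0. cmod s)" using S_fin by (intro member_le_sum) auto
      moreover have "cmod (L 0 (1 / z) - 1 / z) \<le> 2 * \<rho> 0" by (rule L_near) (use far_mono[of 11 30] f in simp)
      moreover have "cmod (1 / z) - cmod (L 0 (1 / z)) \<le> cmod (1 / z - L 0 (1 / z))" by (rule norm_triangle_ineq2)
      moreover have "cmod (1 / z - L 0 (1 / z)) = cmod (L 0 (1 / z) - 1 / z)" by (rule norm_minus_commute)
      ultimately show False using b \<rho>_pos[of 0] by linarith
    qed
    thus ?thesis using f z by (simp add: good_def)
  qed
  hence "eventually (\<lambda>z. z \<in> good 0) (at z0)"
    unfolding eventually_at True using K by (intro exI[of _ "1 / K"]) auto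
  thus ?thesis by blast
next
  case False
  hence "cmod (1 / z0) > 0" by simp
  then obtain m where "\<rho> m < cmod (1 / z0) / 40" using exists_level[of "cmod (1 / z0) / 40"] by auto
  hence "1 / z0 \<in> far 30 m" using \<rho>_pos[of m] by (simp add: far_def)
  thus ?thesis using eventually_good_level[OF False] by blast
qed

lemma F0_meromorphic: "F0 meromorphic_on UNIV"
  unfolding meromorphic_on_altdef
proof (intro ballI)
  fix z0 :: complex
  obtain m where "eventually (\<lambda>z. z \<in> good m) (at z0)" using eventually_good by blast
  then obtain r where r: "r > 0" "\<And>z. z \<noteq> z0 \<Longrightarrow> dist z z0 < r \<Longrightarrow> z \<in> good m"
    unfolding eventually_at by auto
  have sub: "ball z0 r - {z0} \<subseteq> good m"
  proof
    fix z assume "z \<in> ball z0 r - {z0}"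
    hence "z \<noteq> z0" "dist z z0 < r" by (simp_all add: dist_commute)
    thus "z \<in> good m" by (rule r(2))
  qed
  have hol: "F0 holomorphic_on ball z0 r - {z0}" by (rule holomorphic_on_subset[OF F0_hol sub])
  have "isolated_singularity_at F0 z0"
    unfolding isolated_singularity_at_def using r(1) hol
    by (intro exI[of _ r]) (auto simp: analytic_on_open open_delete)
  moreover have "not_essential F0 z0"
  proof -
    obtain l where "(F0 \<longlongrightarrow> l) (at z0) \<or> ((inverse \<circ> F0) \<longlongrightarrow> l) (at z0)"
    proof (rule great_Picard[of "ball z0 r" z0 0 1 F0])
      show "F0 z \<noteq> 0 \<and> F0 z \<noteq> 1" if "z \<in> ball z0 r - {z0}" for z
        using F0_omits[of z m] sub that by blast
    qed (use r(1) hol in auto)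
    thus ?thesis
    proof
      assume "(F0 \<longlongrightarrow> l) (at z0)"
      thus ?thesis by (auto simp: not_essential_def)
    next
      assume l: "((inverse \<circ> F0) \<longlongrightarrow> l) (at z0)"
      show ?thesis
      proof (cases "l = 0")
        case False
        hence "((\<lambda>z. inverse ((inverse \<circ> F0) z)) \<longlongrightarrow> inverse l) (at z0)" using l by (intro tendsto_inverse)
        thus ?thesis by (auto simp: not_essential_def)
      next
        case True
        have "eventually (\<lambda>z. F0 z \<noteq> 0) (at z0)"
          unfolding eventually_at using r F0_omits by (intro exI[of _ r]) auto
        hence "eventually (\<lambda>z. (inverse \<circ> F0) z \<noteq> 0) (at z0)" by eventually_elim auto
        hence "filterlim (inverse \<circ> F0) (at 0) (at z0)" using l True by (simp add: filterlim_at)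
        hence "filterlim (\<lambda>z. inverse ((inverse \<circ> F0) z)) at_infinity (at z0)"
          using filterlim_compose[OF filterlim_inverse_at_infinity] by blast
        hence "is_pole F0 z0" by (simp add: is_pole_def)
        thus ?thesis by (simp add: not_essential_def)
      qed
    qed
  qed
  ultimately show "isolated_singularity_at F0 z0 \<and> not_essential F0 z0" by blast
qed

end

section \<open>Points over given values\<close>

context block_sequence
begin

text \<open>At exceptional points \<open>F0\<close> may carry dummy values. Here they are replaced
  by the limits, and by 0 at poles.\<close>

definition F :: "complex \<Rightarrow> complex" where
  "F = remove_sings F0"

lemma F_nice: "F nicely_meromorphic_on UNIV"
  unfolding F_def by (rule remove_sings_nicely_meromorphic[OF F0_meromorphic])

lemma is_pole_F: "is_pole F z \<longleftrightarrow> is_pole F0 z"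
  unfolding F_def using F0_meromorphic
  by (intro is_pole_remove_sings_iff) (auto simp: meromorphic_on_altdef)

lemma nonreal_good:
  assumes "Im z \<noteq> 0"
  shows "\<exists>m. z \<in> good m"
proof -
  have z: "z \<noteq> 0" using assms by auto
  hence "cmod (1 / z) > 0" by simp
  then obtain m where "\<rho> m < cmod (1 / z) / 40" using exists_level[of "cmod (1 / z) / 40"] by auto
  hence f: "1 / z \<in> far 30 m" using \<rho>_pos[of m] by (simp add: far_def)
  have "Im (1 / z) \<noteq> 0" using assms by (simp add: Im_divide sum_power2_eq_zero_iff)
  hence "Im (L m (1 / z)) \<noteq> 0" by (rule L_nonreal[OF f])
  hence "L m (1 / z) \<notin> S m" using S_real[of m] by (auto simp: complex_is_Real_iff)
  thus ?thesis using z f by (auto simp: good_def)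
qed

lemma F_at_good:
  assumes "z \<in> good m"
  shows "F z = F0 z" "\<not> is_pole F z"
proof -
  have an: "F0 analytic_on {z}"
    using holomorphic_on_imp_analytic_at[OF F0_hol open_good assms] .
  show "F z = F0 z" unfolding F_def by (rule remove_sings_at_analytic[OF an])
  show "\<not> is_pole F z" unfolding is_pole_F using an analytic_at_imp_no_pole by blast
qed

lemma good_cnj:
  assumes "z \<in> good m"
  shows "cnj z \<in> good m" "F0 (cnj z) = cnj (F0 z)"
proof -
  have z: "z \<noteq> 0" "1 / z \<in> far 30 m" "L m (1 / z) \<notin> S m" using assms by (auto simp: good_def)
  have c: "1 / cnj z = cnj (1 / z)" by simp
  have f: "1 / cnj z \<in> far 30 m" unfolding c far_cnj by (rule z(2))
  have l: "L m (1 / cnj z) = cnj (L m (1 / z))" unfolding c by (rule L_cnj[OF far_mono[OF _ z(2)]]) simp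
  have "cnj (L m (1 / z)) \<notin> S m"
  proof
    assume a: "cnj (L m (1 / z)) \<in> S m"
    hence "cnj (L m (1 / z)) \<in> \<real>" using S_real by blast
    hence "cnj (L m (1 / z)) = L m (1 / z)" by (simp add: complex_is_Real_iff complex_eq_iff)
    thus False using a z(3) by simp
  qed
  thus g: "cnj z \<in> good m" using z f l by (simp add: good_def)
  show "F0 (cnj z) = cnj (F0 z)"
    unfolding F0_good[OF g] F0_good[OF assms] l cmp_cnj R0_cnj ..
qed

lemma F0_lim_cnj:
  assumes "F0 \<midarrow>z0\<rightarrow> c"
  shows "F0 \<midarrow>cnj z0\<rightarrow> cnj c"
proof -
  have "filterlim cnj (at z0) (at (cnj z0))"
    unfolding filterlim_at
  proof
    show "(cnj \<longlongrightarrow> z0) (at (cnj z0))" by (rule tendsto_eq_intros refl | simp)+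
    have "eventually (\<lambda>x. x \<noteq> cnj z0) (at (cnj z0))" by (simp add: eventually_at_filter)
    thus "\<forall>\<^sub>F x in at (cnj z0). cnj x \<in> UNIV \<and> cnj x \<noteq> z0"
      by eventually_elim (metis UNIV_I complex_cnj_cnj)
  qed
  hence "((\<lambda>z. cnj (F0 (cnj z))) \<longlongrightarrow> cnj c) (at (cnj z0))"
    by (intro tendsto_cnj filterlim_compose[OF assms])
  moreover obtain m where "eventually (\<lambda>z. z \<in> good m) (at (cnj z0))" using eventually_good by blast
  hence "eventually (\<lambda>z. cnj (F0 (cnj z)) = F0 z) (at (cnj z0))"
    by eventually_elim (simp add: good_cnj)
  ultimately show ?thesis by (rule Lim_transform_eventually)
qed

lemma F_cnj: "F (cnj z) = cnj (F z)"
proof (cases "\<exists>c. F0 \<midarrow>z\<rightarrow> c")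
  case True
  then obtain c where c: "F0 \<midarrow>z\<rightarrow> c" by blast
  show ?thesis unfolding F_def remove_sings_eqI[OF c] remove_sings_eqI[OF F0_lim_cnj[OF c]] ..
next
  case False
  hence "\<not> (\<exists>c. F0 \<midarrow>cnj z\<rightarrow> c)" using F0_lim_cnj[of _ "cnj z"] by auto
  thus ?thesis using False by (simp add: F_def remove_sings_def)
qed

lemma F_nonreal:
  assumes "Im z \<noteq> 0" shows "F z \<noteq> 0" "F z \<noteq> 1" "\<not> is_pole F z"
proof -
  obtain m where "z \<in> good m" using nonreal_good[OF assms] by blast
  thus "F z \<noteq> 0" "F z \<noteq> 1" "\<not> is_pole F z" using F_at_good F0_omits by metis+
qed

text \<open>A vertex is followed inwards through preimages that are not poles, so the composition
  stays analytic at them. By the choice in \<open>is_block\<close> the newest one lies between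
  \<open>\<alpha> n\<close> and \<open>\<rho> n\<close>.\<close>

lemma vertex_chain:
  assumes "of_real v0 \<in> S 0"
  shows "\<exists>v. of_real v \<in> S n \<and> cmp 0 n analytic_on {of_real v} \<and> cmp 0 n (of_real v) = of_real v0"
    "\<exists>x. \<alpha> n \<le> x \<and> x < \<rho> n \<and> cmp 0 (Suc n) analytic_on {of_real x} \<and> cmp 0 (Suc n) (of_real x) = of_real v0"
proof -
  have step: "\<exists>x. \<alpha> n \<le> x \<and> x < \<rho> n \<and> of_real x \<in> S (Suc n) \<and> cmp 0 (Suc n) analytic_on {of_real x} \<and> cmp 0 (Suc n) (of_real x) = of_real v0"
    if v: "of_real v \<in> S n" "cmp 0 n analytic_on {of_real v}" "cmp 0 n (of_real v) = of_real v0" for n v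
  proof -
    obtain x where x: "\<alpha> n \<le> x" "x < \<rho> n" "of_real x \<notin> P n" "B n (of_real x) = of_real v" using B_vertex[OF v(1)] by blast
    have "B n analytic_on {of_real x}"
      by (rule holomorphic_on_imp_analytic_at[OF B_hol]) (use x(3) P_fin in \<open>auto intro: finite_imp_closed\<close>)
    hence "cmp 0 n \<circ> B n analytic_on {of_real x}"
      by (rule analytic_on_compose) (use v(2) x(4) in simp)
    moreover have "cmp 0 (Suc n) = cmp 0 n \<circ> B n" by (simp add: fun_eq_iff)
    ultimately have "cmp 0 (Suc n) analytic_on {of_real x}" by metis
    moreover have "of_real x \<in> S (Suc n)" using x(3,4) v(1) by (simp add: S_Suc)
    ultimately show ?thesis using x v(3) by (intro exI[of _ x]) simp
  qed
  show ex: "\<exists>v. of_real v \<in> S n \<and> cmp 0 n analytic_on {of_real v} \<and> cmp 0 n (of_real v) = of_real v0" for n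
  proof (induction n)
    case 0
    have "cmp 0 0 = (\<lambda>y. y)" by (simp add: fun_eq_iff)
    thus ?case using assms by (intro exI[of _ v0]) (simp add: analytic_on_ident)
  next
    case (Suc n)
    thus ?case using step by blast
  qed
  show "\<exists>x. \<alpha> n \<le> x \<and> x < \<rho> n \<and> cmp 0 (Suc n) analytic_on {of_real x} \<and> cmp 0 (Suc n) (of_real x) = of_real v0"
    using ex[of n] step by blast
qed

text \<open>On the real axis \<open>L m\<close> is real and moves points by at most
  \<open>2 * \<rho> m\<close>; the intermediate value theorem applies on an interval of radius
  \<open>3 * \<rho> m\<close>.\<close>

lemma L_real_solution:
  assumes "x \<ge> 100 * \<rho> m"
  shows "\<exists>y. x - 3 * \<rho> m \<le> y \<and> y \<le> x + 3 * \<rho> m \<and> L m (of_real y) = of_real x"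
proof -
  define lo where "lo = x - 3 * \<rho> m"
  define hi where "hi = x + 3 * \<rho> m"
  have fr: "of_real t \<in> far 11 m" if "t \<in> {lo..hi}" for t
    using that assms \<rho>_pos[of m] by (auto simp: far_def lo_def)
  have re: "L m (of_real t) = of_real (Re (L m (of_real t)))" if "t \<in> {lo..hi}" for t
  proof -
    have "L m (of_real t) = cnj (L m (of_real t))" using L_cnj[OF fr[OF that]] by simp
    thus ?thesis by (simp add: complex_eq_iff)
  qed
  have near: "\<bar>Re (L m (of_real t)) - t\<bar> \<le> 2 * \<rho> m" if "t \<in> {lo..hi}" for t
    using L_near[OF fr[OF that]] abs_Re_le_cmod[of "L m (of_real t) - of_real t"] by simp
  have lh: "lo \<in> {lo..hi}" "hi \<in> {lo..hi}" using \<rho>_pos[of m] by (auto simp: lo_def hi_def)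
  have "continuous_on {lo..hi} (\<lambda>t. L m (of_real t))"
    by (rule continuous_on_compose2[OF holomorphic_on_imp_continuous_on[OF L_hol[of m]]])
       (use fr in \<open>auto intro!: continuous_intros\<close>)
  hence "continuous_on {lo..hi} (\<lambda>t. Re (L m (of_real t)))" by (intro continuous_intros)
  moreover have "Re (L m (of_real lo)) \<le> x" "x \<le> Re (L m (of_real hi))"
    using near[OF lh(1)] near[OF lh(2)] \<rho>_pos[of m] by (simp_all add: lo_def hi_def abs_le_iff)
  moreover have "lo \<le> hi" using lh by simp
  ultimately obtain y where "lo \<le> y" "y \<le> hi" "Re (L m (of_real y)) = x"
    using IVT'[of "\<lambda>t. Re (L m (of_real t))" lo x hi] by blast
  thus ?thesis using re[of y] by (intro exI[of _ y]) (simp add: lo_def hi_def)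
qed

text \<open>The preimage \<open>x\<close> made by block \<open>n\<close> survives in the limit:
  solving \<open>L m y = x\<close> for the tail \<open>m = Suc n\<close> moves it by at most
  \<open>3 * \<rho> m\<close>. As \<open>y\<close> is small, \<open>1 / y\<close> is large, and
  varying \<open>n\<close> gives infinitely many points.\<close>

lemma vertex_points:
  assumes "of_real v0 \<in> S 0"
  shows "\<exists>z m. cmod z \<ge> 1 / (2 * \<rho> n) \<and> ((\<lambda>w. cmp 0 m (L m (1 / w))) \<longlongrightarrow> of_real v0) (at z) \<and>
    eventually (\<lambda>w. w \<in> good m) (at z)"
proof -
  obtain x where x: "\<alpha> n \<le> x" "x < \<rho> n" "cmp 0 (Suc n) analytic_on {of_real x}" "cmp 0 (Suc n) (of_real x) = of_real v0"
    using vertex_chain(2)[OF assms, of n] by blast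
  define m where "m = Suc n"
  have x100: "x \<ge> 100 * \<rho> m" using x(1) \<rho>_Suc[of n] by (simp add: m_def)
  obtain y where y: "x - 3 * \<rho> m \<le> y" "y \<le> x + 3 * \<rho> m" "L m (of_real y) = of_real x"
    using L_real_solution[OF x100] by blast
  have y97: "y \<ge> 97 * \<rho> m" using y(1) x100 by linarith
  have ypos: "y > 0" using y97 \<rho>_pos[of m] by linarith
  have "3 * \<rho> m \<le> \<rho> n" using x100 x(2) \<rho>_pos[of m] by linarith
  hence y2: "y \<le> 2 * \<rho> n" using y(2) x(2) by linarith
  define z where "z = complex_of_real (1 / y)"
  have z: "z \<noteq> 0" "1 / z = of_real y" using ypos by (simp_all add: z_def)
  have fr: "1 / z \<in> far 30 m" using y97 \<rho>_pos[of m] ypos by (simp add: z(2) far_def)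
  have cz: "cmod z = 1 / y" unfolding z_def norm_of_real using ypos by simp
  have "cmod z \<ge> 1 / (2 * \<rho> n)"
    unfolding cz using y2 ypos \<rho>_pos[of n] by (intro divide_left_mono) simp_all
  moreover have "((\<lambda>w. cmp 0 m (L m (1 / w))) \<longlongrightarrow> cmp 0 m (L m (1 / z))) (at z)"
  proof -
    have i1: "isCont (\<lambda>w. L m (1 / w)) z"
    proof -
      have "continuous_on (annulus m) (\<lambda>w. L m (1 / w))"
        by (rule holomorphic_on_imp_continuous_on[OF L_inverse_hol])
      moreover have "z \<in> annulus m" unfolding annulus_def using z(1) fr by blast
      ultimately show ?thesis using continuous_on_eq_continuous_at[OF open_annulus] by blast
    qed
    have i2: "isCont (cmp 0 m) (L m (1 / z))"
      unfolding z(2) y(3) using x(3) unfolding m_def by (rule analytic_at_imp_isCont)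
    show ?thesis by (rule isCont_tendsto_compose[OF i2 isContD[OF i1]])
  qed
  hence "((\<lambda>w. cmp 0 m (L m (1 / w))) \<longlongrightarrow> of_real v0) (at z)"
    unfolding z(2) y(3) using x(4) unfolding m_def[symmetric] by (simp only:)
  ultimately show ?thesis using eventually_good_level[OF z(1) fr] by blast
qed

lemma unbounded_infinite:
  assumes "\<And>n. \<exists>z\<in>A. cmod z \<ge> 1 / (2 * \<rho> n)"
  shows "infinite A"
proof
  assume "finite A"
  then obtain C where C: "C > 0" "\<And>z. z \<in> A \<Longrightarrow> cmod z \<le> C" using finite_imp_bounded bounded_pos by metis
  obtain n where n: "\<rho> n < 1 / (2 * C)" using exists_level[of "1 / (2 * C)"] C(1) by auto
  obtain z where "z \<in> A" "cmod z \<ge> 1 / (2 * \<rho> n)" using assms by blast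
  moreover have "1 / (2 * \<rho> n) > C" using n \<rho>_pos[of n] C(1) by (simp add: field_simps)
  ultimately show False using C(2) by fastforce
qed

lemma vertex_value:
  assumes "of_real v0 \<in> S 0" "of_real v0 \<noteq> (1 / 2 :: complex)"
  shows "infinite {z. F z = R0 (of_real v0) \<and> \<not> is_pole F z}"
proof (rule unbounded_infinite)
  fix n
  obtain z m where z: "cmod z \<ge> 1 / (2 * \<rho> n)" "((\<lambda>w. cmp 0 m (L m (1 / w))) \<longlongrightarrow> of_real v0) (at z)"
    "eventually (\<lambda>w. w \<in> good m) (at z)" using vertex_points[OF assms(1)] by blast
  have "isCont R0 (of_real v0)"
    using continuous_on_eq_continuous_at[of "- {1 / 2}" R0] holomorphic_on_imp_continuous_on[OF R0_holomorphic] assms(2)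
    by (simp add: open_Compl)
  hence "((\<lambda>w. R0 (cmp 0 m (L m (1 / w)))) \<longlongrightarrow> R0 (of_real v0)) (at z)"
    using z(2) by (rule isCont_tendsto_compose)
  moreover have "eventually (\<lambda>w. R0 (cmp 0 m (L m (1 / w))) = F0 w) (at z)"
    using z(3) by eventually_elim (simp add: F0_good)
  ultimately have l: "F0 \<midarrow>z\<rightarrow> R0 (of_real v0)" by (rule Lim_transform_eventually)
  hence "F z = R0 (of_real v0)" unfolding F_def by (rule remove_sings_eqI)
  moreover have "\<not> is_pole F z"
    unfolding is_pole_F unfolding is_pole_def
    using not_tendsto_and_filterlim_at_infinity[OF trivial_limit_at l] by blast
  ultimately show "\<exists>z\<in>{z. F z = R0 (of_real v0) \<and> \<not> is_pole F z}. cmod z \<ge> 1 / (2 * \<rho> n)" using z(1) by blast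
qed

lemma R0_pole: "filterlim R0 at_infinity (at (1 / 2))"
  unfolding R0_def[abs_def]
proof (rule filterlim_divide_at_infinity)
  show "((\<lambda>x::complex. x ^ 3 * (2 - x)) \<longlongrightarrow> (1 / 2) ^ 3 * (2 - 1 / 2)) (at (1 / 2))" by (intro tendsto_intros)
  show "filterlim (\<lambda>x::complex. 2 * x - 1) (at 0) (at (1 / 2))"
    unfolding filterlim_at
  proof
    show "((\<lambda>x::complex. 2 * x - 1) \<longlongrightarrow> 0) (at (1 / 2))" by (rule tendsto_eq_intros refl | simp)+
    have "eventually (\<lambda>x::complex. x \<noteq> 1 / 2) (at (1 / 2))" by (simp add: eventually_at_filter)
    thus "\<forall>\<^sub>F x::complex in at (1 / 2). 2 * x - 1 \<in> UNIV \<and> 2 * x - 1 \<noteq> 0"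
      by eventually_elim (simp add: eq_divide_eq mult.commute)
  qed
qed simp

lemma infinite_poles: "infinite {z. is_pole F z}"
proof (rule unbounded_infinite)
  fix n
  have "of_real (1 / 2) \<in> S 0" by (simp add: S_0 R0_vert_def)
  from vertex_points[OF this, of n] obtain z m where z: "cmod z \<ge> 1 / (2 * \<rho> n)"
    "((\<lambda>w. cmp 0 m (L m (1 / w))) \<longlongrightarrow> 1 / 2) (at z)" "eventually (\<lambda>w. w \<in> good m) (at z)" by auto
  have "eventually (\<lambda>w. cmp 0 m (L m (1 / w)) \<in> UNIV \<and> cmp 0 m (L m (1 / w)) \<noteq> 1 / 2) (at z)"
    using z(3)
  proof eventually_elim
    case (elim w)
    hence "cmp 0 m (L m (1 / w)) \<notin> R0_vert" by (intro cmp0(2)) (simp add: good_def)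
    thus ?case by (auto simp: R0_vert_def)
  qed
  hence "filterlim (\<lambda>w. cmp 0 m (L m (1 / w))) (at (1 / 2)) (at z)" unfolding filterlim_at using z(2) by blast
  from filterlim_compose[OF R0_pole this]
  have "filterlim (\<lambda>w. R0 (cmp 0 m (L m (1 / w)))) at_infinity (at z)" .
  moreover have "eventually (\<lambda>w. R0 (cmp 0 m (L m (1 / w))) = F0 w) (at z)"
    using z(3) by eventually_elim (simp add: F0_good)
  ultimately have "filterlim F0 at_infinity (at z)" by (rule filterlim_cong[OF refl refl, THEN iffD1, rotated])
  hence "is_pole F z" unfolding is_pole_F unfolding is_pole_def .
  thus "\<exists>z\<in>{z. is_pole F z}. cmod z \<ge> 1 / (2 * \<rho> n)" using z(1) by blast
qed

section \<open>Inverse orbits of nonreal points through all blocks\<close>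

definition lifts :: "nat \<Rightarrow> complex \<Rightarrow> (nat \<Rightarrow> complex) \<Rightarrow> bool" where
  "lifts n y0 w \<longleftrightarrow> w 0 = y0 \<and> (\<forall>k. B (n + k) (w (Suc k)) = w k \<and>
     Im (w (Suc k)) * Im (w k) > 0 \<and> \<bar>Im (w (Suc k))\<bar> \<ge> \<bar>Im (w k)\<bar>)"

lemma lifts_exist:
  assumes "Im y0 \<noteq> 0" shows "\<exists>w. lifts n y0 w"
proof -
  have "\<exists>w. \<forall>k. (Im (w k) \<noteq> 0 \<and> (k = 0 \<longrightarrow> w k = y0)) \<and> (B (n + k) (w (Suc k)) = w k \<and>
     Im (w (Suc k)) * Im (w k) > 0 \<and> \<bar>Im (w (Suc k))\<bar> \<ge> \<bar>Im (w k)\<bar>)"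
  proof (rule dependent_nat_choice)
    show "\<exists>x. Im x \<noteq> 0 \<and> (0 = (0::nat) \<longrightarrow> x = y0)" using assms by blast
    fix x k assume "Im x \<noteq> 0 \<and> (k = (0::nat) \<longrightarrow> x = y0)"
    then obtain y where y: "B (n + k) y = x" "Im y * Im x > 0" "\<bar>Im y\<bar> \<ge> \<bar>Im x\<bar>" using B_principal[of x "n + k"] by blast
    hence "Im y \<noteq> 0" by auto
    thus "\<exists>y. (Im y \<noteq> 0 \<and> (Suc k = 0 \<longrightarrow> y = y0)) \<and> B (n + k) y = x \<and> Im y * Im x > 0 \<and> \<bar>Im y\<bar> \<ge> \<bar>Im x\<bar>" using y by auto
  qed
  thus ?thesis unfolding lifts_def by blast
qed

lemma lifts_norm_step:
  assumes "lifts n y0 w"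
  shows "cmod (w (Suc k)) < 5 * \<rho> (n + k) \<or> cmod (w (Suc k) - w k) \<le> \<rho> (n + k)"
proof -
  have "B (n + k) (w (Suc k)) = w k" using assms by (simp add: lifts_def)
  hence "5 * \<rho> (n + k) \<le> cmod (w (Suc k)) \<Longrightarrow> cmod (w (Suc k) - w k) \<le> \<rho> (n + k)"
    using B_near(2)[of "n + k" "w (Suc k)"] by (simp add: norm_minus_commute)
  thus ?thesis by linarith
qed

lemma lifts_bounds:
  assumes "lifts n y0 w" "Im y0 \<noteq> 0"
  shows "cmod (w k) \<le> cmod y0 + 7" "Im (w k) * Im y0 > 0" "\<bar>Im (w k)\<bar> \<ge> \<bar>Im y0\<bar>"
    "cmp (n + i) j (w (i + j)) = w i"
proof -
  have "cmod (w k) \<le> cmod y0 + 5 * \<rho> n + s n k"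
  proof (induction k)
    case 0
    show ?case using assms(1) \<rho>_pos[of n] s_nonneg[of n 0] by (simp add: lifts_def)
  next
    case (Suc k)
    from lifts_norm_step[OF assms(1), of k] show ?case
    proof
      assume "cmod (w (Suc k)) < 5 * \<rho> (n + k)"
      moreover have "cmod y0 \<ge> 0" by simp
      ultimately show ?thesis using \<rho>_mono[of n k] s_nonneg[of n "Suc k"] by linarith
    next
      assume "cmod (w (Suc k) - w k) \<le> \<rho> (n + k)"
      moreover have "cmod (w (Suc k)) \<le> cmod (w k) + cmod (w (Suc k) - w k)"
        using norm_triangle_ineq[of "w k" "w (Suc k) - w k"] by simp
      ultimately show ?thesis using Suc by (simp add: s_def)
    qed
  qed
  moreover have "\<rho> n \<le> 1" using \<rho>_mono[of 0 n] \<rho>_0 by simp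
  ultimately show "cmod (w k) \<le> cmod y0 + 7" using s_le[of n k] by linarith
  have "Im (w k) * Im y0 > 0 \<and> \<bar>Im (w k)\<bar> \<ge> \<bar>Im y0\<bar>"
  proof (induction k)
    case 0
    have "w 0 = y0" using assms(1) by (simp add: lifts_def)
    thus ?case using assms(2) by (auto simp: zero_less_mult_iff)
  next
    case (Suc k)
    have "Im (w (Suc k)) * Im (w k) > 0" "\<bar>Im (w (Suc k))\<bar> \<ge> \<bar>Im (w k)\<bar>" using assms(1) by (auto simp: lifts_def)
    thus ?case using Suc by (auto simp: zero_less_mult_iff)
  qed
  thus "Im (w k) * Im y0 > 0" "\<bar>Im (w k)\<bar> \<ge> \<bar>Im y0\<bar>" by auto
  show "cmp (n + i) j (w (i + j)) = w i"
  proof (induction j)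
    case (Suc j)
    have "B (n + i + j) (w (Suc (i + j))) = w (i + j)" using assms(1) by (simp add: lifts_def add.assoc)
    thus ?case using Suc by simp
  qed simp
qed

text \<open>The imaginary parts of an inverse orbit never decrease in modulus, so the orbit leaves
  the shrinking regions where blocks are far from the identity. From then on its steps are at most
  \<open>\<rho> (n + k)\<close> and it converges. Its limit is a preimage under the infinite
  composition.\<close>

lemma lifts_limit:
  assumes w: "lifts n y0 w" and y0: "Im y0 \<noteq> 0"
  shows "\<exists>y. Im y * Im y0 > 0 \<and> \<bar>Im y\<bar> \<ge> \<bar>Im y0\<bar> \<and> cmod y \<le> cmod y0 + 7 \<and>
    (\<exists>K. \<forall>k\<ge>K. y \<in> far 30 (n + k) \<and> cmp n k (L (n + k) y) = y0)"
proof -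
  obtain K0 where K0: "\<rho> K0 < \<bar>Im y0\<bar> / 40" using exists_level[of "\<bar>Im y0\<bar> / 40"] y0 by auto
  have small: "40 * \<rho> (n + k) < \<bar>Im y0\<bar>" if "k \<ge> K0" for k
    using \<rho>_mono[of K0 "n + k - K0"] that K0 by simp
  have big: "cmod (w k) \<ge> \<bar>Im y0\<bar>" for k
    using lifts_bounds(3)[OF w y0, of k] abs_Im_le_cmod[of "w k"] by linarith
  have st: "cmod (w (Suc k) - w k) \<le> \<rho> (n + k)" if "k \<ge> K0" for k
    using lifts_norm_step[OF w, of k] big[of "Suc k"] small[OF that] \<rho>_pos[of "n + k"] by linarith
  have tele: "cmod (w (k + j) - w k) \<le> 2 * \<rho> (n + k) - 2 * \<rho> (n + k + j)" if "k \<ge> K0" for k j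
  proof (induction j)
    case (Suc j)
    have "cmod ((w (Suc (k + j)) - w (k + j)) + (w (k + j) - w k)) \<le> \<rho> (n + k + j) + (2 * \<rho> (n + k) - 2 * \<rho> (n + k + j))"
      using Suc st[of "k + j"] that by (intro norm_triangle_le add_mono) (simp_all add: add.assoc)
    moreover have "2 * \<rho> (n + k + Suc j) \<le> \<rho> (n + k + j)"
      using \<rho>_dec[of "n + k + j"] \<rho>_pos[of "Suc (n + k + j)"] by simp
    ultimately show ?case by simp
  qed simp
  have tb: "cmod (w (k + j) - w k) \<le> 2 * \<rho> (n + k)" if "k \<ge> K0" for k j
    using tele[OF that, of j] \<rho>_pos[of "n + k + j"] by linarith
  have "Cauchy w"
  proof (rule CauchyI)
    fix e :: real assume e: "e > 0"
    obtain K1 where K1: "\<rho> K1 < e / 4" using exists_level[of "e / 4"] e by auto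
    define K where "K = max K0 K1"
    have "\<rho> (n + K) \<le> \<rho> K1" using \<rho>_mono[of K1 "n + K - K1"] by (simp add: K_def)
    hence KK: "4 * \<rho> (n + K) < e" using K1 by simp
    have b: "cmod (w i - w K) \<le> 2 * \<rho> (n + K)" if "i \<ge> K" for i
      using tb[of K "i - K"] that by (simp add: K_def)
    have "cmod (w i - w j) < e" if "i \<ge> K" "j \<ge> K" for i j
    proof -
      have "cmod ((w i - w K) - (w j - w K)) \<le> cmod (w i - w K) + cmod (w j - w K)" by (rule norm_triangle_ineq4)
      thus ?thesis using b[OF that(1)] b[OF that(2)] KK by simp
    qed
    thus "\<exists>K. \<forall>i\<ge>K. \<forall>j\<ge>K. cmod (w i - w j) < e" by blast
  qed
  then obtain y where y: "w \<longlonglongrightarrow> y" using Cauchy_convergent convergent_def by blast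
  have Imy: "(\<lambda>k. Im (w k)) \<longlonglongrightarrow> Im y" by (intro tendsto_intros y)
  have i1: "\<bar>Im y\<bar> \<ge> \<bar>Im y0\<bar>"
    by (rule tendsto_lowerbound[OF tendsto_rabs[OF Imy]]) (use lifts_bounds(3)[OF w y0] in auto)
  have "Im y * Im y0 \<ge> 0"
    by (rule tendsto_lowerbound[OF tendsto_mult_right[OF Imy]])
       (use lifts_bounds(2)[OF w y0] in \<open>auto intro!: always_eventually less_imp_le\<close>)
  moreover have "Im y * Im y0 \<noteq> 0" using i1 y0 by auto
  ultimately have i2: "Im y * Im y0 > 0" by linarith
  have i3: "cmod y \<le> cmod y0 + 7"
    by (rule tendsto_upperbound[OF tendsto_norm[OF y]]) (use lifts_bounds(1)[OF w y0] in auto)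
  have "y \<in> far 30 (n + k) \<and> cmp n k (L (n + k) y) = y0" if k: "k \<ge> K0" for k
  proof -
    define m where "m = n + k"
    have fr: "y \<in> far 30 m" using small[OF k] i1 abs_Im_le_cmod[of y] \<rho>_pos[of m] unfolding far_def m_def by simp
    have fr11: "y \<in> far 11 m" by (rule far_mono[OF _ fr]) simp
    have "(\<lambda>j. w (j + k)) \<longlonglongrightarrow> y" by (rule LIMSEQ_ignore_initial_segment[OF y])
    hence yk: "(\<lambda>j. w (k + j)) \<longlonglongrightarrow> y" by (simp add: add.commute)
    have "eventually (\<lambda>j. dist (w (k + j)) y < \<rho> m) sequentially" by (rule tendstoD[OF yk \<rho>_pos])
    \<comment> \<open>\<open>w k\<close> is the image of \<open>w (k + j)\<close> under
      \<open>cmp m j\<close>. The Lipschitz constant 2 does not depend on \<open>j\<close>, so in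
      the limit \<open>w k = L m y\<close>.\<close>
    hence ev: "eventually (\<lambda>j. cmod (w k - cmp m j y) \<le> 2 * cmod (w (k + j) - y)) sequentially"
    proof eventually_elim
      case (elim j)
      have "w (k + j) \<in> cball y (\<rho> m)" using elim by (simp add: dist_commute)
      from cmp_lipschitz[OF fr11 this, of j] show ?case
        using lifts_bounds(4)[OF w y0, of k j] by (simp add: m_def)
    qed
    have z: "(\<lambda>j. 2 * cmod (w (k + j) - y)) \<longlonglongrightarrow> 0"
    proof -
      have "(\<lambda>j. 2 * cmod (w (k + j) - y)) \<longlonglongrightarrow> 2 * cmod (y - y)" by (intro tendsto_intros yk)
      thus ?thesis by simp
    qed
    have "(\<lambda>j. w k - cmp m j y) \<longlonglongrightarrow> 0" by (rule Lim_null_comparison[OF ev z])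
    moreover have "(\<lambda>j. w k - cmp m j y) \<longlonglongrightarrow> w k - L m y" by (intro tendsto_intros cmp_tendsto fr11)
    ultimately have "w k = L m y" using LIMSEQ_unique by force
    moreover have "cmp n k (w k) = y0" using lifts_bounds(4)[OF w y0, of 0 k] w by (simp add: lifts_def)
    ultimately show ?thesis using fr by (simp add: m_def)
  qed
  thus ?thesis using i1 i2 i3 by blast
qed

text \<open>A nonreal point over \<open>a\<close> is lifted to level \<open>n\<close>, where block
  \<open>n\<close> has mass at least \<open>n\<close> over it in the prescribed half-plane. Each of
  these fiber points is lifted on through all later blocks without loss of imaginary part and in a
  bounded region. Different fiber points have different limits, since each is recovered from its
  limit.\<close>

lemma a_points:
  assumes a: "a \<noteq> 0" "a \<noteq> 1" and \<sigma>: "\<sigma> = 1 \<or> \<sigma> = -1"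
  shows "\<exists>Z. finite Z \<and> (\<forall>z\<in>Z. \<sigma> * Im z > 0 \<and> F z = a) \<and> (\<Sum>z\<in>Z. \<bar>Im z\<bar> / (1 + (cmod z)\<^sup>2)) \<ge> M"
proof -
  obtain b where b: "Im b \<noteq> 0" "R0 b = a" using R0_nonreal_root[OF a] by blast
  obtain w where w: "lifts 0 b w" using lifts_exist[OF b(1)] by blast
  \<comment> \<open>Both stages of lifting add at most 7 to the modulus and block \<open>n\<close>
    at most 6, so all limits have modulus at most \<open>cmod b + 20\<close>.\<close>
  define C where "C = 1 + (cmod b + 20)\<^sup>2"
  have C: "C > 0" unfolding C_def by (intro add_pos_nonneg) auto
  obtain n where n: "real n \<ge> max (cmod b + 7) (max (1 / \<bar>Im b\<bar>) (\<bar>M\<bar> * C))" using real_arch_simple by blast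
  have w1: "\<bar>Im (w n)\<bar> \<ge> 1 / (real n + 1)"
  proof -
    have "1 / \<bar>Im b\<bar> \<le> real n + 1" using n by simp
    hence "1 / (real n + 1) \<le> \<bar>Im b\<bar>" using b(1) by (simp add: field_simps)
    thus ?thesis using lifts_bounds(3)[OF w b(1), of n] by linarith
  qed
  have w2: "cmod (w n) \<le> real n + 1" using lifts_bounds(1)[OF w b(1), of n] n by linarith
  \<comment> \<open>The inversion \<open>1 / X y\<close> exchanges the half-planes, hence the
    opposite sign in the coordinate y.\<close>
  have "- \<sigma> = 1 \<or> - \<sigma> = -1" using \<sigma> by auto
  from B_mass[OF w1 w2 this] obtain Y where Y: "finite Y"
    "\<And>y. y \<in> Y \<Longrightarrow> B n y = w n \<and> - \<sigma> * Im y > 0" "(\<Sum>y\<in>Y. \<bar>Im y\<bar>) \<ge> real n" by blast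
  have Ynz: "Im y \<noteq> 0" if "y \<in> Y" for y using Y(2)[OF that] by auto
  have Yb: "cmod y \<le> cmod b + 13" if "y \<in> Y" for y
  proof (cases "cmod y \<ge> 5 * \<rho> n")
    case True
    hence "cmod (B n y - y) \<le> \<rho> n" by (rule B_near(2))
    moreover have "cmod y \<le> cmod (w n) + cmod (B n y - y)"
      using norm_triangle_ineq4[of "w n" "B n y - y"] Y(2)[OF that] by simp
    moreover have "\<rho> n \<le> 1" using \<rho>_mono[of 0 n] \<rho>_0 by simp
    ultimately show ?thesis using lifts_bounds(1)[OF w b(1), of n] by linarith
  next
    case False
    moreover have "\<rho> n \<le> 1" using \<rho>_mono[of 0 n] \<rho>_0 by simp
    moreover have "cmod b \<ge> 0" by simp
    ultimately show ?thesis by linarith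
  qed
  have "\<exists>x. Im x * Im y > 0 \<and> \<bar>Im x\<bar> \<ge> \<bar>Im y\<bar> \<and> cmod x \<le> cmod y + 7 \<and>
    (\<exists>K. \<forall>k\<ge>K. x \<in> far 30 (Suc n + k) \<and> cmp (Suc n) k (L (Suc n + k) x) = y)" if "y \<in> Y" for y
    using lifts_exist[OF Ynz[OF that]] lifts_limit[OF _ Ynz[OF that]] by blast
  then obtain X where X: "\<And>y. y \<in> Y \<Longrightarrow> Im (X y) * Im y > 0" "\<And>y. y \<in> Y \<Longrightarrow> \<bar>Im (X y)\<bar> \<ge> \<bar>Im y\<bar>"
    "\<And>y. y \<in> Y \<Longrightarrow> cmod (X y) \<le> cmod y + 7"
    "\<And>y. y \<in> Y \<Longrightarrow> \<exists>K. \<forall>k\<ge>K. X y \<in> far 30 (Suc n + k) \<and> cmp (Suc n) k (L (Suc n + k) (X y)) = y" by metis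
  have Xnz: "X y \<noteq> 0" "Im (X y) \<noteq> 0" if "y \<in> Y" for y using X(1)[OF that] by auto
  have inj: "inj_on (\<lambda>y. 1 / X y) Y"
  proof (rule inj_onI)
    fix y y' assume y: "y \<in> Y" "y' \<in> Y" "1 / X y = 1 / X y'"
    hence eq: "X y = X y'" by (metis div_by_1 divide_divide_eq_right mult_1)
    obtain K where K: "\<And>k. k \<ge> K \<Longrightarrow> cmp (Suc n) k (L (Suc n + k) (X y)) = y" using X(4)[OF y(1)] by blast
    obtain K' where K': "\<And>k. k \<ge> K' \<Longrightarrow> cmp (Suc n) k (L (Suc n + k) (X y')) = y'" using X(4)[OF y(2)] by blast
    show "y = y'" using K[of "max K K'"] K'[of "max K K'"] eq by simp
  qed
  have Fa: "F (1 / X y) = a" if y: "y \<in> Y" for y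
  proof -
    obtain k where k: "X y \<in> far 30 (Suc n + k)" "cmp (Suc n) k (L (Suc n + k) (X y)) = y" using X(4)[OF y] by blast
    define m where "m = Suc n + k"
    have "Im (L m (X y)) \<noteq> 0" using L_nonreal[of "X y" m] k(1) Xnz[OF y] by (simp add: m_def)
    hence "L m (X y) \<notin> S m" using S_real[of m] by (auto simp: complex_is_Real_iff)
    hence g: "1 / X y \<in> good m" using k(1) Xnz[OF y] by (simp add: good_def m_def)
    have "cmp 0 m (L m (X y)) = cmp 0 (Suc n) y" using cmp_add[of 0 "Suc n" k] k(2) by (simp add: m_def del: cmp.simps)
    also have "\<dots> = cmp 0 n (w n)" using Y(2)[OF y] by simp
    also have "\<dots> = b" using lifts_bounds(4)[OF w b(1), of 0 n] w by (simp add: lifts_def)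
    finally have "F0 (1 / X y) = a" using F0_good[OF g] b(2) by simp
    thus ?thesis using F_at_good(1)[OF g] by simp
  qed
  have ImZ: "Im (1 / X y) = - Im (X y) / (cmod (X y))\<^sup>2" for y
    by (simp add: Im_divide cmod_power2)
  have sgn: "\<sigma> * Im (1 / X y) > 0" if y: "y \<in> Y" for y
  proof -
    have "- \<sigma> * Im (X y) > 0" using Y(2)[OF y] X(1)[OF y] \<sigma> by (auto simp: zero_less_mult_iff)
    hence "(- \<sigma> * Im (X y)) / (cmod (X y))\<^sup>2 > 0" using Xnz[OF y] by (intro divide_pos_pos) auto
    thus ?thesis by (simp add: ImZ)
  qed
  have wt: "\<bar>Im (1 / X y)\<bar> / (1 + (cmod (1 / X y))\<^sup>2) \<ge> \<bar>Im y\<bar> / C" if y: "y \<in> Y" for y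
  proof -
    define q where "q = (cmod (X y))\<^sup>2"
    have q: "q > 0" using Xnz[OF y] by (simp add: q_def)
    have "cmod (X y) \<le> cmod b + 20" using X(3)[OF y] Yb[OF y] by linarith
    hence qC: "q + 1 \<le> C" unfolding q_def C_def by (simp add: power_mono)
    \<comment> \<open>The Blaschke weight is invariant under inversion. On a bounded region it is
      therefore comparable with the imaginary part from below.\<close>
    have "\<bar>Im (1 / X y)\<bar> / (1 + (cmod (1 / X y))\<^sup>2) = (\<bar>Im (X y)\<bar> / q) / (1 + 1 / q)"
      by (simp add: ImZ norm_divide power_divide q_def)
    also have "\<dots> = \<bar>Im (X y)\<bar> / (q + 1)" using q by (simp add: field_simps)
    also have "\<dots> \<ge> \<bar>Im (X y)\<bar> / C" using q qC by (intro divide_left_mono) auto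
    finally have "\<bar>Im (1 / X y)\<bar> / (1 + (cmod (1 / X y))\<^sup>2) \<ge> \<bar>Im (X y)\<bar> / C" .
    moreover have "\<bar>Im (X y)\<bar> / C \<ge> \<bar>Im y\<bar> / C" using X(2)[OF y] C by (intro divide_right_mono) auto
    ultimately show ?thesis by linarith
  qed
  define Z where "Z = (\<lambda>y. 1 / X y) ` Y"
  have "(\<Sum>z\<in>Z. \<bar>Im z\<bar> / (1 + (cmod z)\<^sup>2)) = (\<Sum>y\<in>Y. \<bar>Im (1 / X y)\<bar> / (1 + (cmod (1 / X y))\<^sup>2))"
    unfolding Z_def by (subst sum.reindex[OF inj]) simp
  also have "\<dots> \<ge> (\<Sum>y\<in>Y. \<bar>Im y\<bar> / C)" by (intro sum_mono wt)
  also have "(\<Sum>y\<in>Y. \<bar>Im y\<bar> / C) = (\<Sum>y\<in>Y. \<bar>Im y\<bar>) / C" by (simp add: sum_divide_distrib)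
  finally have "(\<Sum>z\<in>Z. \<bar>Im z\<bar> / (1 + (cmod z)\<^sup>2)) \<ge> (\<Sum>y\<in>Y. \<bar>Im y\<bar>) / C" .
  moreover have "(\<Sum>y\<in>Y. \<bar>Im y\<bar>) / C \<ge> M"
  proof -
    have "\<bar>M\<bar> * C \<le> (\<Sum>y\<in>Y. \<bar>Im y\<bar>)" using n Y(3) by linarith
    hence "\<bar>M\<bar> \<le> (\<Sum>y\<in>Y. \<bar>Im y\<bar>) / C" using C by (simp add: pos_le_divide_eq)
    thus ?thesis by linarith
  qed
  ultimately have "(\<Sum>z\<in>Z. \<bar>Im z\<bar> / (1 + (cmod z)\<^sup>2)) \<ge> M" by linarith
  moreover have "finite Z" using Y(1) by (simp add: Z_def)
  moreover have "\<forall>z\<in>Z. \<sigma> * Im z > 0 \<and> F z = a" using sgn Fa by (auto simp: Z_def)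
  ultimately show ?thesis by blast
qed

end

section \<open>Zeros of bounded functions in a half-plane\<close>

text \<open>Schwarz's lemma, transported to the half-plane with \<open>z\<close> at the centre,
  bounds \<open>f\<close> by \<open>M\<close> times the Blaschke factor. So division by the factor
  keeps the bound.\<close>

lemma blaschke_division:
  assumes hol: "f holomorphic_on {w. Im w > 0}" and bd: "\<And>w. Im w > 0 \<Longrightarrow> cmod (f w) \<le> M"
    and z: "Im z > 0" "f z = 0"
  obtains g where "g holomorphic_on {w. Im w > 0}" "\<And>w. Im w > 0 \<Longrightarrow> cmod (g w) \<le> M"
    "\<And>w. Im w > 0 \<Longrightarrow> f w = g w * ((w - z) / (w - cnj z))"
proof -
  define H where "H = {w::complex. Im w > 0}"
  have oH: "open H" unfolding H_def by (rule open_halfspace_Im_gt)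
  have zH: "z \<in> H" using z(1) by (simp add: H_def)
  have nz: "w - cnj z \<noteq> 0" if "w \<in> H" for w using cayley_norm(1)[of w z] that z(1) by (simp add: H_def)
  define q where "q = (\<lambda>w. if w = z then deriv f z else f w / (w - z))"
  define g where "g = (\<lambda>w. q w * (w - cnj z))"
  have "q holomorphic_on H"
    by (rule pole_theorem_open_0[of f H z]) (use hol oH z(2) in \<open>auto simp: q_def H_def\<close>)
  hence gh: "g holomorphic_on H" unfolding g_def by (intro holomorphic_intros)
  have fg: "f w = g w * ((w - z) / (w - cnj z))" if "w \<in> H" for w
    using nz[OF that] z(2) by (simp add: g_def q_def)
  have M0: "M \<ge> 0" using bd[OF z(1)] z(2) by simp
  have le: "cmod (f w) \<le> M * cmod ((w - z) / (w - cnj z))" if w: "w \<in> H" for w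
  proof -
    define C where "C = (\<lambda>u. (z - cnj z * u) / (1 - u))"
    define u where "u = (w - z) / (w - cnj z)"
    have u: "cmod u < 1" using cayley_norm(2)[of w z] w z(1) by (simp add: u_def H_def)
    have Cpos: "Im (C x) > 0" if "cmod x < 1" for x using cayley_inverse(1)[OF z(1) that] by (simp add: C_def)
    have Cu: "C u = w"
    proof -
      have wn: "z - cnj z \<noteq> 0" using z(1) by (auto simp: complex_eq_iff)
      have "1 - u = (z - cnj z) / (w - cnj z)" using nz[OF w] by (simp add: u_def field_simps)
      moreover have "z - cnj z * u = w * (z - cnj z) / (w - cnj z)" using nz[OF w] by (simp add: u_def field_simps)
      ultimately show ?thesis using nz[OF w] wn by (simp add: C_def)
    qed
    have "C holomorphic_on ball 0 1" unfolding C_def by (auto intro!: holomorphic_intros)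
    hence fC: "(\<lambda>u. f (C u)) holomorphic_on ball 0 1"
      using holomorphic_on_compose_gen[OF _ hol, of C "ball 0 1"] Cpos by (force simp: o_def)
    \<comment> \<open>Schwarz's lemma asks for values strictly inside the disc; hence a larger
      constant, which then tends to \<open>M\<close>.\<close>
    have strict: "cmod (f w) \<le> K * cmod u" if K: "K > M" for K
    proof -
      have K0: "K > 0" using K M0 by linarith
      have "cmod (f (C u) / of_real K) \<le> cmod u"
      proof (rule Schwarz_Lemma(1)[where f = "\<lambda>u. f (C u) / of_real K"])
        show "(\<lambda>u. f (C u) / of_real K) holomorphic_on ball 0 1"
          using K0 by (intro holomorphic_intros fC) auto
        show "f (C 0) / of_real K = 0" using z(2) by (simp add: C_def)
        show "cmod (f (C x) / of_real K) < 1" if "cmod x < 1" for x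
          using bd[OF Cpos[OF that]] K K0 by (simp add: norm_divide)
      qed (rule u)
      thus ?thesis using K0 Cu by (simp add: norm_divide field_simps)
    qed
    have "cmod (f w) \<le> M * cmod u"
    proof (rule field_le_epsilon)
      fix e :: real assume e: "e > 0"
      have "cmod (f w) \<le> (M + e) * cmod u" by (rule strict) (use e in simp)
      also have "\<dots> \<le> M * cmod u + e"
        using mult_left_mono[of "cmod u" 1 e] u e by (simp add: algebra_simps)
      finally show "cmod (f w) \<le> M * cmod u + e" .
    qed
    thus ?thesis by (simp add: u_def)
  qed
  have b1: "cmod (g w) \<le> M" if w: "w \<in> H" "w \<noteq> z" for w
  proof -
    have "cmod ((w - z) / (w - cnj z)) > 0" using w nz[OF w(1)] by simp
    moreover have "cmod (g w) * cmod ((w - z) / (w - cnj z)) \<le> M * cmod ((w - z) / (w - cnj z))"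
      using le[OF w(1)] by (simp only: fg[OF w(1)] norm_mult)
    ultimately show ?thesis by (simp only: mult_le_cancel_right_pos)
  qed
  have "cmod (g z) \<le> M"
  proof (rule tendsto_upperbound)
    have "isCont g z"
      using holomorphic_on_imp_continuous_on[OF gh] continuous_on_eq_continuous_at[OF oH] zH by blast
    thus "((\<lambda>w. cmod (g w)) \<longlongrightarrow> cmod (g z)) (at z)" by (intro tendsto_norm) (simp add: isContD)
    have "eventually (\<lambda>w. w \<in> H) (at z)" using eventually_at_topological oH zH by blast
    moreover have "eventually (\<lambda>w. w \<noteq> z) (at z)" by (simp add: eventually_at_filter)
    ultimately show "eventually (\<lambda>w. cmod (g w) \<le> M) (at z)" by eventually_elim (rule b1)
  qed simp
  hence "cmod (g w) \<le> M" if "w \<in> H" for w using b1[OF that] by (cases "w = z") auto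
  thus thesis using that[of g] gh fg by (simp add: H_def)
qed

lemma blaschke_product_bound:
  assumes "finite Z" "f holomorphic_on {w. Im w > 0}" "\<And>w. Im w > 0 \<Longrightarrow> cmod (f w) \<le> M"
    "\<And>z. z \<in> Z \<Longrightarrow> Im z > 0 \<and> f z = 0" "Im w > 0"
  shows "cmod (f w) \<le> M * (\<Prod>z\<in>Z. cmod ((w - z) / (w - cnj z)))"
  using assms
proof (induction Z arbitrary: f rule: finite_induct)
  case (insert z Z)
  have z: "Im z > 0" "f z = 0" using insert.prems(3) by auto
  obtain g where g: "g holomorphic_on {w. Im w > 0}" "\<And>w. Im w > 0 \<Longrightarrow> cmod (g w) \<le> M"
    "\<And>w. Im w > 0 \<Longrightarrow> f w = g w * ((w - z) / (w - cnj z))"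
    using blaschke_division[OF insert.prems(1,2) z] by blast
  have gZ: "Im x > 0 \<and> g x = 0" if x: "x \<in> Z" for x
  proof -
    have xp: "Im x > 0" "f x = 0" using insert.prems(3) x by auto
    have "x - z \<noteq> 0" using x insert.hyps(2) by auto
    moreover have "x - cnj z \<noteq> 0" by (rule cayley_norm(1)[OF xp(1) z(1)])
    ultimately show ?thesis using g(3)[OF xp(1)] xp by simp
  qed
  have "cmod (g w) \<le> M * (\<Prod>z\<in>Z. cmod ((w - z) / (w - cnj z)))"
    by (rule insert.IH[OF g(1,2) gZ insert.prems(4)])
  hence "cmod (g w) * cmod ((w - z) / (w - cnj z)) \<le> M * (\<Prod>z\<in>Z. cmod ((w - z) / (w - cnj z))) * cmod ((w - z) / (w - cnj z))"
    by (rule mult_right_mono) simp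
  moreover have "cmod (f w) = cmod (g w) * cmod ((w - z) / (w - cnj z))"
    by (simp only: g(3)[OF insert.prems(4)] norm_mult)
  moreover have "(\<Prod>x\<in>insert z Z. cmod ((w - x) / (w - cnj x))) = cmod ((w - z) / (w - cnj z)) * (\<Prod>x\<in>Z. cmod ((w - x) / (w - cnj x)))"
    by (rule prod.insert[OF insert.hyps])
  ultimately show ?case by (simp only: mult_ac)
qed simp

text \<open>The square equals 1 - 4 Im w Im z / |w - cnj z|^2, and 1 - x \<le> exp (- x). Bounding
  the denominator by \<open>2 * ((1 + (cmod w)\<^sup>2) * (1 + (cmod z)\<^sup>2))\<close> separates
  the variables and makes the Blaschke weight of \<open>z\<close> appear.\<close>

lemma cayley_norm_exp_bound:
  assumes w: "Im w > 0" and z: "Im z > 0"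
  shows "(cmod ((w - z) / (w - cnj z)))\<^sup>2 \<le> exp (- (2 * Im w / (1 + (cmod w)\<^sup>2) * (\<bar>Im z\<bar> / (1 + (cmod z)\<^sup>2))))"
proof -
  define N where "N = (cmod (w - cnj z))\<^sup>2"
  have "w - cnj z \<noteq> 0" by (rule cayley_norm(1)[OF w z])
  hence N: "N > 0" by (simp add: N_def)
  have "(cmod (w - z))\<^sup>2 = N - 4 * Im w * Im z"
    unfolding N_def cmod_power2 by (simp add: power2_eq_square algebra_simps)
  hence eq: "(cmod ((w - z) / (w - cnj z)))\<^sup>2 = 1 - 4 * Im w * Im z / N"
    unfolding norm_divide power_divide N_def[symmetric] using N by (simp add: diff_divide_distrib)
  have "cmod (w - cnj z) \<le> cmod w + cmod z" using norm_triangle_ineq4[of w "cnj z"] by simp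
  hence "N \<le> (cmod w + cmod z)\<^sup>2" unfolding N_def by (rule power_mono) simp
  also have "\<dots> \<le> 2 * ((cmod w)\<^sup>2 + (cmod z)\<^sup>2)"
    using zero_le_power2[of "cmod w - cmod z"] by (simp add: power2_eq_square algebra_simps)
  also have "\<dots> \<le> 2 * ((1 + (cmod w)\<^sup>2) * (1 + (cmod z)\<^sup>2))"
    by (simp add: algebra_simps)
  finally have NN: "N \<le> 2 * ((1 + (cmod w)\<^sup>2) * (1 + (cmod z)\<^sup>2))" .
  have "2 * Im w / (1 + (cmod w)\<^sup>2) * (\<bar>Im z\<bar> / (1 + (cmod z)\<^sup>2)) =
      4 * Im w * Im z / (2 * ((1 + (cmod w)\<^sup>2) * (1 + (cmod z)\<^sup>2)))"
    using z by simp
  also have "\<dots> \<le> 4 * Im w * Im z / N"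
    using w z N NN by (intro divide_left_mono mult_nonneg_nonneg mult_pos_pos) (auto intro: add_pos_nonneg)
  finally have "2 * Im w / (1 + (cmod w)\<^sup>2) * (\<bar>Im z\<bar> / (1 + (cmod z)\<^sup>2)) \<le> 4 * Im w * Im z / N" .
  thus ?thesis unfolding eq using exp_ge_add_one_self[of "- (2 * Im w / (1 + (cmod w)\<^sup>2) * (\<bar>Im z\<bar> / (1 + (cmod z)\<^sup>2)))"]
    by linarith
qed

text \<open>Logarithms of the product bound at a single point \<open>w\<close> with
  \<open>f w \<noteq> 0\<close> give the Blaschke condition, as a bound uniform over finite sets of
  zeros.\<close>

lemma bounded_zeros_blaschke_upper:
  assumes hol: "f holomorphic_on {w. Im w > 0}" and bd: "bounded (f ` {w. Im w > 0})"
    and w: "Im w > 0" "f w \<noteq> 0"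
  obtains K where "\<And>Z. finite Z \<Longrightarrow> (\<And>z. z \<in> Z \<Longrightarrow> Im z > 0 \<and> f z = 0) \<Longrightarrow>
    (\<Sum>z\<in>Z. \<bar>Im z\<bar> / (1 + (cmod z)\<^sup>2)) \<le> K"
proof -
  obtain M where M: "\<And>w. Im w > 0 \<Longrightarrow> cmod (f w) \<le> M" using bd unfolding bounded_iff by auto
  define c where "c = 2 * Im w / (1 + (cmod w)\<^sup>2)"
  have c: "c > 0" unfolding c_def using w(1) by (intro divide_pos_pos add_pos_nonneg) auto
  define K where "K = ln (M\<^sup>2 / (cmod (f w))\<^sup>2) / c"
  have fw: "(cmod (f w))\<^sup>2 > 0" using w(2) by simp
  have "(\<Sum>z\<in>Z. \<bar>Im z\<bar> / (1 + (cmod z)\<^sup>2)) \<le> K"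
    if Z: "finite Z" "\<And>z. z \<in> Z \<Longrightarrow> Im z > 0 \<and> f z = 0" for Z
  proof -
    define t where "t = (\<Sum>z\<in>Z. \<bar>Im z\<bar> / (1 + (cmod z)\<^sup>2))"
    have "cmod (f w) \<le> M * (\<Prod>z\<in>Z. cmod ((w - z) / (w - cnj z)))"
      by (rule blaschke_product_bound[OF Z(1) hol M Z(2) w(1)])
    hence "(cmod (f w))\<^sup>2 \<le> (M * (\<Prod>z\<in>Z. cmod ((w - z) / (w - cnj z))))\<^sup>2"
      by (rule power_mono) simp
    also have "\<dots> = M\<^sup>2 * (\<Prod>z\<in>Z. (cmod ((w - z) / (w - cnj z)))\<^sup>2)"
      by (simp only: power_mult_distrib prod_power_distrib)
    also have "\<dots> \<le> M\<^sup>2 * (\<Prod>z\<in>Z. exp (- (c * (\<bar>Im z\<bar> / (1 + (cmod z)\<^sup>2)))))"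
      unfolding c_def using Z(2) by (intro mult_left_mono prod_mono conjI cayley_norm_exp_bound w(1)) auto
    also have "(\<Prod>z\<in>Z. exp (- (c * (\<bar>Im z\<bar> / (1 + (cmod z)\<^sup>2))))) = exp (- (c * t))"
      using Z(1) by (simp add: exp_sum[symmetric] sum_negf sum_distrib_left t_def)
    finally have "(cmod (f w))\<^sup>2 \<le> M\<^sup>2 * exp (- (c * t))" .
    hence "exp (c * t) \<le> M\<^sup>2 / (cmod (f w))\<^sup>2"
      using fw by (simp add: exp_minus field_simps)
    hence "c * t \<le> ln (M\<^sup>2 / (cmod (f w))\<^sup>2)"
      using ln_mono[of "exp (c * t)" "M\<^sup>2 / (cmod (f w))\<^sup>2"] by simp
    thus ?thesis using c by (simp add: K_def t_def[symmetric] pos_le_divide_eq mult.commute)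
  qed
  thus thesis by (rule that)
qed

lemma bounded_zeros_blaschke:
  assumes \<sigma>: "\<sigma> = 1 \<or> \<sigma> = (-1::real)"
    and hol: "f holomorphic_on {w. \<sigma> * Im w > 0}" and bd: "bounded (f ` {w. \<sigma> * Im w > 0})"
    and w: "\<sigma> * Im w > 0" "f w \<noteq> 0"
  obtains K where "\<And>Z. finite Z \<Longrightarrow> (\<And>z. z \<in> Z \<Longrightarrow> \<sigma> * Im z > 0 \<and> f z = 0) \<Longrightarrow>
    (\<Sum>z\<in>Z. \<bar>Im z\<bar> / (1 + (cmod z)\<^sup>2)) \<le> K"
proof -
  \<comment> \<open>For the lower half-plane this is the half-turn, which is holomorphic and
    preserves the Blaschke weight.\<close>
  define r where "r = (\<lambda>z::complex. of_real \<sigma> * z)"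
  have rr: "r (r z) = z" for z using \<sigma> by (auto simp: r_def)
  have ri: "Im (r z) = \<sigma> * Im z" "\<sigma> * Im (r z) = Im z" "\<bar>Im (r z)\<bar> = \<bar>Im z\<bar>" "cmod (r z) = cmod z" for z
    using \<sigma> by (auto simp: r_def)
  have im: "r ` {w. Im w > 0} \<subseteq> {w. \<sigma> * Im w > 0}"
    unfolding image_subset_iff mem_Collect_eq ri(2) by blast
  have rh: "r holomorphic_on {w. Im w > 0}" unfolding r_def by (intro holomorphic_intros)
  have "(f \<circ> r) holomorphic_on {w. Im w > 0}" by (rule holomorphic_on_compose_gen[OF rh hol im])
  moreover have "bounded ((f \<circ> r) ` {w. Im w > 0})"
    by (rule bounded_subset[OF bd]) (use im in \<open>auto simp: image_comp[symmetric]\<close>)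
  moreover have "Im (r w) > 0" "(f \<circ> r) (r w) \<noteq> 0" using w by (simp_all add: ri rr)
  ultimately obtain K where K: "\<And>Z. finite Z \<Longrightarrow> (\<And>z. z \<in> Z \<Longrightarrow> Im z > 0 \<and> (f \<circ> r) z = 0) \<Longrightarrow>
    (\<Sum>z\<in>Z. \<bar>Im z\<bar> / (1 + (cmod z)\<^sup>2)) \<le> K" using bounded_zeros_blaschke_upper by blast
  have "(\<Sum>z\<in>Z. \<bar>Im z\<bar> / (1 + (cmod z)\<^sup>2)) \<le> K"
    if Z: "finite Z" "\<And>z. z \<in> Z \<Longrightarrow> \<sigma> * Im z > 0 \<and> f z = 0" for Z
  proof -
    have "inj_on r Z" by (rule inj_on_inverseI[of _ r]) (rule rr)
    hence "(\<Sum>z\<in>r ` Z. \<bar>Im z\<bar> / (1 + (cmod z)\<^sup>2)) = (\<Sum>z\<in>Z. \<bar>Im z\<bar> / (1 + (cmod z)\<^sup>2))"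
      by (subst sum.reindex) (simp_all only: o_def ri(3,4))
    moreover have "(\<Sum>z\<in>r ` Z. \<bar>Im z\<bar> / (1 + (cmod z)\<^sup>2)) \<le> K"
      by (rule K) (use Z in \<open>auto simp: ri rr\<close>)
    ultimately show ?thesis by simp
  qed
  thus thesis by (rule that)
qed

section \<open>Failure of the Blaschke condition and of bounded type\<close>

context block_sequence
begin

lemma F_holomorphic: "F holomorphic_on {z. Im z \<noteq> 0}"
proof -
  have "F holomorphic_on good m" for m
    by (rule holomorphic_transform[OF F0_hol]) (simp add: F_at_good)
  hence "F analytic_on good m" for m by (simp add: analytic_on_open[OF open_good])
  hence "F analytic_on (\<Union>m. good m)" by (simp add: analytic_on_Union analytic_on_UN)
  hence "F analytic_on {z. Im z \<noteq> 0}" by (rule analytic_on_subset) (use nonreal_good in auto)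
  thus ?thesis by (rule analytic_imp_holomorphic)
qed

lemma halfplane:
  assumes "\<sigma> = 1 \<or> \<sigma> = (-1::real)"
  shows "open {z. \<sigma> * Im z > 0}" "connected {z. \<sigma> * Im z > 0}"
    "F holomorphic_on {z. \<sigma> * Im z > 0}"
proof -
  show "open {z. \<sigma> * Im z > 0}"
    using assms by (auto simp: open_halfspace_Im_gt open_halfspace_Im_lt)
  show "connected {z. \<sigma> * Im z > 0}"
    using assms by (auto intro!: convex_connected simp: convex_halfspace_Im_gt convex_halfspace_Im_lt)
  show "F holomorphic_on {z. \<sigma> * Im z > 0}"
    by (rule holomorphic_on_subset[OF F_holomorphic]) auto
qed

text \<open>The order at a zero is positive once the function is not constant in the half-plane.
  This is seen from a second value, 2 or 3, that \<open>a_points\<close> shows to be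
  attained.\<close>

lemma point_divisor_pos:
  assumes z: "Im z \<noteq> 0" "F z = c" and \<sigma>: "\<sigma> = 1 \<or> \<sigma> = -1" "\<sigma> * Im z > 0"
  shows "point_divisor F (Some c) z \<ge> 1"
proof -
  define a :: complex where "a = (if c = 2 then 3 else 2)"
  have a: "a \<noteq> 0" "a \<noteq> 1" "a \<noteq> c" by (auto simp: a_def)
  obtain Z where Z: "finite Z" "\<forall>z\<in>Z. \<sigma> * Im z > 0 \<and> F z = a" "(\<Sum>z\<in>Z. \<bar>Im z\<bar> / (1 + (cmod z)\<^sup>2)) \<ge> 1"
    using a_points[OF a(1,2) \<sigma>(1), of 1] by blast
  have "Z \<noteq> {}" using Z(3) by auto
  then obtain p where p: "\<sigma> * Im p > 0" "F p = a" using Z(2) by blast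
  have hol: "(\<lambda>w. F w - c) holomorphic_on {z. \<sigma> * Im z > 0}"
    by (intro holomorphic_intros halfplane(3)[OF \<sigma>(1)])
  obtain r where r: "0 < r" "\<And>w. w \<in> ball z r - {z} \<Longrightarrow> F w - c \<noteq> 0"
    by (rule isolated_zeros[OF hol halfplane(1,2)[OF \<sigma>(1)], of z p]) (use z p a \<sigma>(2) in auto)
  have "eventually (\<lambda>w. F w - c \<noteq> 0) (at z)"
    unfolding eventually_at
  proof (intro exI[of _ r] conjI ballI impI)
    fix w assume "w \<noteq> z \<and> dist w z < r"
    thus "F w - c \<noteq> 0" by (intro r(2)) (simp add: dist_commute)
  qed (rule r(1))
  hence "frequently (\<lambda>w. F w - c \<noteq> 0) (at z)" by (rule eventually_frequently[rotated]) simp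
  hence "zorder (\<lambda>w. F w - c) z > 0"
    using zorder_pos_iff[OF hol halfplane(1)[OF \<sigma>(1)], of z] z(2) \<sigma>(2) by simp
  moreover have "sphere_map F z = Some c" using F_nonreal(3)[OF z(1)] z(2) by (simp add: sphere_map_def)
  ultimately show ?thesis by (simp add: point_divisor_def)
qed

lemma not_blaschke:
  assumes \<sigma>: "\<sigma> = 1 \<or> \<sigma> = -1" and c: "c \<noteq> 0" "c \<noteq> 1"
  shows "\<not> blaschke_condition (restrict_divisor (point_divisor F (Some c)) {z. \<sigma> * Im z > 0})"
proof
  define D where "D = restrict_divisor (point_divisor F (Some c)) {z. \<sigma> * Im z > 0}"
  define f where "f = (\<lambda>z. real (D z) * (\<bar>Im z\<bar> / (1 + (cmod z)\<^sup>2)))"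
  assume "blaschke_condition (restrict_divisor (point_divisor F (Some c)) {z. \<sigma> * Im z > 0})"
  hence sm: "f summable_on UNIV" by (simp add: blaschke_condition_def f_def D_def)
  have wt: "\<bar>Im z\<bar> / (1 + (cmod z)\<^sup>2) \<ge> 0" for z by simp
  obtain Z where Z: "finite Z" "\<forall>z\<in>Z. \<sigma> * Im z > 0 \<and> F z = c"
    "(\<Sum>z\<in>Z. \<bar>Im z\<bar> / (1 + (cmod z)\<^sup>2)) \<ge> infsum f UNIV + 1"
    using a_points[OF c \<sigma>] by blast
  have "(\<Sum>z\<in>Z. \<bar>Im z\<bar> / (1 + (cmod z)\<^sup>2)) \<le> sum f Z"
  proof (rule sum_mono)
    fix z assume "z \<in> Z"
    hence z: "\<sigma> * Im z > 0" "F z = c" using Z(2) by auto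
    have "point_divisor F (Some c) z \<ge> 1" by (rule point_divisor_pos[OF _ z(2) \<sigma> z(1)]) (use z in auto)
    hence "1 \<le> real (D z)" using z(1) by (simp add: D_def restrict_divisor_def)
    from mult_right_mono[OF this wt[of z]] show "\<bar>Im z\<bar> / (1 + (cmod z)\<^sup>2) \<le> f z" by (simp add: f_def)
  qed
  also have "\<dots> \<le> infsum f UNIV"
    by (rule finite_sum_le_infsum[OF sm Z(1)]) (simp_all add: f_def)
  finally show False using Z(3) by simp
qed

lemma not_bounded_type:
  assumes \<sigma>: "\<sigma> = 1 \<or> \<sigma> = -1"
  shows "\<not> bounded_type_on F {z. \<sigma> * Im z > 0}"
proof
  define H where "H = {z. \<sigma> * Im z > 0}"
  note hp = halfplane[OF \<sigma>, folded H_def]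
  assume "bounded_type_on F {z. \<sigma> * Im z > 0}"
  then obtain g h p where g: "g holomorphic_on H" "bounded (g ` H)"
    and h: "h holomorphic_on H" "bounded (h ` H)" and p: "p \<in> H" "h p \<noteq> 0"
    and ev: "\<forall>\<^sub>\<approx>z\<in>H. F z = g z / h z" unfolding bounded_type_on_def H_def by blast
  have cont: "isCont k z" if "k holomorphic_on H" "z \<in> H" for k z
    using holomorphic_on_imp_continuous_on[OF that(1)] continuous_on_eq_continuous_at[OF hp(1)] that(2) by blast
  \<comment> \<open>The equality off a sparse set extends to every point by continuity, as both
    sides are continuous in the half-plane.\<close>
  have eq: "g z = F z * h z" if z: "z \<in> H" for z
  proof (rule LIM_unique)
    show "g \<midarrow>z\<rightarrow> g z" by (rule isContD[OF cont[OF g(1) z]])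
    have "eventually (\<lambda>w. F w = g w / h w) (at z)"
      using ev z unfolding eventually_cosparse_open_eq[OF hp(1)] by blast
    moreover have "eventually (\<lambda>w. w \<in> H) (at z)" using eventually_at_topological hp(1) z by blast
    ultimately have "eventually (\<lambda>w. F w * h w = g w) (at z)"
    proof eventually_elim
      case (elim w)
      \<comment> \<open>A zero of \<open>h\<close> would give the quotient the dummy value 0, which
        \<open>F\<close> omits here.\<close>
      have "F w \<noteq> 0" by (rule F_nonreal) (use elim(2) in \<open>auto simp: H_def\<close>)
      hence "h w \<noteq> 0" using elim(1) by auto
      thus ?case using elim(1) by simp
    qed
    moreover have "(\<lambda>w. F w * h w) \<midarrow>z\<rightarrow> F z * h z"
      by (intro tendsto_mult isContD cont hp(3) h(1) z)
    ultimately show "g \<midarrow>z\<rightarrow> F z * h z" by (rule Lim_transform_eventually[rotated])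
  qed
  \<comment> \<open>Any value other than 0, 1 and \<open>F p\<close> would serve: then
    \<open>g - a * h\<close> is bounded, does not vanish at \<open>p\<close>, and vanishes at all
    a-points.\<close>
  define a :: complex where "a = (if F p = 2 then 3 else 2)"
  have a: "a \<noteq> 0" "a \<noteq> 1" "a \<noteq> F p" by (auto simp: a_def)
  define f where "f = (\<lambda>z. g z - a * h z)"
  have fe: "f z = (F z - a) * h z" if "z \<in> H" for z using eq[OF that] by (simp add: f_def algebra_simps)
  have "f holomorphic_on H" unfolding f_def by (intro holomorphic_intros g(1) h(1))
  moreover have "bounded (f ` H)"
  proof -
    obtain M1 where M1: "\<And>z. z \<in> H \<Longrightarrow> cmod (g z) \<le> M1" using g(2) unfolding bounded_iff by auto
    obtain M2 where M2: "\<And>z. z \<in> H \<Longrightarrow> cmod (h z) \<le> M2" using h(2) unfolding bounded_iff by auto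
    have "cmod (f z) \<le> M1 + cmod a * M2" if "z \<in> H" for z
    proof -
      have "cmod (f z) \<le> cmod (g z) + cmod (a * h z)" unfolding f_def by (rule norm_triangle_ineq4)
      also have "\<dots> \<le> M1 + cmod a * M2"
        unfolding norm_mult by (intro add_mono mult_left_mono M1 M2 that) simp
      finally show ?thesis .
    qed
    thus ?thesis unfolding bounded_iff by blast
  qed
  moreover have "\<sigma> * Im p > 0" using p(1) by (simp add: H_def)
  moreover have "f p \<noteq> 0" using fe[OF p(1)] p(2) a(3) by simp
  ultimately obtain K where K: "\<And>Z. finite Z \<Longrightarrow> (\<And>z. z \<in> Z \<Longrightarrow> \<sigma> * Im z > 0 \<and> f z = 0) \<Longrightarrow>
      (\<Sum>z\<in>Z. \<bar>Im z\<bar> / (1 + (cmod z)\<^sup>2)) \<le> K"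
    using bounded_zeros_blaschke[OF \<sigma>] unfolding H_def by blast
  obtain Z where Z: "finite Z" "\<forall>z\<in>Z. \<sigma> * Im z > 0 \<and> F z = a"
    "(\<Sum>z\<in>Z. \<bar>Im z\<bar> / (1 + (cmod z)\<^sup>2)) \<ge> K + 1"
    using a_points[OF a(1,2) \<sigma>] by blast
  have "(\<Sum>z\<in>Z. \<bar>Im z\<bar> / (1 + (cmod z)\<^sup>2)) \<le> K"
    by (rule K[OF Z(1)]) (use Z(2) fe in \<open>auto simp: H_def\<close>)
  thus False using Z(3) by simp
qed

end

text \<open>Dependent choice of the blocks. Each block determines the vertex set of the next one,
  and its \<alpha> fixes the next scale \<open>\<alpha> / 100\<close>.\<close>

lemma block_sequence_exists: "\<exists>S \<rho> \<alpha> B P. block_sequence S \<rho> \<alpha> B P"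
proof -
  define ok where "ok = (\<lambda>n (S, \<rho>, \<alpha>, B, P). finite S \<and> S \<subseteq> \<real> \<and> 0 < \<alpha> \<and> \<alpha> < \<rho> \<and> \<rho> \<le> 1 \<and>
    (n = 0 \<longrightarrow> S = R0_vert) \<and> is_block S \<alpha> \<rho> (real n) (real n + 1) B P)"
  define nxt where "nxt = (\<lambda>(n::nat) (S :: complex set, \<rho> :: real, \<alpha> :: real, B :: complex \<Rightarrow> complex, P :: complex set) (S', \<rho>', \<alpha>' :: real, B' :: complex \<Rightarrow> complex, P' :: complex set).
    \<rho>' \<le> \<alpha> / 100 \<and> S' = P \<union> {y. y \<notin> P \<and> B y \<in> S})"
  have "\<exists>X. \<forall>n. ok n (X n) \<and> nxt n (X n) (X (Suc n))"
  proof (rule dependent_nat_choice)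
    have R: "finite R0_vert" "R0_vert \<subseteq> \<real>" by (auto simp: R0_vert_def)
    obtain \<alpha> B P where "0 < \<alpha>" "\<alpha> < 1" "is_block R0_vert \<alpha> 1 (real 0) (real 0 + 1) B P"
      using block_exists[OF R, of 1 "real 0 + 1" "real 0"] by auto
    hence "ok 0 (R0_vert, 1, \<alpha>, B, P)" using R by (simp add: ok_def)
    thus "\<exists>x. ok 0 x" by blast
  next
    fix x n assume x: "ok n x"
    obtain S \<rho> \<alpha> B P where xe: "x = (S, \<rho>, \<alpha>, B, P)" by (metis prod_cases5)
    have o: "0 < \<alpha>" "\<alpha> < \<rho>" "\<rho> \<le> 1" "is_block S \<alpha> \<rho> (real n) (real n + 1) B P"
      using x by (auto simp: ok_def xe)
    define S' where "S' = P \<union> {y. y \<notin> P \<and> B y \<in> S}"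
    have S': "finite S'" "S' \<subseteq> \<real>" using o(4) unfolding S'_def is_block_def by blast+
    have "\<alpha> / 100 > 0" "real (Suc n) + 1 \<ge> 1" using o(1) by auto
    then obtain \<alpha>' B' P' where b: "0 < \<alpha>'" "\<alpha>' < \<alpha> / 100" "is_block S' \<alpha>' (\<alpha> / 100) (real (Suc n)) (real (Suc n) + 1) B' P'"
      using block_exists[OF S', of "\<alpha> / 100" "real (Suc n) + 1" "real (Suc n)"] by blast
    have "ok (Suc n) (S', \<alpha> / 100, \<alpha>', B', P')" using b S' o(1,2,3) by (simp add: ok_def)
    moreover have "nxt n x (S', \<alpha> / 100, \<alpha>', B', P')" by (simp add: nxt_def xe S'_def)
    ultimately show "\<exists>y. ok (Suc n) y \<and> nxt n x y" by blast
  qed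
  then obtain X where X: "\<And>n. ok n (X n)" "\<And>n. nxt n (X n) (X (Suc n))" by blast
  define S where "S = (\<lambda>n. fst (X n))"
  define \<rho> where "\<rho> = (\<lambda>n. fst (snd (X n)))"
  define \<alpha> where "\<alpha> = (\<lambda>n. fst (snd (snd (X n))))"
  define B where "B = (\<lambda>n. fst (snd (snd (snd (X n)))))"
  define P where "P = (\<lambda>n. snd (snd (snd (snd (X n)))))"
  have Xe: "X n = (S n, \<rho> n, \<alpha> n, B n, P n)" for n by (simp add: S_def \<rho>_def \<alpha>_def B_def P_def)
  have "block_sequence S \<rho> \<alpha> B P"
  proof
    show "S 0 = R0_vert" "\<rho> 0 \<le> 1" using X(1)[of 0] by (simp_all add: ok_def Xe)
    fix n
    show "finite (S n)" "S n \<subseteq> \<real>" "0 < \<alpha> n" "\<alpha> n < \<rho> n"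
      "is_block (S n) (\<alpha> n) (\<rho> n) (real n) (real n + 1) (B n) (P n)"
      using X(1)[of n] by (simp_all add: ok_def Xe)
    show "\<rho> (Suc n) \<le> \<alpha> n / 100" "S (Suc n) = P n \<union> {y. y \<notin> P n \<and> B n y \<in> S n}"
      using X(2)[of n] by (simp_all add: nxt_def Xe)
  qed
  thus ?thesis by blast
qed

theorem theorem1p2:
  shows "\<exists>F :: complex \<Rightarrow> complex.
     F nicely_meromorphic_on UNIV \<and>
     (\<forall>z. F (cnj z) = cnj (F z)) \<and>
     sphere_map F -` {Some 0, Some 1, None} \<subseteq> \<real> \<and>
     infinite (sphere_map F -` {Some 0}) \<and>
     infinite (sphere_map F -` {Some 1}) \<and>
     infinite (sphere_map F -` {None}) \<and>
     (\<forall>a :: extended_complex. a \<notin> {Some 0, Some 1, None} \<longrightarrow>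
        (\<forall>H \<in> {upper_half_plane, lower_half_plane}.
           \<not> blaschke_condition (restrict_divisor (point_divisor F a) H))) \<and>
     (\<forall>H \<in> {upper_half_plane, lower_half_plane}. \<not> bounded_type_on F H)"
proof -
  obtain S \<rho> \<alpha> B P where "block_sequence S \<rho> \<alpha> B P" using block_sequence_exists by blast
  then interpret block_sequence S \<rho> \<alpha> B P .
  have up: "upper_half_plane = {z. 1 * Im z > 0}" and low: "lower_half_plane = {z. -1 * Im z > 0}"
    by (simp_all add: upper_half_plane_def lower_half_plane_def)
  have finite_values: "sphere_map F -` {Some c} = {z. F z = c \<and> \<not> is_pole F z}" for c
    by (auto simp: sphere_map_def split: if_splits)
  show ?thesis
  proof (intro exI[of _ F] conjI allI impI)
    show "F nicely_meromorphic_on UNIV" by (rule F_nice)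
    show "F (cnj z) = cnj (F z)" for z by (rule F_cnj)
    show "sphere_map F -` {Some 0, Some 1, None} \<subseteq> \<real>"
    proof
      fix z assume "z \<in> sphere_map F -` {Some 0, Some 1, None}"
      hence "F z = 0 \<or> F z = 1 \<or> is_pole F z" by (auto simp: sphere_map_def split: if_splits)
      hence "Im z = 0" using F_nonreal by blast
      thus "z \<in> \<real>" by (simp add: complex_is_Real_iff)
    qed
    show "infinite (sphere_map F -` {Some 0})"
      using vertex_value[of 0] by (simp add: finite_values S_0 R0_vert_def R0_def)
    show "infinite (sphere_map F -` {Some 1})"
      using vertex_value[of 1] by (simp add: finite_values S_0 R0_vert_def R0_def)
    have "sphere_map F -` {None} = {z. is_pole F z}" by (auto simp: sphere_map_def split: if_splits)
    thus "infinite (sphere_map F -` {None})" using infinite_poles by simp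
    show "\<forall>H\<in>{upper_half_plane, lower_half_plane}. \<not> blaschke_condition (restrict_divisor (point_divisor F a) H)"
      if "a \<notin> {Some 0, Some 1, None}" for a
    proof -
      obtain c where "a = Some c" "c \<noteq> 0" "c \<noteq> 1" using \<open>a \<notin> _\<close> by (cases a) auto
      thus ?thesis using not_blaschke[of 1 c] not_blaschke[of "-1" c] unfolding up low by blast
    qed
    show "\<forall>H\<in>{upper_half_plane, lower_half_plane}. \<not> bounded_type_on F H"
      using not_bounded_type[of 1] not_bounded_type[of "-1"] unfolding up low by blast
  qed
qed

end
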